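(* Let $\mathbf T=(T_1,\ldots,T_n)$ be a pure $\mathbf{\Theta}_n$-contraction on a Hilbert space $\mathcal H$. Suppose that $\{A_l^{(i)}:0\le l\le p,\ 1\le i\le n-1\}\subseteq\mathcal B(\mathcal D_{T_n^*})$ satisfies $$A_l^{(i)}=\big(A_{p-l}^{(n-i)}\big)^*\quad(0\le l\le p)\qquad\text{and}\qquad D_{T_n^*}T_i^*=\sum_{l=0}^{p}A_l^{(i)*}D_{T_n^*}T_n^{*l},\qquad 1\le i\le n-1 .$$ On $\mathcal K=H^2(\mathbb D)\otimes\mathcal D_{T_n^*}$ consider the operators $$V_i=\sum_{l=0}^{p}M_z^l\otimes A_l^{(i)}\ (1\le i\le n-1),\qquad V_n=M_z\otimes I_{\mathcal D_{T_n^*}},$$ and put $\mathbf V=(V_1,\ldots,V_n)$. Let $W:\mathcal H\to\mathcal K$ be given by $Wh=\sum_{k\ge0}z^k\otimes D_{T_n^*}T_n^{*k}h$, $h\in\mathcal H$. Then $W$ is an isometry and $$W^*V_i=T_iW^*,\qquad 1\le i\le n.$$ Moreover, if $$\Big(\gamma_1\sum_{l=0}^{p}A_l^{(1)}z^l,\ \ldots,\ \gamma_{n-1}\sum_{l=0}^{p}A_l^{(n-1)}z^l\Big)$$ is a $\Gamma_{n-1}$-contraction for every $z\in\mathbb T$, then $\mathbf V$ is a minimal pure $\mathbf{\Theta}_n$-isometric dilation of $\mathbf T$ (with $\mathcal H$ identified with the subspace $W\mathcal H$ of $\mathcal K$ via $W$).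
   Context: Fix integers $n\ge2$, $m\ge1$, $p\ge1$ with $p\mid m$, and put $q=m/p$, $\gamma_i=\frac{n-i}{n}$ for $1\le i\le n-1$. $\mathbb D$ is the open unit disc, $\mathbb T$ the unit circle. For $r\ge1$ let $s_i(z_1,\ldots,z_r)=\sum_{1\le k_1<\cdots<k_i\le r}z_{k_1}\cdots z_{k_i}$ and $\Gamma_r=\{(s_1(z),\ldots,s_r(z)):z\in\overline{\mathbb D}^{\,r}\}$. Define $\boldsymbol\theta=(\theta_1,\ldots,\theta_n):\mathbb C^n\to\mathbb C^n$ by $\theta_i(z)=s_i(z_1^m,\ldots,z_n^m)$ for $1\le i\le n-1$ and $\theta_n(z)=(z_1\cdots z_n)^q$. Set $\mathbf{\Theta}_n=\boldsymbol\theta(\mathbb D^n)$, $\overline{\mathbf{\Theta}}_n=\boldsymbol\theta(\overline{\mathbb D}^{\,n})$ and $b\mathbf{\Theta}_n=\boldsymbol\theta(\mathbb T^n)$ (the distinguished boundary). A compact $X\subset\mathbb C^r$ is a spectral set for a commuting tuple $\mathbf S$ of $r$ bounded Hilbert space operators if its (Taylor) joint spectrum lies in $X$ and $\|f(\mathbf S)\|\le\sup_X|f|$ for every $f$ holomorphic on a neighbourhood of $X$. A $\Gamma_r$-contraction is a commuting $r$-tuple having $\Gamma_r$ as a spectral set. A $\mathbf{\Theta}_n$-contraction is a commuting $n$-tuple having $\overline{\mathbf{\Theta}}_n$ as a spectral set; it is pure if $T_n$ is a pure contraction, i.e. $T_n^{*k}\to0$ strongly as $k\to\infty$. A $\mathbf{\Theta}_n$-unitary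 is a commuting $n$-tuple of normal operators with joint spectrum in $b\mathbf{\Theta}_n$. A $\mathbf{\Theta}_n$-isometry is the restriction $(N_1|_{\mathcal L},\ldots,N_n|_{\mathcal L})$ of a $\mathbf{\Theta}_n$-unitary to a joint invariant subspace $\mathcal L$; it is pure if its last component is a pure isometry. For a contraction $S$, $D_S=(I-S^*S)^{1/2}$ and $\mathcal D_S=\overline{\operatorname{Ran}}\,D_S$. $H^2(\mathbb D)$ is the Hardy space of the disc and $M_z$ multiplication by $z$ on it. A commuting tuple $\mathbf V=(V_1,\ldots,V_n)$ on $\mathcal K\supseteq\mathcal H$ is a $\mathbf{\Theta}_n$-isometric dilation of a $\mathbf{\Theta}_n$-contraction $\mathbf T$ on $\mathcal H$ if $\mathbf V$ is a $\mathbf{\Theta}_n$-isometry and $V_i^*|_{\mathcal H}=T_i^*$ for $1\le i\le n$. It is minimal if $\mathcal K=\overline{\operatorname{span}}\{V_n^kh:h\in\mathcal H,\ k\ge0\}$, and pure if $\mathbf V$ is a pure $\mathbf{\Theta}_n$-isometry. *)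

theory Defs
  imports "HOL-Analysis.Analysis" "HOL-Algebra.Algebraic_Closure_Type"
begin

section \<open>Hilbert spaces and bounded operators\<close>

text \<open>
  A complex Hilbert space is a module over the field of complex numbers together with an inner
  product, linear in the first argument; the ring fields \<open>mult\<close> and \<open>one\<close> of the module record
  are irrelevant.  An operator is a HOL function of which only the values on the carrier of its
  domain matter, so equality of operators is always stated pointwise on the carrier.
\<close>

record 'a hspace = "(complex, 'a) module" +
  hinner :: "'a \<Rightarrow> 'a \<Rightarrow> complex"

definition hnorm :: "'a hspace \<Rightarrow> 'a \<Rightarrow> real" where
  "hnorm H x = sqrt (Re (hinner H x x))"

text \<open>The guard makes \<open>Metric_space (carrier H) (hdist H)\<close> hold: that locale requires
  nonnegativity and symmetry also off the carrier.\<close>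

definition hdist :: "'a hspace \<Rightarrow> 'a \<Rightarrow> 'a \<Rightarrow> real" where
  "hdist H x y = (if x \<in> carrier H \<and> y \<in> carrier H then hnorm H (x \<ominus>\<^bsub>H\<^esub> y) else 0)"

abbreviation htop :: "'a hspace \<Rightarrow> 'a topology" where
  "htop H \<equiv> Metric_space.mtopology (carrier H) (hdist H)"

definition hilbert_space :: "'a hspace \<Rightarrow> bool" where
  "hilbert_space H \<longleftrightarrow>
     Module.module (ring_of_type_algebra :: complex ring) H \<and>
     (\<forall>x\<in>carrier H. \<forall>y\<in>carrier H. \<forall>z\<in>carrier H.
        hinner H (x \<oplus>\<^bsub>H\<^esub> y) z = hinner H x z + hinner H y z) \<and>
     (\<forall>c. \<forall>x\<in>carrier H. \<forall>y\<in>carrier H. hinner H (c \<odot>\<^bsub>H\<^esub> x) y = c * hinner H x y) \<and>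
     (\<forall>x\<in>carrier H. \<forall>y\<in>carrier H. hinner H y x = cnj (hinner H x y)) \<and>
     (\<forall>x\<in>carrier H. 0 \<le> Re (hinner H x x)) \<and>
     (\<forall>x\<in>carrier H. hinner H x x = 0 \<longrightarrow> x = \<zero>\<^bsub>H\<^esub>) \<and>
     Metric_space.mcomplete (carrier H) (hdist H)"

definition hspan :: "'a hspace \<Rightarrow> 'a set \<Rightarrow> 'a set" where
  "hspan H S = {finsum H (\<lambda>x. c x \<odot>\<^bsub>H\<^esub> x) F | c F. finite F \<and> F \<subseteq> S}"

definition hsums :: "'a hspace \<Rightarrow> (nat \<Rightarrow> 'a) \<Rightarrow> 'a \<Rightarrow> bool" where
  "hsums H f s \<longleftrightarrow> limitin (htop H) (\<lambda>N. finsum H f {..<N}) s sequentially"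

definition hsuminf :: "'a hspace \<Rightarrow> (nat \<Rightarrow> 'a) \<Rightarrow> 'a" where
  "hsuminf H f = (THE s. hsums H f s)"

definition bounded_operator :: "'a hspace \<Rightarrow> 'b hspace \<Rightarrow> ('a \<Rightarrow> 'b) \<Rightarrow> bool" where
  "bounded_operator H K T \<longleftrightarrow>
     T \<in> carrier H \<rightarrow> carrier K \<and>
     (\<forall>x\<in>carrier H. \<forall>y\<in>carrier H. T (x \<oplus>\<^bsub>H\<^esub> y) = T x \<oplus>\<^bsub>K\<^esub> T y) \<and>
     (\<forall>c. \<forall>x\<in>carrier H. T (c \<odot>\<^bsub>H\<^esub> x) = c \<odot>\<^bsub>K\<^esub> T x) \<and>
     (\<exists>C. \<forall>x\<in>carrier H. hnorm K (T x) \<le> C * hnorm H x)"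

definition op_norm :: "'a hspace \<Rightarrow> ('a \<Rightarrow> 'a) \<Rightarrow> real" where
  "op_norm H T = (SUP x\<in>{x \<in> carrier H. hnorm H x \<le> 1}. hnorm H (T x))"

definition hadjoint :: "'a hspace \<Rightarrow> 'b hspace \<Rightarrow> ('a \<Rightarrow> 'b) \<Rightarrow> 'b \<Rightarrow> 'a" where
  "hadjoint H K T y =
     (THE x. x \<in> carrier H \<and> (\<forall>h\<in>carrier H. hinner K (T h) y = hinner H h x))"

definition hisometry :: "'a hspace \<Rightarrow> 'b hspace \<Rightarrow> ('a \<Rightarrow> 'b) \<Rightarrow> bool" where
  "hisometry H K W \<longleftrightarrow>
     bounded_operator H K W \<and> (\<forall>x\<in>carrier H. hnorm K (W x) = hnorm H x)"

definition normal_operator :: "'a hspace \<Rightarrow> ('a \<Rightarrow> 'a) \<Rightarrow> bool" where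
  "normal_operator H N \<longleftrightarrow>
     bounded_operator H H N \<and>
     (\<forall>x\<in>carrier H. N (hadjoint H H N x) = hadjoint H H N (N x))"

definition positive_operator :: "'a hspace \<Rightarrow> ('a \<Rightarrow> 'a) \<Rightarrow> bool" where
  "positive_operator H P \<longleftrightarrow>
     bounded_operator H H P \<and>
     (\<forall>x\<in>carrier H. Im (hinner H (P x) x) = 0 \<and> 0 \<le> Re (hinner H (P x) x))"

text \<open>The positive square root; \<open>SOME\<close> because it is unique only on the carrier.\<close>

definition hsqrt :: "'a hspace \<Rightarrow> ('a \<Rightarrow> 'a) \<Rightarrow> 'a \<Rightarrow> 'a" where
  "hsqrt H P = (SOME R. positive_operator H R \<and> (\<forall>x\<in>carrier H. R (R x) = P x))"

definition defect_operator :: "'a hspace \<Rightarrow> ('a \<Rightarrow> 'a) \<Rightarrow> 'a \<Rightarrow> 'a" where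
  "defect_operator H S = hsqrt H (\<lambda>x. x \<ominus>\<^bsub>H\<^esub> hadjoint H H S (S x))"

definition defect_space :: "'a hspace \<Rightarrow> ('a \<Rightarrow> 'a) \<Rightarrow> 'a hspace" where
  "defect_space H S = H\<lparr>carrier := htop H closure_of (defect_operator H S ` carrier H)\<rparr>"

definition strongly_stable_adjoint :: "'a hspace \<Rightarrow> ('a \<Rightarrow> 'a) \<Rightarrow> bool" where
  "strongly_stable_adjoint H S \<longleftrightarrow>
     (\<forall>x\<in>carrier H. limitin (htop H) (\<lambda>k. (hadjoint H H S ^^ k) x) \<zero>\<^bsub>H\<^esub> sequentially)"

definition pure_contraction :: "'a hspace \<Rightarrow> ('a \<Rightarrow> 'a) \<Rightarrow> bool" where
  "pure_contraction H S \<longleftrightarrow>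
     bounded_operator H H S \<and> (\<forall>x\<in>carrier H. hnorm H (S x) \<le> hnorm H x) \<and>
     strongly_stable_adjoint H S"

definition pure_isometry :: "'a hspace \<Rightarrow> ('a \<Rightarrow> 'a) \<Rightarrow> bool" where
  "pure_isometry H S \<longleftrightarrow> hisometry H H S \<and> strongly_stable_adjoint H S"


section \<open>Hardy space and Hilbert space tensor products\<close>

text \<open>Functions on the disc are represented by functions vanishing off the disc; \<open>taylor_coeff\<close>
  is the coefficient sequence of the power series at \<open>0\<close>.\<close>

definition taylor_coeff :: "(complex \<Rightarrow> complex) \<Rightarrow> nat \<Rightarrow> complex" where
  "taylor_coeff f k = (deriv ^^ k) f 0 / fact k"

definition hardy_space :: "(complex \<Rightarrow> complex) hspace" where
  "hardy_space =
     \<lparr>carrier = {f. f holomorphic_on ball 0 1 \<and> (\<forall>z. z \<notin> ball 0 1 \<longrightarrow> f z = 0) \<and>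
                   summable (\<lambda>k. (cmod (taylor_coeff f k))\<^sup>2)},
      monoid.mult = undefined, one = undefined,
      ring.zero = (\<lambda>z. 0), add = (\<lambda>f g z. f z + g z),
      smult = (\<lambda>c f z. c * f z),
      hinner = (\<lambda>f g. \<Sum>k. taylor_coeff f k * cnj (taylor_coeff g k))\<rparr>"

definition mult_z :: "(complex \<Rightarrow> complex) \<Rightarrow> complex \<Rightarrow> complex" where
  "mult_z f = (\<lambda>z. z * f z)"

definition hardy_monom :: "nat \<Rightarrow> complex \<Rightarrow> complex" where
  "hardy_monom k = (\<lambda>z. if z \<in> ball 0 1 then z ^ k else 0)"

text \<open>\<open>K\<close> together with the bilinear map \<open>tens\<close> is a Hilbert space tensor product of \<open>H1\<close> and
  \<open>H2\<close>; this determines \<open>(K, tens)\<close> up to a unique unitary preserving elementary tensors.\<close>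

definition hilbert_tensor ::
    "'a hspace \<Rightarrow> 'b hspace \<Rightarrow> 'k hspace \<Rightarrow> ('a \<Rightarrow> 'b \<Rightarrow> 'k) \<Rightarrow> bool" where
  "hilbert_tensor H1 H2 K tens \<longleftrightarrow>
     hilbert_space K \<and>
     (\<forall>f\<in>carrier H1. \<forall>x\<in>carrier H2. tens f x \<in> carrier K) \<and>
     (\<forall>f\<in>carrier H1. \<forall>g\<in>carrier H1. \<forall>x\<in>carrier H2.
        tens (f \<oplus>\<^bsub>H1\<^esub> g) x = tens f x \<oplus>\<^bsub>K\<^esub> tens g x) \<and>
     (\<forall>f\<in>carrier H1. \<forall>x\<in>carrier H2. \<forall>y\<in>carrier H2.
        tens f (x \<oplus>\<^bsub>H2\<^esub> y) = tens f x \<oplus>\<^bsub>K\<^esub> tens f y) \<and>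
     (\<forall>c. \<forall>f\<in>carrier H1. \<forall>x\<in>carrier H2.
        tens (c \<odot>\<^bsub>H1\<^esub> f) x = c \<odot>\<^bsub>K\<^esub> tens f x \<and> tens f (c \<odot>\<^bsub>H2\<^esub> x) = c \<odot>\<^bsub>K\<^esub> tens f x) \<and>
     (\<forall>f\<in>carrier H1. \<forall>g\<in>carrier H1. \<forall>x\<in>carrier H2. \<forall>y\<in>carrier H2.
        hinner K (tens f x) (tens g y) = hinner H1 f g * hinner H2 x y) \<and>
     htop K closure_of (hspan K {tens f x | f x. f \<in> carrier H1 \<and> x \<in> carrier H2}) = carrier K"

text \<open>The operator \<open>M \<otimes> A\<close>, unique on the carrier.\<close>

definition op_tensor ::
    "'a hspace \<Rightarrow> 'b hspace \<Rightarrow> 'k hspace \<Rightarrow> ('a \<Rightarrow> 'b \<Rightarrow> 'k) \<Rightarrow> ('a \<Rightarrow> 'a) \<Rightarrow> ('b \<Rightarrow> 'b) \<Rightarrow> 'k \<Rightarrow> 'k"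
  where
  "op_tensor H1 H2 K tens M A =
     (SOME B. bounded_operator K K B \<and>
        (\<forall>f\<in>carrier H1. \<forall>x\<in>carrier H2. B (tens f x) = tens (M f) (A x)))"


section \<open>Taylor joint spectrum\<close>

text \<open>Tuples are indexed by \<open>1..r\<close>; points of complex r-space are functions that vanish outside
  \<open>{1..r}\<close>, with the topology induced by the product topology.\<close>

definition cspace :: "nat \<Rightarrow> (nat \<Rightarrow> complex) set" where
  "cspace r = {z. \<forall>i. i \<notin> {1..r} \<longrightarrow> z i = 0}"

definition commuting_tuple :: "'a hspace \<Rightarrow> nat \<Rightarrow> (nat \<Rightarrow> 'a \<Rightarrow> 'a) \<Rightarrow> bool" where
  "commuting_tuple H r S \<longleftrightarrow>
     (\<forall>i\<in>{1..r}. bounded_operator H H (S i)) \<and>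
     (\<forall>i\<in>{1..r}. \<forall>j\<in>{1..r}. \<forall>x\<in>carrier H. S i (S j x) = S j (S i x))"

text \<open>The Koszul complex of \<open>S\<close>, all degrees at once: \<open>\<xi> I\<close> is the coefficient of
  \<open>e\<^sub>i\<^sub>1 \<and> \<dots> \<and> e\<^sub>i\<^sub>k\<close> for \<open>I = {i\<^sub>1 < \<dots> < i\<^sub>k}\<close>, and the differential is
  \<open>\<Sum>\<^sub>i S\<^sub>i \<otimes> (e\<^sub>i \<and> _)\<close>.  It is homogeneous, so total exactness is exactness in each degree.\<close>

definition koszul_d ::
    "'a hspace \<Rightarrow> (nat \<Rightarrow> 'a \<Rightarrow> 'a) \<Rightarrow> (nat set \<Rightarrow> 'a) \<Rightarrow> nat set \<Rightarrow> 'a" where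
  "koszul_d H S \<xi> I =
     finsum H (\<lambda>i. ((-1) ^ card {j\<in>I. j < i}) \<odot>\<^bsub>H\<^esub> S i (\<xi> (I - {i}))) I"

definition koszul_exact :: "'a hspace \<Rightarrow> nat \<Rightarrow> (nat \<Rightarrow> 'a \<Rightarrow> 'a) \<Rightarrow> bool" where
  "koszul_exact H r S \<longleftrightarrow>
     (\<forall>\<xi>\<in>Pow {1..r} \<rightarrow> carrier H.
        (\<forall>I\<in>Pow {1..r}. koszul_d H S \<xi> I = \<zero>\<^bsub>H\<^esub>) \<longrightarrow>
        (\<exists>\<eta>\<in>Pow {1..r} \<rightarrow> carrier H. \<forall>I\<in>Pow {1..r}. \<xi> I = koszul_d H S \<eta> I))"

definition taylor_spectrum ::
    "'a hspace \<Rightarrow> nat \<Rightarrow> (nat \<Rightarrow> 'a \<Rightarrow> 'a) \<Rightarrow> (nat \<Rightarrow> complex) set" where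
  "taylor_spectrum H r S =
     {w \<in> cspace r. \<not> koszul_exact H r (\<lambda>i x. S i x \<ominus>\<^bsub>H\<^esub> w i \<odot>\<^bsub>H\<^esub> x)}"


section \<open>Holomorphic functional calculus and spectral sets\<close>

definition holomorphic_several ::
    "nat \<Rightarrow> (nat \<Rightarrow> complex) set \<Rightarrow> ((nat \<Rightarrow> complex) \<Rightarrow> complex) \<Rightarrow> bool" where
  "holomorphic_several r U f \<longleftrightarrow>
     openin (top_of_set (cspace r)) U \<and> continuous_on U f \<and>
     (\<forall>z\<in>U. \<forall>i\<in>{1..r}. (\<lambda>w. f (z(i := w))) field_differentiable at (z i))"

definition holomorphic_near ::
    "nat \<Rightarrow> (nat \<Rightarrow> complex) set \<Rightarrow> ((nat \<Rightarrow> complex) \<Rightarrow> complex) \<Rightarrow> bool" where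
  "holomorphic_near r Q f \<longleftrightarrow> (\<exists>U. Q \<subseteq> U \<and> holomorphic_several r U f)"

text \<open>\<open>f \<mapsto> \<Phi> f\<close> is Taylor's functional calculus \<open>f \<mapsto> f(S)\<close>, given by its defining properties: a
  unital continuous algebra homomorphism on germs of holomorphic functions near the Taylor
  spectrum that sends the coordinate functions to the entries of \<open>S\<close> and satisfies the spectral
  mapping property for tuples of functions.  It exists by Taylor's theorem and is unique by
  Putinar's theorem (Uniqueness of Taylor's functional calculus, 1983).\<close>

definition taylor_calculus ::
    "'a hspace \<Rightarrow> nat \<Rightarrow> (nat \<Rightarrow> 'a \<Rightarrow> 'a) \<Rightarrow> (((nat \<Rightarrow> complex) \<Rightarrow> complex) \<Rightarrow> 'a \<Rightarrow> 'a) \<Rightarrow> bool"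
  where
  "taylor_calculus H r S \<Phi> \<longleftrightarrow>
     (\<forall>f. holomorphic_near r (taylor_spectrum H r S) f \<longrightarrow> bounded_operator H H (\<Phi> f)) \<and>
     (\<forall>U f g. taylor_spectrum H r S \<subseteq> U \<longrightarrow>
        holomorphic_several r U f \<longrightarrow> holomorphic_several r U g \<longrightarrow> (\<forall>z\<in>U. f z = g z) \<longrightarrow>
        (\<forall>x\<in>carrier H. \<Phi> f x = \<Phi> g x)) \<and>
     (\<forall>c. \<forall>x\<in>carrier H. \<Phi> (\<lambda>z. c) x = c \<odot>\<^bsub>H\<^esub> x) \<and>
     (\<forall>i\<in>{1..r}. \<forall>x\<in>carrier H. \<Phi> (\<lambda>z. z i) x = S i x) \<and>
     (\<forall>f g. holomorphic_near r (taylor_spectrum H r S) f \<longrightarrow>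
        holomorphic_near r (taylor_spectrum H r S) g \<longrightarrow>
        (\<forall>x\<in>carrier H. \<Phi> (\<lambda>z. f z + g z) x = \<Phi> f x \<oplus>\<^bsub>H\<^esub> \<Phi> g x \<and>
                       \<Phi> (\<lambda>z. f z * g z) x = \<Phi> f (\<Phi> g x))) \<and>
     (\<forall>U F f. taylor_spectrum H r S \<subseteq> U \<longrightarrow>
        (\<forall>k. holomorphic_several r U (F k)) \<longrightarrow> holomorphic_several r U f \<longrightarrow>
        (\<forall>C. compact C \<longrightarrow> C \<subseteq> U \<longrightarrow> uniform_limit C F f sequentially) \<longrightarrow>
        (\<lambda>k. op_norm H (\<lambda>x. \<Phi> (F k) x \<ominus>\<^bsub>H\<^esub> \<Phi> f x)) \<longlonglongrightarrow> 0) \<and>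
     (\<forall>s F. (\<forall>j\<in>{1..s}. holomorphic_near r (taylor_spectrum H r S) (F j)) \<longrightarrow>
        taylor_spectrum H s (\<lambda>j. \<Phi> (F j)) =
          (\<lambda>z j. if j \<in> {1..s} then F j z else 0) ` taylor_spectrum H r S)"

text \<open>Because the calculus exists and is unique, \<open>\<exists>\<Phi>\<close> below only names \<open>f \<mapsto> f(S)\<close>.\<close>

definition spectral_set ::
    "'a hspace \<Rightarrow> nat \<Rightarrow> (nat \<Rightarrow> complex) set \<Rightarrow> (nat \<Rightarrow> 'a \<Rightarrow> 'a) \<Rightarrow> bool" where
  "spectral_set H r Q S \<longleftrightarrow>
     commuting_tuple H r S \<and> taylor_spectrum H r S \<subseteq> Q \<and>
     (\<exists>\<Phi>. taylor_calculus H r S \<Phi> \<and>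
        (\<forall>f. holomorphic_near r Q f \<longrightarrow> op_norm H (\<Phi> f) \<le> (SUP z\<in>Q. cmod (f z))))"


section \<open>The symmetrized polydisc and the domain Theta\<close>

definition esym :: "nat \<Rightarrow> nat \<Rightarrow> (nat \<Rightarrow> complex) \<Rightarrow> complex" where
  "esym r i z = (\<Sum>A | A \<subseteq> {1..r} \<and> card A = i. \<Prod>k\<in>A. z k)"

definition Gamma_set :: "nat \<Rightarrow> (nat \<Rightarrow> complex) set" where
  "Gamma_set r =
     (\<lambda>z i. if i \<in> {1..r} then esym r i z else 0) ` {z \<in> cspace r. \<forall>k\<in>{1..r}. cmod (z k) \<le> 1}"

definition theta_map :: "nat \<Rightarrow> nat \<Rightarrow> nat \<Rightarrow> (nat \<Rightarrow> complex) \<Rightarrow> nat \<Rightarrow> complex" where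
  "theta_map n m p z =
     (\<lambda>i. if i \<in> {1..n - 1} then esym n i (\<lambda>k. z k ^ m)
          else if i = n then (\<Prod>k\<in>{1..n}. z k) ^ (m div p) else 0)"

definition Theta_closed :: "nat \<Rightarrow> nat \<Rightarrow> nat \<Rightarrow> (nat \<Rightarrow> complex) set" where
  "Theta_closed n m p = theta_map n m p ` {z \<in> cspace n. \<forall>k\<in>{1..n}. cmod (z k) \<le> 1}"

definition Theta_boundary :: "nat \<Rightarrow> nat \<Rightarrow> nat \<Rightarrow> (nat \<Rightarrow> complex) set" where
  "Theta_boundary n m p = theta_map n m p ` {z \<in> cspace n. \<forall>k\<in>{1..n}. cmod (z k) = 1}"

definition Gamma_contraction :: "nat \<Rightarrow> 'a hspace \<Rightarrow> (nat \<Rightarrow> 'a \<Rightarrow> 'a) \<Rightarrow> bool" where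
  "Gamma_contraction r H S \<longleftrightarrow> spectral_set H r (Gamma_set r) S"

definition Theta_contraction ::
    "nat \<Rightarrow> nat \<Rightarrow> nat \<Rightarrow> 'a hspace \<Rightarrow> (nat \<Rightarrow> 'a \<Rightarrow> 'a) \<Rightarrow> bool" where
  "Theta_contraction n m p H T \<longleftrightarrow> spectral_set H n (Theta_closed n m p) T"

definition pure_Theta_contraction ::
    "nat \<Rightarrow> nat \<Rightarrow> nat \<Rightarrow> 'a hspace \<Rightarrow> (nat \<Rightarrow> 'a \<Rightarrow> 'a) \<Rightarrow> bool" where
  "pure_Theta_contraction n m p H T \<longleftrightarrow> Theta_contraction n m p H T \<and> pure_contraction H (T n)"

definition Theta_unitary ::
    "nat \<Rightarrow> nat \<Rightarrow> nat \<Rightarrow> 'a hspace \<Rightarrow> (nat \<Rightarrow> 'a \<Rightarrow> 'a) \<Rightarrow> bool" where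
  "Theta_unitary n m p L N \<longleftrightarrow>
     commuting_tuple L n N \<and> (\<forall>i\<in>{1..n}. normal_operator L (N i)) \<and>
     taylor_spectrum L n N \<subseteq> Theta_boundary n m p"

text \<open>\<open>V\<close> is, via the isometric embedding \<open>J\<close>, the restriction of the Theta-unitary \<open>N\<close> on \<open>L\<close> to
  the joint invariant subspace \<open>J K\<close>.  HOL has no quantification over types, so \<open>L\<close> lives on
  \<open>int \<Rightarrow> 'k\<close>.  This loses nothing: replacing \<open>L\<close> by the smallest subspace that contains \<open>J K\<close>
  and reduces \<open>N\<close>, its dimension is at most that of \<open>K\<close> if \<open>K\<close> is infinite-dimensional, and it is
  \<open>J K\<close> itself if \<open>K\<close> is finite-dimensional.\<close>

definition Theta_isometry ::
    "nat \<Rightarrow> nat \<Rightarrow> nat \<Rightarrow> 'k hspace \<Rightarrow> (nat \<Rightarrow> 'k \<Rightarrow> 'k) \<Rightarrow> bool" where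
  "Theta_isometry n m p K V \<longleftrightarrow>
     (\<forall>i\<in>{1..n}. bounded_operator K K (V i)) \<and>
     (\<exists>(L :: (int \<Rightarrow> 'k) hspace) N J.
        hilbert_space L \<and> Theta_unitary n m p L N \<and> hisometry K L J \<and>
        (\<forall>i\<in>{1..n}. \<forall>x\<in>carrier K. N i (J x) = J (V i x)))"

definition pure_Theta_isometry ::
    "nat \<Rightarrow> nat \<Rightarrow> nat \<Rightarrow> 'k hspace \<Rightarrow> (nat \<Rightarrow> 'k \<Rightarrow> 'k) \<Rightarrow> bool" where
  "pure_Theta_isometry n m p K V \<longleftrightarrow> Theta_isometry n m p K V \<and> pure_isometry K (V n)"

text \<open>In the dilation notions \<open>H\<close> is identified with the subspace \<open>W H\<close> of \<open>K\<close>.\<close>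

definition Theta_isometric_dilation ::
    "nat \<Rightarrow> nat \<Rightarrow> nat \<Rightarrow> 'h hspace \<Rightarrow> (nat \<Rightarrow> 'h \<Rightarrow> 'h) \<Rightarrow> 'k hspace \<Rightarrow> (nat \<Rightarrow> 'k \<Rightarrow> 'k) \<Rightarrow>
       ('h \<Rightarrow> 'k) \<Rightarrow> bool" where
  "Theta_isometric_dilation n m p H T K V W \<longleftrightarrow>
     Theta_contraction n m p H T \<and> Theta_isometry n m p K V \<and> hisometry H K W \<and>
     (\<forall>i\<in>{1..n}. \<forall>h\<in>carrier H. hadjoint K K (V i) (W h) = W (hadjoint H H (T i) h))"

definition minimal_dilation ::
    "nat \<Rightarrow> 'h hspace \<Rightarrow> 'k hspace \<Rightarrow> (nat \<Rightarrow> 'k \<Rightarrow> 'k) \<Rightarrow> ('h \<Rightarrow> 'k) \<Rightarrow> bool" where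
  "minimal_dilation n H K V W \<longleftrightarrow>
     htop K closure_of (hspan K {(V n ^^ k) (W h) | k h. h \<in> carrier H}) = carrier K"

end

(*
  W is an isometry because the norms |D Ts^k h|^2 telescope, and V_i^* W = W T_i^* is the
  fundamental equation read coefficientwise.

  The Laurent operators N_i with the coefficients A_l^(i) on two-sided sequences extend V, and with
  the bilateral shift U = N_n one has N_i^* = U^(-p) N_(n-i), so N is a commuting tuple of normal
  operators.  A point w of its joint spectrum is a joint approximate eigenvalue; otherwise
  P = sum_i (N_i - w_i)^* (N_i - w_i) is invertible and the operators P^(-1) (N_i - w_i)^* contract
  the Koszul complex.  Hence |w_n| = 1, w_i = w_n^p conj(w_(n-i)), and (w_1, ..., w_(n-1)) is a joint
  approximate eigenvalue of the symbols at z = w_n.  The functional calculus of the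
  Gamma-contraction there inverts the operator obtained from t^(n-1) - s_1 t^(n-2) + ... for |t| > 1,
  so the derivative of the self-inversive polynomial t^n - w_1 t^(n-1) + ... + (-1)^n w_n^p has no
  zero outside the closed disc.  By Cohn's theorem all zeros of that polynomial lie on the circle,
  which puts w into the distinguished boundary.
*)

theory Submission
  imports Defs "HOL-Complex_Analysis.Complex_Analysis"
begin

section \<open>Hilbert spaces\<close>

text \<open>The weights (n-i)/n come from differentiation: the derivative of t^n - w_1 t^(n-1) + ...
  is n times t^(n-1) - gamma_1 w_1 t^(n-2) + ..., and a point of Gamma_(n-1) lists, up to signs, the
  coefficients of a monic polynomial of degree n-1 with all zeros in the closed disc. The hypothesis
  on the symbols thus speaks about critical points, and Cohn's theorem carries it to the zeros. The
  obstacle is that the approximate eigenvectors are two-sided sequences, whereas the hypothesis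
  concerns operators on the coefficient space at one fixed z. Along such a sequence U acts almost as
  w_n, so a Laurent operator may be replaced by its symbol at z = w_n acting in every coordinate,
  and a lower bound on the coefficient space holds on sequences with the same constant. Commutation
  travels the other way: for all z on the circle it is an identity of operator polynomials, hence
  one of coefficients. The zeros fix only the numbers z_k^m and the p-th power of the last
  coordinate; the freedom in the choice of m-th roots adjusts that coordinate itself.\<close>

locale prehilbert =
  fixes H :: "'a hspace" (structure)
  assumes module: "module (ring_of_type_algebra :: complex ring) H"
    and inner_add_left [simp]: "\<lbrakk>x \<in> carrier H; y \<in> carrier H; z \<in> carrier H\<rbrakk> \<Longrightarrow>
      hinner H (x \<oplus> y) z = hinner H x z + hinner H y z"
    and inner_smult_left [simp]: "\<lbrakk>x \<in> carrier H; y \<in> carrier H\<rbrakk> \<Longrightarrow>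
      hinner H (c \<odot> x) y = c * hinner H x y"
    and inner_commute: "\<lbrakk>x \<in> carrier H; y \<in> carrier H\<rbrakk> \<Longrightarrow> hinner H y x = cnj (hinner H x y)"
    and inner_self_nonneg: "x \<in> carrier H \<Longrightarrow> 0 \<le> Re (hinner H x x)"
    and inner_self_eq_0D: "\<lbrakk>x \<in> carrier H; hinner H x x = 0\<rbrakk> \<Longrightarrow> x = \<zero>"
begin

sublocale abelian_group H
  using module by (rule module.axioms(2))

lemma smult_closed [simp, intro]: "x \<in> carrier H \<Longrightarrow> c \<odot> x \<in> carrier H"
  using module.smult_closed[OF module] by (simp add: ring_of_type_algebra_def)

lemma smult_add_left: "x \<in> carrier H \<Longrightarrow> (a + b) \<odot> x = a \<odot> x \<oplus> b \<odot> x"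
  using module.smult_l_distr[OF module] by (simp add: ring_of_type_algebra_def)

lemma smult_add_right:
  "x \<in> carrier H \<Longrightarrow> y \<in> carrier H \<Longrightarrow> a \<odot> (x \<oplus> y) = a \<odot> x \<oplus> a \<odot> y"
  using module.smult_r_distr[OF module] by (simp add: ring_of_type_algebra_def)

lemma smult_assoc: "x \<in> carrier H \<Longrightarrow> (a * b) \<odot> x = a \<odot> (b \<odot> x)"
  using module.smult_assoc1[OF module] by (simp add: ring_of_type_algebra_def)

lemma smult_one [simp]: "x \<in> carrier H \<Longrightarrow> 1 \<odot> x = x"
  using module.smult_one[OF module] by (simp add: ring_of_type_algebra_def)

lemma inner_add_right [simp]:
  assumes "x \<in> carrier H" "y \<in> carrier H" "z \<in> carrier H"
  shows "hinner H z (x \<oplus> y) = hinner H z x + hinner H z y"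
  using assms inner_commute[of "x \<oplus> y" z] inner_commute[of x z] inner_commute[of y z] by simp

lemma inner_smult_right [simp]:
  assumes "x \<in> carrier H" "y \<in> carrier H"
  shows "hinner H x (c \<odot> y) = cnj c * hinner H x y"
  using assms inner_commute[of "c \<odot> y" x] inner_commute[of y x] by simp

lemma inner_zero_left [simp]: "x \<in> carrier H \<Longrightarrow> hinner H \<zero> x = 0"
  using inner_add_left[of \<zero> \<zero> x] by simp

lemma inner_zero_right [simp]: "x \<in> carrier H \<Longrightarrow> hinner H x \<zero> = 0"
  using inner_commute[of \<zero> x] by simp

lemma inner_inv_left [simp]:
  "x \<in> carrier H \<Longrightarrow> y \<in> carrier H \<Longrightarrow> hinner H (\<ominus> x) y = - hinner H x y"
  using inner_add_left[of x "\<ominus> x" y] by (simp add: r_neg add_eq_0_iff)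

lemma inner_diff_left [simp]:
  "x \<in> carrier H \<Longrightarrow> y \<in> carrier H \<Longrightarrow> z \<in> carrier H \<Longrightarrow>
     hinner H (x \<ominus> y) z = hinner H x z - hinner H y z"
  by (simp add: a_minus_def)

lemma inner_diff_right [simp]:
  assumes "x \<in> carrier H" "y \<in> carrier H" "z \<in> carrier H"
  shows "hinner H z (x \<ominus> y) = hinner H z x - hinner H z y"
  using assms inner_commute[of "x \<ominus> y" z] inner_commute[of x z] inner_commute[of y z] by simp

lemma inner_finsum_left:
  assumes "finite F" "\<And>i. i \<in> F \<Longrightarrow> f i \<in> carrier H" "y \<in> carrier H"
  shows "hinner H (finsum H f F) y = (\<Sum>i\<in>F. hinner H (f i) y)"
  using assms by (induction F rule: finite_induct) (auto simp: Pi_iff)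

lemma inner_finsum_right:
  assumes "finite F" "\<And>i. i \<in> F \<Longrightarrow> f i \<in> carrier H" "y \<in> carrier H"
  shows "hinner H y (finsum H f F) = (\<Sum>i\<in>F. hinner H y (f i))"
  using assms by (induction F rule: finite_induct) (auto simp: Pi_iff)

lemma inner_self: "x \<in> carrier H \<Longrightarrow> hinner H x x = of_real ((hnorm H x)\<^sup>2)"
  using inner_commute[of x x] inner_self_nonneg[of x]
  by (simp add: hnorm_def complex_eq_iff)

lemma norm_sq: "x \<in> carrier H \<Longrightarrow> (hnorm H x)\<^sup>2 = Re (hinner H x x)"
  by (simp add: inner_self)

lemma norm_nonneg [simp]: "x \<in> carrier H \<Longrightarrow> 0 \<le> hnorm H x"
  by (simp add: hnorm_def inner_self_nonneg)

lemma norm_eq_0_iff [simp]: "x \<in> carrier H \<Longrightarrow> hnorm H x = 0 \<longleftrightarrow> x = \<zero>"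
proof
  assume x: "x \<in> carrier H" and "hnorm H x = 0"
  then have "hinner H x x = 0" using inner_self[of x] by simp
  then show "x = \<zero>" using x by (rule inner_self_eq_0D[rotated])
qed (simp add: hnorm_def)

lemma minus_eq_zero_iff: "x \<in> carrier H \<Longrightarrow> y \<in> carrier H \<Longrightarrow> x \<ominus> y = \<zero> \<longleftrightarrow> x = y"
  unfolding a_minus_def by (metis a_assoc a_inv_closed l_neg l_zero r_neg r_zero)

text \<open>Definiteness of the inner product at x - y. It turns a vector identity into one between
  complex numbers, which the simplifier settles; most identities in the module are proved this
  way.\<close>

lemma eqI:
  assumes "x \<in> carrier H" "y \<in> carrier H"
    and "\<And>v. v \<in> carrier H \<Longrightarrow> hinner H x v = hinner H y v"
  shows "x = y"
proof -
  have "hinner H (x \<ominus> y) (x \<ominus> y) = 0" using assms by simp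
  then have "x \<ominus> y = \<zero>" using assms by (simp add: inner_self)
  then show ?thesis using assms by (simp add: minus_eq_zero_iff)
qed

lemma norm_smult [simp]: "x \<in> carrier H \<Longrightarrow> hnorm H (c \<odot> x) = cmod c * hnorm H x"
proof (rule power2_eq_imp_eq)
  assume x: "x \<in> carrier H"
  have "complex_of_real ((hnorm H (c \<odot> x))\<^sup>2) = of_real ((cmod c * hnorm H x)\<^sup>2)"
    using x inner_self[of "c \<odot> x"] inner_self[of x]
    unfolding power_mult_distrib of_real_mult complex_norm_square[of c] by (simp add: ac_simps)
  then show "(hnorm H (c \<odot> x))\<^sup>2 = (cmod c * hnorm H x)\<^sup>2" using of_real_eq_iff by blast
qed auto

lemma norm_zero [simp]: "hnorm H \<zero> = 0"
  by simp

lemma norm_add_sq: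
  assumes "x \<in> carrier H" "y \<in> carrier H"
  shows "(hnorm H (x \<oplus> y))\<^sup>2 = (hnorm H x)\<^sup>2 + 2 * Re (hinner H x y) + (hnorm H y)\<^sup>2"
  using assms inner_commute[of x y] by (simp add: norm_sq)

lemma norm_diff_sq:
  assumes "x \<in> carrier H" "y \<in> carrier H"
  shows "(hnorm H (x \<ominus> y))\<^sup>2 = (hnorm H x)\<^sup>2 - 2 * Re (hinner H x y) + (hnorm H y)\<^sup>2"
  using assms inner_commute[of x y] by (simp add: norm_sq)

lemma Cauchy_Schwarz:
  assumes x: "x \<in> carrier H" and y: "y \<in> carrier H"
  shows "cmod (hinner H x y) \<le> hnorm H x * hnorm H y"
proof (cases "y = \<zero>")
  case True
  then show ?thesis using x by simp
next
  case False
  let ?a = "hinner H x y" and ?n = "(hnorm H y)\<^sup>2"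
  \<comment> \<open>\<open>t\<close> times \<open>y\<close> is the orthogonal projection of
    \<open>x\<close> onto the line through \<open>y\<close>; the squared norm of the remainder is
    nonnegative.\<close>
  define t where "t = ?a / of_real ?n"
  have n: "?n > 0" using False y by simp
  have t: "cmod t = cmod ?a / ?n" by (simp add: t_def norm_divide norm_power)
  have "Re (hinner H x (t \<odot> y)) = (cmod ?a)\<^sup>2 / ?n"
    using x y by (simp add: t_def mult.commute flip: complex_norm_square)
  moreover have "(hnorm H (t \<odot> y))\<^sup>2 = (cmod ?a)\<^sup>2 / ?n"
  proof -
    have "hnorm H y \<noteq> 0" using n by auto
    then have "(cmod ?a / ?n * hnorm H y)\<^sup>2 = (cmod ?a)\<^sup>2 / ?n"
      by (simp add: field_simps power2_eq_square)
    then show ?thesis using y t by simp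
  qed
  ultimately have "0 \<le> (hnorm H x)\<^sup>2 - (cmod ?a)\<^sup>2 / ?n"
    using norm_diff_sq[of x "t \<odot> y"] x y zero_le_power2[of "hnorm H (x \<ominus> t \<odot> y)"] by simp
  then have "(cmod ?a)\<^sup>2 \<le> (hnorm H x * hnorm H y)\<^sup>2"
    using n by (simp add: field_simps power_mult_distrib)
  then show ?thesis using x y by (simp add: power2_le_iff_abs_le abs_le_square_iff)
qed

lemma norm_triangle:
  assumes "x \<in> carrier H" "y \<in> carrier H"
  shows "hnorm H (x \<oplus> y) \<le> hnorm H x + hnorm H y"
proof (rule power2_le_imp_le)
  have "Re (hinner H x y) \<le> hnorm H x * hnorm H y"
    using Cauchy_Schwarz[OF assms] complex_Re_le_cmod order_trans by blast
  then show "(hnorm H (x \<oplus> y))\<^sup>2 \<le> (hnorm H x + hnorm H y)\<^sup>2"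
    using assms by (simp add: norm_add_sq power2_sum)
qed (use assms in auto)

lemma inv_eq_smult: "x \<in> carrier H \<Longrightarrow> \<ominus> x = (-1) \<odot> x"
  by (rule eqI) auto

lemma norm_inv [simp]: "x \<in> carrier H \<Longrightarrow> hnorm H (\<ominus> x) = hnorm H x"
  by (simp add: inv_eq_smult)

lemma norm_triangle_diff:
  assumes "x \<in> carrier H" "y \<in> carrier H"
  shows "hnorm H (x \<ominus> y) \<le> hnorm H x + hnorm H y"
  using norm_triangle[of x "\<ominus> y"] assms by (simp add: a_minus_def)

lemma norm_diff_triangle:
  assumes "x \<in> carrier H" "y \<in> carrier H" "z \<in> carrier H"
  shows "hnorm H (x \<ominus> z) \<le> hnorm H (x \<ominus> y) + hnorm H (y \<ominus> z)"
proof -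
  have "x \<ominus> z = (x \<ominus> y) \<oplus> (y \<ominus> z)" by (rule eqI) (use assms in auto)
  then show ?thesis using norm_triangle[of "x \<ominus> y" "y \<ominus> z"] assms by simp
qed

lemma norm_diff_commute:
  assumes "x \<in> carrier H" "y \<in> carrier H"
  shows "hnorm H (x \<ominus> y) = hnorm H (y \<ominus> x)"
proof -
  have "x \<ominus> y = \<ominus> (y \<ominus> x)" by (rule eqI) (use assms in auto)
  then show ?thesis using assms by simp
qed

lemma diff_zero [simp]: "x \<in> carrier H \<Longrightarrow> x \<ominus> \<zero> = x"
  by (rule eqI) auto

lemma norm_diff_ge:
  assumes "x \<in> carrier H" "y \<in> carrier H"
  shows "\<bar>hnorm H x - hnorm H y\<bar> \<le> hnorm H (x \<ominus> y)"
  using norm_diff_triangle[of x y \<zero>] norm_diff_triangle[of y x \<zero>] norm_diff_commute[OF assms] assms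
  by simp

section \<open>Norm convergence, closures and completeness\<close>

sublocale Met: Metric_space "carrier H" "hdist H"
proof
  fix x y z
  show "0 \<le> hdist H x y" by (simp add: hdist_def)
  show "hdist H x y = hdist H y x" using norm_diff_commute by (simp add: hdist_def)
  show "x \<in> carrier H \<Longrightarrow> y \<in> carrier H \<Longrightarrow> hdist H x y = 0 \<longleftrightarrow> x = y"
    by (simp add: hdist_def minus_eq_zero_iff)
  show "x \<in> carrier H \<Longrightarrow> y \<in> carrier H \<Longrightarrow> z \<in> carrier H \<Longrightarrow>
    hdist H x z \<le> hdist H x y + hdist H y z"
    using norm_diff_triangle by (simp add: hdist_def)
qed

text \<open>\<open>limitin\<close> asks for membership in the carrier only eventually. Here it is
  part of the definition for every index, so that a convergence assumption supplies all carrier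
  conditions.\<close>

definition hlim :: "(nat \<Rightarrow> 'a) \<Rightarrow> 'a \<Rightarrow> bool" where
  "hlim f x \<longleftrightarrow> x \<in> carrier H \<and> (\<forall>k. f k \<in> carrier H) \<and> (\<lambda>k. hnorm H (f k \<ominus> x)) \<longlonglongrightarrow> 0"

lemma hlimI:
  "x \<in> carrier H \<Longrightarrow> (\<And>k. f k \<in> carrier H) \<Longrightarrow> (\<lambda>k. hnorm H (f k \<ominus> x)) \<longlonglongrightarrow> 0 \<Longrightarrow> hlim f x"
  by (simp add: hlim_def)

lemma limitin_iff_hlim:
  assumes "\<And>k. f k \<in> carrier H"
  shows "limitin (htop H) f x sequentially \<longleftrightarrow> hlim f x"
  using assms by (auto simp: Met.limitin_metric_dist_null hlim_def hdist_def)

lemma hlim_norm_bound: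
  assumes "x \<in> carrier H" "\<And>k. f k \<in> carrier H" "\<And>k. hnorm H (f k \<ominus> x) \<le> b k" "b \<longlonglongrightarrow> 0"
  shows "hlim f x"
  unfolding hlim_def
  by (intro conjI allI assms(1,2) tendsto_sandwich[OF _ _ tendsto_const assms(4)])
    (auto simp: assms)

lemma hlim_inner:
  assumes "hlim f x" "v \<in> carrier H"
  shows "(\<lambda>k. hinner H (f k) v) \<longlonglongrightarrow> hinner H x v"
proof -
  have c: "x \<in> carrier H" "f k \<in> carrier H" for k using assms by (auto simp: hlim_def)
  have "(\<lambda>k. hnorm H (f k \<ominus> x) * hnorm H v) \<longlonglongrightarrow> 0"
    using assms tendsto_mult_left_zero by (auto simp: hlim_def)
  then have "(\<lambda>k. hinner H (f k) v - hinner H x v) \<longlonglongrightarrow> 0"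
    by (rule Lim_null_comparison[rotated])
      (use Cauchy_Schwarz[of "f _ \<ominus> x" v] c assms(2) in auto)
  then show ?thesis by (simp add: LIM_zero_iff)
qed

lemma hlim_inner_right:
  assumes "hlim f x" "v \<in> carrier H"
  shows "(\<lambda>k. hinner H v (f k)) \<longlonglongrightarrow> hinner H v x"
proof -
  have "(\<lambda>k. cnj (hinner H (f k) v)) \<longlonglongrightarrow> cnj (hinner H x v)"
    using hlim_inner[OF assms] tendsto_cnj by blast
  moreover have "x \<in> carrier H" "f k \<in> carrier H" for k using assms by (auto simp: hlim_def)
  ultimately show ?thesis using assms(2) by (simp flip: inner_commute)
qed

lemma hlim_norm:
  assumes "hlim f x"
  shows "(\<lambda>k. hnorm H (f k)) \<longlonglongrightarrow> hnorm H x"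
proof -
  have c: "x \<in> carrier H" "f k \<in> carrier H" for k using assms by (auto simp: hlim_def)
  have "(\<lambda>k. hnorm H (f k \<ominus> x)) \<longlonglongrightarrow> 0" using assms by (simp add: hlim_def)
  then have "(\<lambda>k. hnorm H (f k) - hnorm H x) \<longlonglongrightarrow> 0"
    by (rule Lim_null_comparison[rotated]) (use norm_diff_ge c in auto)
  then show ?thesis by (simp add: LIM_zero_iff)
qed

lemma hlim_unique:
  assumes "hlim f x" "hlim f y"
  shows "x = y"
proof (rule eqI)
  show "x \<in> carrier H" "y \<in> carrier H" using assms by (auto simp: hlim_def)
  show "hinner H x v = hinner H y v" if "v \<in> carrier H" for v
    using hlim_inner[OF assms(1) that] hlim_inner[OF assms(2) that] LIMSEQ_unique by blast
qed

lemma hlim_add: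
  assumes "hlim f x" "hlim g y"
  shows "hlim (\<lambda>k. f k \<oplus> g k) (x \<oplus> y)"
proof -
  have c: "x \<in> carrier H" "f k \<in> carrier H" "y \<in> carrier H" "g k \<in> carrier H" for k
    using assms by (auto simp: hlim_def)
  have "(f k \<oplus> g k) \<ominus> (x \<oplus> y) = (f k \<ominus> x) \<oplus> (g k \<ominus> y)" for k
    by (rule eqI) (use c in auto)
  then have "hnorm H ((f k \<oplus> g k) \<ominus> (x \<oplus> y)) \<le> hnorm H (f k \<ominus> x) + hnorm H (g k \<ominus> y)" for k
    using norm_triangle c by simp
  moreover have "(\<lambda>k. hnorm H (f k \<ominus> x) + hnorm H (g k \<ominus> y)) \<longlonglongrightarrow> 0"
    using assms tendsto_add_zero by (auto simp: hlim_def)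
  ultimately show ?thesis using c by (intro hlim_norm_bound) auto
qed

lemma hlim_smult:
  assumes "hlim f x"
  shows "hlim (\<lambda>k. c \<odot> f k) (c \<odot> x)"
proof -
  have c: "x \<in> carrier H" "f k \<in> carrier H" for k using assms by (auto simp: hlim_def)
  have "c \<odot> f k \<ominus> c \<odot> x = c \<odot> (f k \<ominus> x)" for k
    by (rule eqI) (use c in \<open>auto simp: algebra_simps\<close>)
  then have "hnorm H (c \<odot> f k \<ominus> c \<odot> x) = cmod c * hnorm H (f k \<ominus> x)" for k
    using c by simp
  then show ?thesis using assms tendsto_mult_right_zero by (auto simp: hlim_def)
qed

lemma closure_iff:
  assumes "S \<subseteq> carrier H"
  shows "x \<in> htop H closure_of S \<longleftrightarrow> x \<in> carrier H \<and> (\<forall>e>0. \<exists>y\<in>S. hnorm H (y \<ominus> x) < e)"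
  using assms norm_diff_commute by (auto simp: Met.metric_closure_of hdist_def subset_iff) 

lemma closure_iff_hlim:
  assumes "S \<subseteq> carrier H"
  shows "x \<in> htop H closure_of S \<longleftrightarrow> (\<exists>f. (\<forall>k. f k \<in> S) \<and> hlim f x)"
proof
  assume x: "x \<in> htop H closure_of S"
  then have "\<forall>k. \<exists>y\<in>S. hnorm H (y \<ominus> x) < 1 / Suc k" using assms by (simp add: closure_iff)
  then obtain f where f: "\<And>k. f k \<in> S" "\<And>k. hnorm H (f k \<ominus> x) < 1 / Suc k" by metis
  have "hlim f x"
    by (rule hlim_norm_bound[OF _ _ less_imp_le[OF f(2)]])
      (use x f assms closure_iff LIMSEQ_inverse_real_of_nat in \<open>auto simp: inverse_eq_divide\<close>)
  with f show "\<exists>f. (\<forall>k. f k \<in> S) \<and> hlim f x" by blast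
next
  assume "\<exists>f. (\<forall>k. f k \<in> S) \<and> hlim f x"
  then obtain f where f: "\<And>k. f k \<in> S" "hlim f x" by blast
  have "\<exists>y\<in>S. hnorm H (y \<ominus> x) < e" if "e > 0" for e
  proof -
    have "eventually (\<lambda>k. hnorm H (f k \<ominus> x) < e) sequentially"
      using f(2) that order_tendstoD(2) by (auto simp: hlim_def)
    then show ?thesis using f(1) by (auto simp: eventually_sequentially)
  qed
  then show "x \<in> htop H closure_of S" using assms f by (simp add: closure_iff hlim_def)
qed

end

locale hilbert = prehilbert +
  assumes mcomplete: "Metric_space.mcomplete (carrier H) (hdist H)"
begin

lemma complete:
  assumes f: "\<And>k. f k \<in> carrier H"
    and C: "\<And>e. e > 0 \<Longrightarrow> \<exists>N. \<forall>j\<ge>N. \<forall>k\<ge>N. hnorm H (f j \<ominus> f k) < e"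
  obtains x where "hlim f x"
proof -
  have "Met.MCauchy f"
    unfolding Met.MCauchy_def using f C by (fastforce simp: hdist_def)
  then show ?thesis using mcomplete that f limitin_iff_hlim by (auto simp: Met.mcomplete_def)
qed

end

lemma hilbert_iff: "hilbert H \<longleftrightarrow> hilbert_space H"
  unfolding hilbert_def hilbert_axioms_def prehilbert_def hilbert_space_def by blast

text \<open>Completeness is kept apart from the algebra: for a subspace or for \<open>ell2\<close>
  the \<open>prehilbert\<close> laws come first and supply the differences and norms in which
  completeness is then proved.\<close>

lemma (in prehilbert) hilbertI:
  assumes "\<And>f. (\<And>k. f k \<in> carrier H) \<Longrightarrow>
    (\<And>e. e > 0 \<Longrightarrow> \<exists>N. \<forall>j\<ge>N. \<forall>k\<ge>N. hnorm H (f j \<ominus> f k) < e) \<Longrightarrow> \<exists>x. hlim f x"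
  shows "hilbert H"
proof (intro hilbert.intro hilbert_axioms.intro)
  show "prehilbert H" ..
  show "Met.mcomplete"
    unfolding Met.mcomplete_def
  proof (intro allI impI)
    fix f assume f: "Met.MCauchy f"
    then have c: "f k \<in> carrier H" for k by (auto simp: Met.MCauchy_def)
    have "\<exists>N. \<forall>j\<ge>N. \<forall>k\<ge>N. hnorm H (f j \<ominus> f k) < e" if "e > 0" for e
      using f that c by (fastforce simp: Met.MCauchy_def hdist_def)
    then obtain x where "hlim f x" using assms c by blast
    then show "\<exists>x. limitin Met.mtopology f x sequentially" using c limitin_iff_hlim by blast
  qed
qed

text \<open>The record has no field for negation, so additive inverses are supplied through scalar
  multiplication by -1.\<close>

lemma prehilbertI:
  fixes H (structure)
  assumes add: "\<And>x y. \<lbrakk>x \<in> carrier H; y \<in> carrier H\<rbrakk> \<Longrightarrow> x \<oplus> y \<in> carrier H"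
    and smult: "\<And>c x. x \<in> carrier H \<Longrightarrow> c \<odot> x \<in> carrier H"
    and zero: "\<zero> \<in> carrier H"
    and assoc: "\<And>x y z. \<lbrakk>x \<in> carrier H; y \<in> carrier H; z \<in> carrier H\<rbrakk> \<Longrightarrow>
      (x \<oplus> y) \<oplus> z = x \<oplus> (y \<oplus> z)"
    and comm: "\<And>x y. \<lbrakk>x \<in> carrier H; y \<in> carrier H\<rbrakk> \<Longrightarrow> x \<oplus> y = y \<oplus> x"
    and l_zero: "\<And>x. x \<in> carrier H \<Longrightarrow> \<zero> \<oplus> x = x"
    and l_neg: "\<And>x. x \<in> carrier H \<Longrightarrow> (-1) \<odot> x \<oplus> x = \<zero>"
    and smult_add_left: "\<And>a b x. x \<in> carrier H \<Longrightarrow> (a + b) \<odot> x = a \<odot> x \<oplus> b \<odot> x"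
    and smult_add_right: "\<And>a x y. \<lbrakk>x \<in> carrier H; y \<in> carrier H\<rbrakk> \<Longrightarrow>
      a \<odot> (x \<oplus> y) = a \<odot> x \<oplus> a \<odot> y"
    and smult_assoc: "\<And>a b x. x \<in> carrier H \<Longrightarrow> (a * b) \<odot> x = a \<odot> (b \<odot> x)"
    and smult_one: "\<And>x. x \<in> carrier H \<Longrightarrow> 1 \<odot> x = x"
    and inner_add: "\<And>x y z. \<lbrakk>x \<in> carrier H; y \<in> carrier H; z \<in> carrier H\<rbrakk> \<Longrightarrow>
      hinner H (x \<oplus> y) z = hinner H x z + hinner H y z"
    and inner_smult: "\<And>c x y. \<lbrakk>x \<in> carrier H; y \<in> carrier H\<rbrakk> \<Longrightarrow>
      hinner H (c \<odot> x) y = c * hinner H x y"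
    and inner_comm: "\<And>x y. \<lbrakk>x \<in> carrier H; y \<in> carrier H\<rbrakk> \<Longrightarrow>
      hinner H y x = cnj (hinner H x y)"
    and inner_nonneg: "\<And>x. x \<in> carrier H \<Longrightarrow> 0 \<le> Re (hinner H x x)"
    and inner_zero: "\<And>x. \<lbrakk>x \<in> carrier H; hinner H x x = 0\<rbrakk> \<Longrightarrow> x = \<zero>"
  shows "prehilbert H"
proof (intro prehilbert.intro moduleI cring_from_type_algebra)
  show "abelian_group H"
  proof (rule abelian_groupI)
    show "\<exists>y\<in>carrier H. y \<oplus> x = \<zero>" if "x \<in> carrier H" for x
      using smult[OF that] l_neg[OF that] by blast
  qed (fact add zero assoc comm l_zero)+
qed (simp_all only: ring_of_type_algebra_def partial_object.simps monoid.simps ring.simps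
  smult smult_add_left smult_add_right smult_assoc smult_one inner_add inner_smult inner_nonneg,
  erule (1) inner_comm, erule (1) inner_zero)

section \<open>Bounded operators, the Riesz theorem and adjoints\<close>

lemma bop_closed: "bounded_operator H K T \<Longrightarrow> x \<in> carrier H \<Longrightarrow> T x \<in> carrier K"
  by (auto simp: bounded_operator_def)

lemma bop_add: "bounded_operator H K T \<Longrightarrow> x \<in> carrier H \<Longrightarrow> y \<in> carrier H \<Longrightarrow>
    T (x \<oplus>\<^bsub>H\<^esub> y) = T x \<oplus>\<^bsub>K\<^esub> T y"
  by (auto simp: bounded_operator_def)

lemma bop_smult: "bounded_operator H K T \<Longrightarrow> x \<in> carrier H \<Longrightarrow>
    T (c \<odot>\<^bsub>H\<^esub> x) = c \<odot>\<^bsub>K\<^esub> T x"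
  by (auto simp: bounded_operator_def)

lemma bop_bound:
  assumes "hilbert H" "bounded_operator H K T"
  obtains C where "C > 0" "\<And>x. x \<in> carrier H \<Longrightarrow> hnorm K (T x) \<le> C * hnorm H x"
proof -
  interpret hilbert H by fact
  obtain C where C: "\<And>x. x \<in> carrier H \<Longrightarrow> hnorm K (T x) \<le> C * hnorm H x"
    using assms(2) unfolding bounded_operator_def by blast
  have "hnorm K (T x) \<le> (\<bar>C\<bar> + 1) * hnorm H x" if "x \<in> carrier H" for x
  proof -
    have "C * hnorm H x \<le> (\<bar>C\<bar> + 1) * hnorm H x" using that by (intro mult_right_mono) auto
    then show ?thesis using C[OF that] by linarith
  qed
  then show ?thesis using that[of "\<bar>C\<bar> + 1"] by simp
qed

lemma bounded_operatorI:
  assumes "\<And>x. x \<in> carrier H \<Longrightarrow> T x \<in> carrier K"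
    and "\<And>x y. x \<in> carrier H \<Longrightarrow> y \<in> carrier H \<Longrightarrow> T (x \<oplus>\<^bsub>H\<^esub> y) = T x \<oplus>\<^bsub>K\<^esub> T y"
    and "\<And>c x. x \<in> carrier H \<Longrightarrow> T (c \<odot>\<^bsub>H\<^esub> x) = c \<odot>\<^bsub>K\<^esub> T x"
    and "\<And>x. x \<in> carrier H \<Longrightarrow> hnorm K (T x) \<le> C * hnorm H x"
  shows "bounded_operator H K T"
  using assms unfolding bounded_operator_def by blast

lemma bounded_operator_id: "bounded_operator H H (\<lambda>x. x)"
  by (rule bounded_operatorI[where C = 1]) auto

lemma bounded_operator_comp:
  assumes "hilbert H" "hilbert K" "bounded_operator H K S" "bounded_operator K L T"
  shows "bounded_operator H L (\<lambda>x. T (S x))"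
proof -
  interpret H: hilbert H by fact
  interpret K: hilbert K by fact
  obtain C where C: "C > 0" "\<And>x. x \<in> carrier H \<Longrightarrow> hnorm K (S x) \<le> C * hnorm H x"
    using bop_bound assms by blast
  obtain C' where C': "C' > 0" "\<And>x. x \<in> carrier K \<Longrightarrow> hnorm L (T x) \<le> C' * hnorm K x"
    using bop_bound assms by blast
  show ?thesis
  proof (rule bounded_operatorI)
    fix x assume x: "x \<in> carrier H"
    have "hnorm L (T (S x)) \<le> C' * hnorm K (S x)" by (rule C') (rule bop_closed[OF assms(3) x])
    also have "\<dots> \<le> C' * (C * hnorm H x)" using C' C x by simp
    finally show "hnorm L (T (S x)) \<le> (C' * C) * hnorm H x" by simp
  qed (simp_all add: bop_closed[OF assms(4)] bop_closed[OF assms(3)] bop_add[OF assms(3)]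
      bop_add[OF assms(4)] bop_smult[OF assms(3)] bop_smult[OF assms(4)])
qed

lemma bounded_operator_funpow:
  assumes "hilbert H" "bounded_operator H H T"
  shows "bounded_operator H H (T ^^ k)"
proof (induction k)
  case 0
  then show ?case using bounded_operator_id by (simp add: id_def)
next
  case (Suc k)
  then show ?case using bounded_operator_comp[OF assms(1,1) Suc assms(2)] by (simp add: o_def)
qed

locale two_hilbert = H: hilbert H + K: hilbert K for H :: "'a hspace" and K :: "'b hspace"
begin

lemma bop_zero:
  assumes "bounded_operator H K T"
  shows "T \<zero>\<^bsub>H\<^esub> = \<zero>\<^bsub>K\<^esub>"
proof -
  have "T (0 \<odot>\<^bsub>H\<^esub> \<zero>\<^bsub>H\<^esub>) = 0 \<odot>\<^bsub>K\<^esub> T \<zero>\<^bsub>H\<^esub>" by (rule bop_smult[OF assms]) simp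
  moreover have "0 \<odot>\<^bsub>H\<^esub> \<zero>\<^bsub>H\<^esub> = \<zero>\<^bsub>H\<^esub>" by (rule H.eqI) auto
  moreover have "0 \<odot>\<^bsub>K\<^esub> T \<zero>\<^bsub>H\<^esub> = \<zero>\<^bsub>K\<^esub>"
    by (rule K.eqI) (use bop_closed[OF assms, of "\<zero>\<^bsub>H\<^esub>"] in auto)
  ultimately show ?thesis by simp
qed

lemma bop_diff:
  assumes T: "bounded_operator H K T" and x: "x \<in> carrier H" and y: "y \<in> carrier H"
  shows "T (x \<ominus>\<^bsub>H\<^esub> y) = T x \<ominus>\<^bsub>K\<^esub> T y"
proof -
  have *: "T x \<in> carrier K" "T y \<in> carrier K" using bop_closed[OF T] x y by auto
  have "x \<ominus>\<^bsub>H\<^esub> y = x \<oplus>\<^bsub>H\<^esub> (-1) \<odot>\<^bsub>H\<^esub> y" by (rule H.eqI) (use x y in auto)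
  then have "T (x \<ominus>\<^bsub>H\<^esub> y) = T x \<oplus>\<^bsub>K\<^esub> (-1) \<odot>\<^bsub>K\<^esub> T y"
    using bop_add[OF T] bop_smult[OF T] x y by simp
  also have "\<dots> = T x \<ominus>\<^bsub>K\<^esub> T y" by (rule K.eqI) (use * in auto)
  finally show ?thesis .
qed

lemma bop_finsum:
  assumes T: "bounded_operator H K T" and "finite F" "\<And>i. i \<in> F \<Longrightarrow> f i \<in> carrier H"
  shows "T (finsum H f F) = finsum K (\<lambda>i. T (f i)) F"
  using assms(2,3)
proof (induction F rule: finite_induct)
  case (insert a F)
  then show ?case using bop_add[OF T] bop_closed[OF T] by (auto simp: Pi_iff)
qed (use bop_zero[OF T] in simp)

lemma bop_hlim:
  assumes T: "bounded_operator H K T" and "H.hlim f x"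
  shows "K.hlim (\<lambda>k. T (f k)) (T x)"
proof -
  obtain C where C: "C > 0" "\<And>x. x \<in> carrier H \<Longrightarrow> hnorm K (T x) \<le> C * hnorm H x"
    using bop_bound[OF _ T] H.hilbert_axioms by blast
  have c: "x \<in> carrier H" "f k \<in> carrier H" for k using assms by (auto simp: H.hlim_def)
  show ?thesis
  proof (rule K.hlim_norm_bound)
    show "hnorm K (T (f k) \<ominus>\<^bsub>K\<^esub> T x) \<le> C * hnorm H (f k \<ominus>\<^bsub>H\<^esub> x)" for k
      using C(2)[of "f k \<ominus>\<^bsub>H\<^esub> x"] c bop_diff[OF T] by simp
    show "(\<lambda>k. C * hnorm H (f k \<ominus>\<^bsub>H\<^esub> x)) \<longlonglongrightarrow> 0"
      using assms(2) tendsto_mult_right_zero by (auto simp: H.hlim_def)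
  qed (use c bop_closed[OF T] in auto)
qed

end

text \<open>A nonzero linear term would win near t = 0. This is what makes a first variation
  vanish.\<close>

lemma quadratic_nonneg_imp_zero:
  fixes a b :: real
  assumes "\<And>t. 0 \<le> b * t + a * t\<^sup>2"
  shows "b = 0"
proof (rule ccontr)
  assume b: "b \<noteq> 0"
  \<comment> \<open>Any positive number above \<open>a\<close> works: at t = -b/s the form equals
    b^2 (a - s) / s^2, which is negative.\<close>
  define s where "s = \<bar>a\<bar> + 1"
  have s: "s > 0" "a < s" by (auto simp: s_def)
  have "b * (- b / s) + a * (- b / s)\<^sup>2 = (b\<^sup>2 / s\<^sup>2) * (a - s)"
    using s by (simp add: field_simps power2_eq_square)
  also have "\<dots> < 0" using s b by (intro mult_pos_neg) auto
  finally show False using assms[of "- b / s"] by simp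
qed

context hilbert
begin

text \<open>Minimises \<open>\<langle>P x, x\<rangle> - 2 Re (\<phi> x)\<close>.  For \<open>P = I\<close> this is the Riesz theorem, in general it makes
  \<open>P\<close> surjective.\<close>

lemma coercive_representation:
  assumes P: "bounded_operator H H P"
    and selfadj: "\<And>x y. x \<in> carrier H \<Longrightarrow> y \<in> carrier H \<Longrightarrow> hinner H (P x) y = hinner H x (P y)"
    and c: "c > 0" "\<And>x. x \<in> carrier H \<Longrightarrow> c * (hnorm H x)\<^sup>2 \<le> Re (hinner H (P x) x)"
    and phi_add: "\<And>x y. x \<in> carrier H \<Longrightarrow> y \<in> carrier H \<Longrightarrow> \<phi> (x \<oplus> y) = \<phi> x + \<phi> y"
    and phi_smult: "\<And>a x. x \<in> carrier H \<Longrightarrow> \<phi> (a \<odot> x) = a * \<phi> x"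
    and phi_bound: "\<And>x. x \<in> carrier H \<Longrightarrow> cmod (\<phi> x) \<le> C * hnorm H x"
  shows "\<exists>x\<in>carrier H. \<forall>h\<in>carrier H. \<phi> h = hinner H h (P x)"
proof -
  note Pc [simp] = bop_closed[OF P]
  define q where "q x = Re (hinner H (P x) x)" for x
  define J where "J x = q x - 2 * Re (\<phi> x)" for x
  have q_add: "q (x \<oplus> y) = q x + q y + 2 * Re (hinner H y (P x))"
    if "x \<in> carrier H" "y \<in> carrier H" for x y
    using that selfadj[of y x] inner_commute[of "P x" y] by (simp add: q_def bop_add[OF P])
  have q_smult: "q (of_real t \<odot> x) = t\<^sup>2 * q x" if "x \<in> carrier H" for x t
    using that by (simp add: q_def bop_smult[OF P] power2_eq_square)
  \<comment> \<open>Complete the square in \<open>hnorm H x\<close>.\<close>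
  have J_below: "- (C\<^sup>2 / c) \<le> J x" if x: "x \<in> carrier H" for x
  proof -
    have "Re (\<phi> x) \<le> C * hnorm H x"
      using phi_bound[OF x] complex_Re_le_cmod order_trans by blast
    then have "J x \<ge> c * (hnorm H x)\<^sup>2 - 2 * (C * hnorm H x)" using c(2)[OF x] by (simp add: J_def q_def)
    moreover have "c * (hnorm H x)\<^sup>2 - 2 * (C * hnorm H x) + C\<^sup>2 / c = (c * hnorm H x - C)\<^sup>2 / c"
      using c(1) by (simp add: power2_diff power_mult_distrib add_divide_distrib diff_divide_distrib)
        (simp add: power2_eq_square)
    moreover have "(c * hnorm H x - C)\<^sup>2 / c \<ge> 0" using c(1) by simp
    ultimately show ?thesis by linarith
  qed
  define m where "m = Inf (J ` carrier H)"
  have bdd: "bdd_below (J ` carrier H)" using J_below by (auto intro!: bdd_belowI)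
  have m_le: "m \<le> J x" if "x \<in> carrier H" for x
    unfolding m_def using bdd that by (simp add: cInf_lower)
  have "\<exists>x\<in>carrier H. J x < m + 1 / Suc k" for k
    using cInf_lessD[of "J ` carrier H" "m + 1 / Suc k"] zero_closed unfolding m_def by fastforce
  then obtain f where f: "\<And>k. f k \<in> carrier H" "\<And>k. J (f k) < m + 1 / Suc k" by metis
  \<comment> \<open>Parallelogram law for the form \<open>q\<close>: since \<open>J\<close> is at
    least \<open>m\<close> at the midpoint, the excess of \<open>J\<close> over \<open>m\<close> at
    x and y controls their distance. So minimising sequences are Cauchy.\<close>
  have mid: "c * (hnorm H (x \<ominus> y))\<^sup>2 \<le> 2 * (J x - m) + 2 * (J y - m)"
    if x: "x \<in> carrier H" and y: "y \<in> carrier H" for x y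
  proof -
    let ?z = "of_real (1/2) \<odot> (x \<oplus> y)"
    have 1: "J ?z = (q x + q y + 2 * Re (hinner H y (P x))) / 4 - Re (\<phi> x) - Re (\<phi> y)"
      unfolding J_def q_smult[OF a_closed[OF x y]] q_add[OF x y]
      using x y by (simp add: phi_smult phi_add power2_eq_square)
    have "x \<ominus> y = x \<oplus> of_real (-1) \<odot> y" by (rule eqI) (use x y in auto)
    then have "q (x \<ominus> y) = q (x \<oplus> of_real (-1) \<odot> y)" by simp
    also have "\<dots> = q x + q y - 2 * Re (hinner H y (P x))"
      using x y q_smult[OF y, of "-1"] by (subst q_add) auto
    finally have 2: "q (x \<ominus> y) = q x + q y - 2 * Re (hinner H y (P x))" .
    have "q (x \<ominus> y) = 2 * J x + 2 * J y - 4 * J ?z" unfolding 1 2 by (simp add: J_def field_simps)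
    moreover have "m \<le> J ?z" using x y by (intro m_le) auto
    ultimately show ?thesis using c(2)[of "x \<ominus> y"] x y by (simp add: q_def)
  qed
  have "\<exists>N. \<forall>j\<ge>N. \<forall>k\<ge>N. hnorm H (f j \<ominus> f k) < e" if e: "e > 0" for e
  proof -
    obtain N where N': "4 / (c * e\<^sup>2) < real N" using reals_Archimedean2 by blast
    have ce: "0 < c * e\<^sup>2" using c(1) e by simp
    then have "0 < real N" using N' by (meson divide_pos_pos less_trans zero_less_numeral)
    then have N: "N > 0" "4 / real N < c * e\<^sup>2" using N' ce by (auto simp: field_simps)
    have "hnorm H (f j \<ominus> f k) < e" if jk: "j \<ge> N" "k \<ge> N" for j k
    proof -
      have "1 / real (Suc i) \<le> 1 / real N" if "i \<ge> N" for i
        using that N by (intro divide_left_mono) auto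
      then have "c * (hnorm H (f j \<ominus> f k))\<^sup>2 \<le> 4 * (1 / real N)"
        using mid[OF f(1) f(1), of j k] f(2)[of j] f(2)[of k] jk by (smt (verit))
      then have "c * (hnorm H (f j \<ominus> f k))\<^sup>2 < c * e\<^sup>2" using N by simp
      then have "(hnorm H (f j \<ominus> f k))\<^sup>2 < e\<^sup>2" using c(1) by simp
      then show ?thesis using e by (intro power2_less_imp_less[of _ e]) auto
    qed
    then show ?thesis by blast
  qed
  then obtain x where x: "hlim f x" using complete f(1) by blast
  then have xc: "x \<in> carrier H" by (simp add: hlim_def)
  \<comment> \<open>Perturb \<open>f k\<close> by t h: the value of \<open>J\<close> stays above
    \<open>m\<close>, hence drops by less than 1 / Suc k. In the limit a quadratic in
    \<open>t\<close> without constant term is nonnegative, so its linear coefficient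
    vanishes.\<close>
  have re: "Re (\<phi> h) = Re (hinner H h (P x))" if h: "h \<in> carrier H" for h
  proof -
    have "0 \<le> (2 * (Re (hinner H h (P x)) - Re (\<phi> h))) * t + q h * t\<^sup>2" for t
    proof (rule LIMSEQ_le_const)
      have "(\<lambda>k. hinner H h (P (f k))) \<longlonglongrightarrow> hinner H h (P x)"
        using hlim_inner_right[OF x, of "P h"] h xc f(1) by (simp add: selfadj)
      then have "(\<lambda>k. 1 / Suc k + ((2 * (Re (hinner H h (P (f k))) - Re (\<phi> h))) * t + q h * t\<^sup>2))
          \<longlonglongrightarrow> 0 + ((2 * (Re (hinner H h (P x)) - Re (\<phi> h))) * t + q h * t\<^sup>2)"
        using LIMSEQ_inverse_real_of_nat by (intro tendsto_intros) (auto simp: inverse_eq_divide)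
      then show "(\<lambda>k. 1 / Suc k + ((2 * (Re (hinner H h (P (f k))) - Re (\<phi> h))) * t + q h * t\<^sup>2))
          \<longlonglongrightarrow> (2 * (Re (hinner H h (P x)) - Re (\<phi> h))) * t + q h * t\<^sup>2" by simp
      have "0 \<le> 1 / Suc k + ((2 * (Re (hinner H h (P (f k))) - Re (\<phi> h))) * t + q h * t\<^sup>2)" for k
      proof -
        have "J (f k \<oplus> of_real t \<odot> h) =
            J (f k) + ((2 * (Re (hinner H h (P (f k))) - Re (\<phi> h))) * t + q h * t\<^sup>2)"
          unfolding J_def q_add[OF f(1) smult_closed[OF h]] q_smult[OF h]
          using f(1) h by (simp add: phi_add phi_smult algebra_simps)
        moreover have "m \<le> J (f k \<oplus> of_real t \<odot> h)" using f(1) h by (intro m_le) auto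
        ultimately show ?thesis using f(2)[of k] by simp
      qed
      then show "\<exists>N. \<forall>k\<ge>N. 0 \<le> 1 / Suc k +
          ((2 * (Re (hinner H h (P (f k))) - Re (\<phi> h))) * t + q h * t\<^sup>2)" by blast
    qed
    from quadratic_nonneg_imp_zero[OF this] show ?thesis by simp
  qed
  \<comment> \<open>Imaginary parts come from the real parts at i h.\<close>
  have "\<phi> h = hinner H h (P x)" if h: "h \<in> carrier H" for h
    using re[OF h] re[of "\<i> \<odot> h"] h xc by (simp add: phi_smult complex_eq_iff)
  then show ?thesis using xc by blast
qed

lemma Riesz:
  assumes "\<And>x y. x \<in> carrier H \<Longrightarrow> y \<in> carrier H \<Longrightarrow> \<phi> (x \<oplus> y) = \<phi> x + \<phi> y"
    and "\<And>a x. x \<in> carrier H \<Longrightarrow> \<phi> (a \<odot> x) = a * \<phi> x"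
    and "\<And>x. x \<in> carrier H \<Longrightarrow> cmod (\<phi> x) \<le> C * hnorm H x"
  shows "\<exists>x\<in>carrier H. \<forall>h\<in>carrier H. \<phi> h = hinner H h x"
  by (rule coercive_representation[OF bounded_operator_id, of 1])
    (use assms in \<open>auto simp: norm_sq\<close>)

text \<open>The bounded functional <., y> has the form <., P x>, and a vector is determined by its
  scalar products.\<close>

lemma coercive_surj:
  assumes P: "bounded_operator H H P"
    and "\<And>x y. x \<in> carrier H \<Longrightarrow> y \<in> carrier H \<Longrightarrow> hinner H (P x) y = hinner H x (P y)"
    and "c > 0" "\<And>x. x \<in> carrier H \<Longrightarrow> c * (hnorm H x)\<^sup>2 \<le> Re (hinner H (P x) x)"
    and y: "y \<in> carrier H"
  shows "\<exists>x\<in>carrier H. P x = y"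
proof -
  have "cmod (hinner H h y) \<le> hnorm H y * hnorm H h" if "h \<in> carrier H" for h
    using Cauchy_Schwarz[OF that y] by (simp add: mult.commute)
  with y obtain x where x: "x \<in> carrier H" "\<forall>h\<in>carrier H. hinner H h y = hinner H h (P x)"
    using coercive_representation[OF assms(1-4), of "\<lambda>h. hinner H h y" "hnorm H y"] by auto
  then have "P x = y"
    using bop_closed[OF P x(1)] y inner_commute[of _ y] inner_commute[of _ "P x"] by (intro eqI) auto
  with x show ?thesis by blast
qed

end

section \<open>Adjoints\<close>

context two_hilbert
begin

text \<open>Riesz's theorem for h -> <T h, y> yields the vector that the definite description picks
  out.\<close>

lemma hadjoint:
  assumes T: "bounded_operator H K T" and y: "y \<in> carrier K"
  shows "hadjoint H K T y \<in> carrier H"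
    and "\<And>h. h \<in> carrier H \<Longrightarrow> hinner K (T h) y = hinner H h (hadjoint H K T y)"
proof -
  note Tc [simp] = bop_closed[OF T]
  obtain C where C: "C > 0" "\<And>x. x \<in> carrier H \<Longrightarrow> hnorm K (T x) \<le> C * hnorm H x"
    using bop_bound[OF _ T] H.hilbert_axioms by blast
  have "\<exists>x\<in>carrier H. \<forall>h\<in>carrier H. hinner K (T h) y = hinner H h x"
  proof (rule H.Riesz)
    fix x assume x: "x \<in> carrier H"
    have "cmod (hinner K (T x) y) \<le> hnorm K (T x) * hnorm K y"
      using K.Cauchy_Schwarz x y by simp
    also have "\<dots> \<le> (C * hnorm H x) * hnorm K y" using C x y by (simp add: mult_right_mono)
    finally show "cmod (hinner K (T x) y) \<le> (C * hnorm K y) * hnorm H x" by (simp add: ac_simps)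
  qed (use y in \<open>auto simp: bop_add[OF T] bop_smult[OF T]\<close>)
  then obtain x where x: "x \<in> carrier H" "\<forall>h\<in>carrier H. hinner K (T h) y = hinner H h x" by blast
  have "hadjoint H K T y = x"
    unfolding hadjoint_def
  proof (rule the_equality)
    fix z assume "z \<in> carrier H \<and> (\<forall>h\<in>carrier H. hinner K (T h) y = hinner H h z)"
    then show "z = x" using x H.inner_commute[of _ z] H.inner_commute[of _ x] by (intro H.eqI) auto
  qed (use x in blast)
  then show "hadjoint H K T y \<in> carrier H"
    and "\<And>h. h \<in> carrier H \<Longrightarrow> hinner K (T h) y = hinner H h (hadjoint H K T y)" using x by auto
qed

lemma hadjoint_unique:
  assumes "x \<in> carrier H" "\<And>h. h \<in> carrier H \<Longrightarrow> hinner K (T h) y = hinner H h x"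
  shows "hadjoint H K T y = x"
  unfolding hadjoint_def
proof (rule the_equality)
  fix z assume "z \<in> carrier H \<and> (\<forall>h\<in>carrier H. hinner K (T h) y = hinner H h z)"
  then show "z = x"
    using assms H.inner_commute[of _ z] H.inner_commute[of _ x] by (intro H.eqI) auto
qed (use assms in blast)

lemma hadjoint_left:
  assumes T: "bounded_operator H K T" and y: "y \<in> carrier K" and h: "h \<in> carrier H"
  shows "hinner H (hadjoint H K T y) h = hinner K y (T h)"
  using hadjoint[OF T y] h y H.inner_commute[of h "hadjoint H K T y"]
    K.inner_commute[of "T h" y] bop_closed[OF T h] by simp

text \<open>||T^* y||^2 = <y, T T^* y> is at most C ||y|| ||T^* y||; cancel one factor. The same
  constant \<open>C\<close> serves, so the adjoint of a contraction is a contraction.\<close>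

lemma bounded_operator_hadjoint:
  assumes T: "bounded_operator H K T"
    and C: "C \<ge> 0" "\<And>x. x \<in> carrier H \<Longrightarrow> hnorm K (T x) \<le> C * hnorm H x"
  shows "bounded_operator K H (hadjoint H K T)"
    and "\<And>y. y \<in> carrier K \<Longrightarrow> hnorm H (hadjoint H K T y) \<le> C * hnorm K y"
proof -
  note Tc [simp] = bop_closed[OF T]
  note A [simp] = hadjoint(1)[OF T] hadjoint_left[OF T]
  show bound: "hnorm H (hadjoint H K T y) \<le> C * hnorm K y" if y: "y \<in> carrier K" for y
  proof -
    let ?a = "hadjoint H K T y"
    have "(hnorm H ?a)\<^sup>2 = Re (hinner K y (T ?a))" using y by (simp add: H.norm_sq)
    also have "\<dots> \<le> hnorm K y * hnorm K (T ?a)"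
      using K.Cauchy_Schwarz[OF y Tc, of ?a] y complex_Re_le_cmod order_trans by auto
    also have "\<dots> \<le> hnorm K y * (C * hnorm H ?a)" using C y by (intro mult_left_mono) auto
    finally have "hnorm H ?a * hnorm H ?a \<le> (C * hnorm K y) * hnorm H ?a"
      by (simp add: power2_eq_square ac_simps)
    moreover have "0 \<le> hnorm H ?a" "0 \<le> C * hnorm K y" using y C by auto
    ultimately show ?thesis by (metis mult_right_le_imp_le order_le_less)
  qed
  show "bounded_operator K H (hadjoint H K T)"
  proof (rule bounded_operatorI)
    show "hadjoint H K T (x \<oplus>\<^bsub>K\<^esub> y) = hadjoint H K T x \<oplus>\<^bsub>H\<^esub> hadjoint H K T y"
      if "x \<in> carrier K" "y \<in> carrier K" for x y
      by (rule H.eqI) (use that in auto)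
    show "hadjoint H K T (c \<odot>\<^bsub>K\<^esub> x) = c \<odot>\<^bsub>H\<^esub> hadjoint H K T x"
      if "x \<in> carrier K" for x c
      by (rule H.eqI) (use that in auto)
  qed (use bound in auto)
qed

end

section \<open>Spans, closed subspaces and density\<close>

context prehilbert
begin

lemma span_subset: "S \<subseteq> carrier H \<Longrightarrow> hspan H S \<subseteq> carrier H"
  by (auto simp: hspan_def subset_iff intro!: finsum_closed)

lemma span_superset:
  assumes "S \<subseteq> carrier H"
  shows "S \<subseteq> hspan H S"
proof
  fix x assume x: "x \<in> S"
  then have "finsum H (\<lambda>x. 1 \<odot> x) {x} = x" using assms by (subst finsum_insert) auto
  with x show "x \<in> hspan H S" unfolding hspan_def by (intro CollectI exI conjI) (auto intro: sym)
qed

lemma span_add: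
  assumes S: "S \<subseteq> carrier H" and x: "x \<in> hspan H S" and y: "y \<in> hspan H S"
  shows "x \<oplus> y \<in> hspan H S"
proof -
  obtain c F where F: "x = finsum H (\<lambda>x. c x \<odot> x) F" "finite F" "F \<subseteq> S"
    using x by (auto simp: hspan_def)
  obtain d G where G: "y = finsum H (\<lambda>x. d x \<odot> x) G" "finite G" "G \<subseteq> S"
    using y by (auto simp: hspan_def)
  \<comment> \<open>Coefficients extended by 0 let both sums run over the union of F and G.\<close>
  let ?e = "\<lambda>x. (if x \<in> F then c x else 0) + (if x \<in> G then d x else 0)"
  have FS: "\<And>i. i \<in> F \<Longrightarrow> i \<in> carrier H" "\<And>i. i \<in> G \<Longrightarrow> i \<in> carrier H" using F G S by auto
  have "x \<oplus> y = finsum H (\<lambda>x. ?e x \<odot> x) (F \<union> G)"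
  proof (rule eqI)
    show "x \<oplus> y \<in> carrier H" using S x y span_subset by blast
    show "finsum H (\<lambda>x. ?e x \<odot> x) (F \<union> G) \<in> carrier H" using FS by (intro finsum_closed) auto
    fix v assume v: "v \<in> carrier H"
    have "hinner H x v = (\<Sum>i\<in>F. c i * hinner H i v)" "hinner H y v = (\<Sum>i\<in>G. d i * hinner H i v)"
      using F(1,2) G(1,2) FS v by (auto simp: inner_finsum_left)
    moreover have "(\<Sum>i\<in>F. c i * hinner H i v)
        = (\<Sum>i\<in>F \<union> G. (if i \<in> F then c i else 0) * hinner H i v)"
      using F G by (intro sum.mono_neutral_cong_left) auto
    moreover have "(\<Sum>i\<in>G. d i * hinner H i v)
        = (\<Sum>i\<in>F \<union> G. (if i \<in> G then d i else 0) * hinner H i v)"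
      using F G by (intro sum.mono_neutral_cong_left) auto
    moreover have "hinner H (finsum H (\<lambda>x. ?e x \<odot> x) (F \<union> G)) v
        = (\<Sum>i\<in>F \<union> G. ?e i * hinner H i v)"
      by (subst inner_finsum_left) (use F G FS v in \<open>auto intro!: sum.cong\<close>)
    moreover have "x \<in> carrier H" "y \<in> carrier H" using S x y span_subset by blast+
    ultimately show "hinner H (x \<oplus> y) v = hinner H (finsum H (\<lambda>x. ?e x \<odot> x) (F \<union> G)) v"
      using v by (simp add: sum.distrib distrib_right)
  qed
  then show ?thesis
    using F(2,3) G(2,3) unfolding hspan_def by (intro CollectI exI[of _ ?e] exI[of _ "F \<union> G"]) simp
qed

lemma span_smult:
  assumes S: "S \<subseteq> carrier H" and x: "x \<in> hspan H S"
  shows "a \<odot> x \<in> hspan H S"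
proof -
  obtain c F where F: "x = finsum H (\<lambda>x. c x \<odot> x) F" "finite F" "F \<subseteq> S"
    using x by (auto simp: hspan_def)
  have FS: "\<And>i. i \<in> F \<Longrightarrow> i \<in> carrier H" using F S by auto
  have xc: "x \<in> carrier H" using S x span_subset by blast
  have "a \<odot> x = finsum H (\<lambda>x. (a * c x) \<odot> x) F"
  proof (rule eqI)
    show "finsum H (\<lambda>x. (a * c x) \<odot> x) F \<in> carrier H" using FS by (intro finsum_closed) auto
    show "hinner H (a \<odot> x) v = hinner H (finsum H (\<lambda>x. (a * c x) \<odot> x) F) v"
      if v: "v \<in> carrier H" for v
    proof -
      have "hinner H x v = (\<Sum>i\<in>F. c i * hinner H i v)"
        using F(1,2) FS v by (auto simp: inner_finsum_left)
      then show ?thesis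
        using xc v F FS by (subst inner_finsum_left) (auto simp: sum_distrib_left mult.assoc)
    qed
  qed (use xc in auto)
  then show ?thesis
    using F(2,3) unfolding hspan_def by (intro CollectI exI[of _ "\<lambda>x. a * c x"] exI[of _ F]) simp
qed

lemma span_zero: "\<zero> \<in> hspan H S"
  unfolding hspan_def by (intro CollectI exI[of _ "\<lambda>_. 0"] exI[of _ "{}"]) auto

end

context hilbert
begin

lemma subspace_hilbert:
  assumes S: "S \<subseteq> carrier H" "\<zero> \<in> S"
    and add: "\<And>x y. x \<in> S \<Longrightarrow> y \<in> S \<Longrightarrow> x \<oplus> y \<in> S"
    and smult: "\<And>c x. x \<in> S \<Longrightarrow> c \<odot> x \<in> S"
    and lim: "\<And>f x. (\<And>k. f k \<in> S) \<Longrightarrow> hlim f x \<Longrightarrow> x \<in> S"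
  shows "hilbert (H\<lparr>carrier := S\<rparr>)"
proof -
  let ?S = "H\<lparr>carrier := S\<rparr>"
  have [simp]: "x \<in> carrier H" if "x \<in> S" for x using that S by auto
  have neg: "(-1) \<odot> x \<oplus> x = \<zero>" if "x \<in> S" for x by (rule eqI) (use that in auto)
  have pre: "prehilbert ?S"
  proof (rule prehilbertI)
    show "x \<oplus>\<^bsub>?S\<^esub> y = y \<oplus>\<^bsub>?S\<^esub> x" if "x \<in> carrier ?S" "y \<in> carrier ?S" for x y
      using that by (simp add: a_comm)
    show "hinner ?S y x = cnj (hinner ?S x y)" if "x \<in> carrier ?S" "y \<in> carrier ?S" for x y
      using that inner_commute[of x y] by simp
    show "x = \<zero>\<^bsub>?S\<^esub>" if "x \<in> carrier ?S" "hinner ?S x x = 0" for x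
      using that inner_self_eq_0D[of x] by simp
  qed (simp_all add: S add smult a_assoc smult_add_left smult_add_right smult_assoc neg
      inner_self_nonneg)
  interpret S: prehilbert ?S by (rule pre)
  have [simp]: "hnorm ?S x = hnorm H x" for x by (simp add: hnorm_def)
  \<comment> \<open>Negation in the restricted record is a definite description over the smaller
    carrier. The differences agree because negation is multiplication by -1 in either space.\<close>
  have diff: "x \<ominus>\<^bsub>?S\<^esub> y = x \<ominus> y" if "x \<in> S" "y \<in> S" for x y
  proof -
    have "\<ominus>\<^bsub>?S\<^esub> y = (-1) \<odot> y" using S.inv_eq_smult that by simp
    then show ?thesis using that by (simp add: a_minus_def inv_eq_smult)
  qed
  show ?thesis
  proof (rule S.hilbertI)
    fix f :: "nat \<Rightarrow> 'a"
    assume f: "\<And>k. f k \<in> carrier ?S"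
      and C: "\<And>e. e > 0 \<Longrightarrow> \<exists>N. \<forall>j\<ge>N. \<forall>k\<ge>N. hnorm ?S (f j \<ominus>\<^bsub>?S\<^esub> f k) < e"
    obtain x where x: "hlim f x"
      using complete[of f] f C by (auto simp: diff)
    then have "x \<in> S" using lim f by auto
    then have "S.hlim f x" using x f by (auto simp: hlim_def S.hlim_def diff)
    then show "\<exists>x. S.hlim f x" by blast
  qed
qed

lemma closure_hilbert:
  assumes S: "S \<subseteq> carrier H" "\<zero> \<in> S"
    and add: "\<And>x y. x \<in> S \<Longrightarrow> y \<in> S \<Longrightarrow> x \<oplus> y \<in> S"
    and smult: "\<And>c x. x \<in> S \<Longrightarrow> c \<odot> x \<in> S"
  shows "hilbert (H\<lparr>carrier := htop H closure_of S\<rparr>)"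
proof (rule subspace_hilbert)
  let ?M = "htop H closure_of S"
  show M: "?M \<subseteq> carrier H" using S closure_iff by auto
  show "\<zero> \<in> ?M" using S by (auto simp: closure_iff intro!: bexI[of _ \<zero>])
  show "x \<oplus> y \<in> ?M" if "x \<in> ?M" "y \<in> ?M" for x y
  proof -
    obtain f g where "\<And>k. f k \<in> S" "hlim f x" "\<And>k. g k \<in> S" "hlim g y"
      using \<open>x \<in> ?M\<close> \<open>y \<in> ?M\<close> closure_iff_hlim[OF S(1)] by auto
    then show ?thesis
      unfolding closure_iff_hlim[OF S(1)]
      by (intro exI[of _ "\<lambda>k. f k \<oplus> g k"]) (simp add: add hlim_add)
  qed
  show "c \<odot> x \<in> ?M" if "x \<in> ?M" for x c
  proof -
    obtain f where "\<And>k. f k \<in> S" "hlim f x"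
      using \<open>x \<in> ?M\<close> closure_iff_hlim[OF S(1)] by auto
    then show ?thesis
      unfolding closure_iff_hlim[OF S(1)]
      by (intro exI[of _ "\<lambda>k. c \<odot> f k"]) (simp add: smult hlim_smult)
  qed
  show "x \<in> ?M" if f: "\<And>k. f k \<in> ?M" and x: "hlim f x" for f x
  proof -
    have "x \<in> htop H closure_of ?M" using M f x closure_iff_hlim[OF M] by blast
    then show ?thesis by simp
  qed
qed

lemma dense_spanI:
  assumes S: "S \<subseteq> carrier H"
    and perp: "\<And>x. x \<in> carrier H \<Longrightarrow> (\<And>s. s \<in> S \<Longrightarrow> hinner H s x = 0) \<Longrightarrow> x = \<zero>"
  shows "htop H closure_of (hspan H S) = carrier H"
proof
  let ?M = "htop H closure_of (hspan H S)"
  note sp = span_subset[OF S]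
  show M: "?M \<subseteq> carrier H" using closure_iff[OF sp] by auto
  interpret M: hilbert "H\<lparr>carrier := ?M\<rparr>"
    by (rule closure_hilbert) (use sp span_zero span_add[OF S] span_smult[OF S] in auto)
  have [simp]: "hnorm (H\<lparr>carrier := ?M\<rparr>) x = hnorm H x" for x by (simp add: hnorm_def)
  have SM: "S \<subseteq> ?M"
    using span_superset[OF S] sp closure_of_subset[of "hspan H S" "htop H"] by auto
  show "carrier H \<subseteq> ?M"
  proof
    fix y assume y: "y \<in> carrier H"
    have [simp]: "x \<in> carrier H" if "x \<in> ?M" for x using that M by auto
    have "\<exists>m\<in>carrier (H\<lparr>carrier := ?M\<rparr>). \<forall>h\<in>carrier (H\<lparr>carrier := ?M\<rparr>).
        hinner H h y = hinner (H\<lparr>carrier := ?M\<rparr>) h m"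
      by (rule M.Riesz[where C = "hnorm H y"])
        (use y Cauchy_Schwarz[of _ y] in \<open>auto simp: mult.commute\<close>)
    then obtain m where m: "m \<in> ?M" "\<And>h. h \<in> ?M \<Longrightarrow> hinner H h y = hinner H h m" by auto
    have "y \<ominus> m = \<zero>" by (rule perp) (use m y S SM in auto)
    then show "y \<in> ?M" using m y by (simp add: minus_eq_zero_iff)
  qed
qed

text \<open>Orthogonality to S passes to the span and to its limits, and \<open>x\<close> is such a
  limit, so <x, x> = 0.\<close>

lemma dense_span_perp:
  assumes S: "S \<subseteq> carrier H" "htop H closure_of (hspan H S) = carrier H"
    and x: "x \<in> carrier H" "\<And>s. s \<in> S \<Longrightarrow> hinner H s x = 0"
  shows "x = \<zero>"
proof -
  have sp: "hinner H s x = 0" if s: "s \<in> hspan H S" for s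
  proof -
    obtain c F where F: "s = finsum H (\<lambda>x. c x \<odot> x) F" "finite F" "F \<subseteq> S"
      using s by (auto simp: hspan_def)
    then have "hinner H s x = (\<Sum>i\<in>F. hinner H (c i \<odot> i) x)"
      using S x by (auto intro!: inner_finsum_left)
    also have "\<dots> = 0" using F S x by (intro sum.neutral) (auto simp: subset_iff)
    finally show ?thesis .
  qed
  obtain f where f: "\<And>k. f k \<in> hspan H S" "hlim f x"
    using x(1) S closure_iff_hlim[OF span_subset[OF S(1)]] by blast
  have "hinner H x x = 0"
    using LIMSEQ_unique[OF hlim_inner[OF f(2) x(1)]] sp[OF f(1)] by simp
  then show ?thesis using x by (auto intro: inner_self_eq_0D)
qed

end

lemma (in two_hilbert) bop_eq_on_dense:
  assumes S: "S \<subseteq> carrier H" "htop H closure_of (hspan H S) = carrier H"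
    and A: "bounded_operator H K A" and B: "bounded_operator H K B"
    and eq: "\<And>s. s \<in> S \<Longrightarrow> A s = B s"
    and x: "x \<in> carrier H"
  shows "A x = B x"
proof -
  have sp: "A s = B s" if s: "s \<in> hspan H S" for s
  proof -
    obtain c F where F: "s = finsum H (\<lambda>x. c x \<odot>\<^bsub>H\<^esub> x) F" "finite F" "F \<subseteq> S"
      using s by (auto simp: hspan_def)
    then have c: "\<And>i. i \<in> F \<Longrightarrow> i \<in> carrier H" using S by auto
    have "A s = finsum K (\<lambda>i. A (c i \<odot>\<^bsub>H\<^esub> i)) F" "B s = finsum K (\<lambda>i. B (c i \<odot>\<^bsub>H\<^esub> i)) F"
      using F c bop_finsum[OF A, of F "\<lambda>i. c i \<odot>\<^bsub>H\<^esub> i"] bop_finsum[OF B, of F "\<lambda>i. c i \<odot>\<^bsub>H\<^esub> i"] by auto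
    moreover have "A (c i \<odot>\<^bsub>H\<^esub> i) = B (c i \<odot>\<^bsub>H\<^esub> i)" if "i \<in> F" for i
      using that F c eq bop_smult[OF A] bop_smult[OF B] by auto
    moreover have "A (c i \<odot>\<^bsub>H\<^esub> i) \<in> carrier K" if "i \<in> F" for i
      using that c bop_closed[OF A] by auto
    ultimately show ?thesis by (auto intro!: K.finsum_cong')
  qed
  obtain f where f: "\<And>k. f k \<in> hspan H S" "H.hlim f x"
    using x(1) S H.closure_iff_hlim[OF H.span_subset[OF S(1)]] by blast
  show ?thesis
    using bop_hlim[OF A f(2)] bop_hlim[OF B f(2)] sp[OF f(1)] K.hlim_unique by auto
qed

section \<open>Square roots of positive operators\<close>

text \<open>The coefficients of \<open>1 - sqrt (1 - t)\<close>.\<close>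

fun sqrt_coeff :: "nat \<Rightarrow> real" where
  "sqrt_coeff N = (if N = 0 then 0 else if N = 1 then 1 / 2
     else (\<Sum>j\<in>{1..<N}. sqrt_coeff j * sqrt_coeff (N - j)) / 2)"

declare sqrt_coeff.simps [simp del]

lemma sqrt_coeff_0 [simp]: "sqrt_coeff 0 = 0"
  by (simp add: sqrt_coeff.simps)

lemma sqrt_coeff_nonneg [simp]: "0 \<le> sqrt_coeff N"
proof (induction N rule: less_induct)
  case (less N)
  then show ?case by (subst sqrt_coeff.simps) (auto intro!: sum_nonneg)
qed

text \<open>Coefficientwise form of s^2 = 2 s - t for s = 1 - sqrt (1 - t).\<close>

lemma sqrt_coeff_convolution:
  "(\<Sum>j\<le>N. sqrt_coeff j * sqrt_coeff (N - j)) = 2 * sqrt_coeff N - (if N = 1 then 1 else 0)"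
proof -
  have *: "(\<Sum>j\<le>N. sqrt_coeff j * sqrt_coeff (N - j))
      = (\<Sum>j\<in>{1..<N}. sqrt_coeff j * sqrt_coeff (N - j))"
    by (rule sum.mono_neutral_right) (auto simp: not_less Suc_le_eq)
  show ?thesis unfolding * by (subst (3) sqrt_coeff.simps) auto
qed

text \<open>Summing the recursion gives 2 S_(N+1) <= S_N^2 + 1 for the partial sums: in a pair i + j
  <= N + 1 with one index above N the other is 0, where the coefficient vanishes. The bound 1 is the
  value of 1 - sqrt (1 - t) at t = 1.\<close>

lemma sqrt_coeff_sum_le: "(\<Sum>k\<le>N. sqrt_coeff k) \<le> 1"
proof (induction N)
  case (Suc N)
  let ?c = sqrt_coeff
  have "2 * (\<Sum>k\<le>Suc N. ?c k) = (\<Sum>k\<le>Suc N. (\<Sum>j\<le>k. ?c j * ?c (k - j)) + (if k = 1 then 1 else 0))"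
    unfolding sqrt_coeff_convolution by (simp add: sum_distrib_left del: sum.atMost_Suc)
  also have "\<dots> = (\<Sum>k\<le>Suc N. \<Sum>j\<le>k. ?c j * ?c (k - j)) + 1"
    by (simp add: sum.distrib sum.delta del: sum.atMost_Suc)
  also have "(\<Sum>k\<le>Suc N. \<Sum>j\<le>k. ?c j * ?c (k - j)) = (\<Sum>(i,j)\<in>{(i,j). i + j \<le> Suc N}. ?c i * ?c j)"
    by (simp add: sum.triangle_reindex_eq del: sum.atMost_Suc)
  also have "\<dots> \<le> (\<Sum>(i,j)\<in>{..N} \<times> {..N}. ?c i * ?c j)"
  proof -
    let ?T = "{(i, j). i + j \<le> Suc N}"
    have fin: "finite ?T" by (rule finite_subset[of _ "{..Suc N} \<times> {..Suc N}"]) auto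
    have "(\<Sum>(i,j)\<in>?T. ?c i * ?c j) = (\<Sum>(i,j)\<in>?T \<inter> {..N} \<times> {..N}. ?c i * ?c j)"
      using fin
    proof (rule sum.mono_neutral_right)
      have "?c i * ?c j = 0" if "i + j \<le> Suc N" "\<not> (i \<le> N \<and> j \<le> N)" for i j
      proof -
        have "i = 0 \<or> j = 0" using that by linarith
        then show ?thesis by auto
      qed
      then show "\<forall>x\<in>?T - ?T \<inter> {..N} \<times> {..N}. (case x of (i, j) \<Rightarrow> ?c i * ?c j) = 0"
        by (intro ballI) (simp only: split_paired_all prod.case Diff_iff Int_iff mem_Sigma_iff
            mem_Collect_eq atMost_iff, blast)
    qed auto
    also have "\<dots> \<le> (\<Sum>(i,j)\<in>{..N} \<times> {..N}. ?c i * ?c j)"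
      by (intro sum_mono2) auto
    finally show ?thesis .
  qed
  also have "\<dots> = (\<Sum>k\<le>N. ?c k) * (\<Sum>k\<le>N. ?c k)"
    by (simp add: sum_product sum.cartesian_product)
  also have "\<dots> \<le> 1 * 1" using Suc by (intro mult_mono sum_nonneg) auto
  finally show ?case by simp
qed simp

lemma sqrt_coeff_summable: "sqrt_coeff summable_on UNIV"
proof (rule nonneg_bdd_above_summable_on)
  show "bdd_above (sum sqrt_coeff ` {F. F \<subseteq> UNIV \<and> finite F})"
  proof (rule bdd_aboveI2)
    fix F :: "nat set" assume "F \<in> {F. F \<subseteq> UNIV \<and> finite F}"
    then have "finite F" by simp
    then have "sum sqrt_coeff F \<le> sum sqrt_coeff {..Max F}" by (intro sum_mono2) auto
    then show "sum sqrt_coeff F \<le> 1" using sqrt_coeff_sum_le order_trans by blast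
  qed
qed auto

lemma sqrt_coeff_infsum_le: "infsum sqrt_coeff UNIV \<le> 1"
proof (rule infsum_le_finite_sums[OF sqrt_coeff_summable])
  fix F :: "nat set" assume "finite F"
  then have "sum sqrt_coeff F \<le> sum sqrt_coeff {..Max F}" by (intro sum_mono2) auto
  then show "sum sqrt_coeff F \<le> 1" using sqrt_coeff_sum_le order_trans by blast
qed

lemma sqrt_coeff_abs_summable:
  assumes "\<And>k. cmod (b k) \<le> M"
  shows "(\<lambda>k. cmod (of_real (sqrt_coeff k) * b k)) summable_on UNIV"
proof (rule Infinite_Sum.abs_summable_on_comparison_test')
  show "(\<lambda>k. sqrt_coeff k * M) summable_on UNIV"
    using sqrt_coeff_summable by (rule summable_on_cmult_left)
  show "cmod (of_real (sqrt_coeff k) * b k) \<le> sqrt_coeff k * M" for k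
    using assms[of k] by (simp add: norm_mult mult_left_mono)
qed

lemmas sqrt_coeff_mult_summable = abs_summable_summable[OF sqrt_coeff_abs_summable]

text \<open>The weights are nonnegative with sum at most 1.\<close>

lemma sqrt_coeff_infsum_bound:
  assumes "\<And>k. cmod (b k) \<le> M"
  shows "cmod (\<Sum>\<^sub>\<infinity>k. of_real (sqrt_coeff k) * b k) \<le> M"
proof -
  have M: "0 \<le> M" using assms[of 0] norm_ge_zero order_trans by blast
  have "cmod (\<Sum>\<^sub>\<infinity>k. of_real (sqrt_coeff k) * b k) \<le> (\<Sum>\<^sub>\<infinity>k. cmod (of_real (sqrt_coeff k) * b k))"
    by (rule norm_infsum_bound) (rule sqrt_coeff_abs_summable[OF assms])
  also have "\<dots> \<le> (\<Sum>\<^sub>\<infinity>k. sqrt_coeff k * M)"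
    by (rule infsum_mono[OF sqrt_coeff_abs_summable[OF assms]
          summable_on_cmult_left[OF sqrt_coeff_summable]])
      (use assms in \<open>auto simp: norm_mult intro!: mult_left_mono\<close>)
  also have "\<dots> = infsum sqrt_coeff UNIV * M"
    using sqrt_coeff_summable by (intro infsum_cmult_left) auto
  also have "\<dots> \<le> M" using sqrt_coeff_infsum_le M mult_right_mono by fastforce
  finally show ?thesis .
qed

text \<open>Absolute convergence permits summation along the antidiagonals j + k = N, where
  \<open>sqrt_coeff_convolution\<close> applies. For b k = <Q^k x, v> this is the weak form of S^2 =
  2 S - Q, with S the corresponding series in the powers of Q.\<close>

lemma sqrt_coeff_double_infsum:
  assumes b: "\<And>k. cmod (b k) \<le> M"
  shows "(\<Sum>\<^sub>\<infinity>j. of_real (sqrt_coeff j) * (\<Sum>\<^sub>\<infinity>k. of_real (sqrt_coeff k) * b (j + k)))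
     = 2 * (\<Sum>\<^sub>\<infinity>k. of_real (sqrt_coeff k) * b k) - b 1"
proof -
  let ?c = "\<lambda>k. complex_of_real (sqrt_coeff k)"
  define f where "f = (\<lambda>(j, k). ?c j * (?c k * b (j + k)))"
  have f_abs: "(\<lambda>x. cmod (f x)) summable_on UNIV \<times> UNIV"
  proof (rule Infinite_Sum.abs_summable_on_comparison_test')
    have "(\<lambda>(j, k). sqrt_coeff j * (sqrt_coeff k * M)) summable_on UNIV \<times> UNIV"
    proof (rule summable_on_SigmaI)
      show "((\<lambda>k. case (j, k) of (j, k) \<Rightarrow> sqrt_coeff j * (sqrt_coeff k * M)) has_sum
          sqrt_coeff j * (infsum sqrt_coeff UNIV * M)) UNIV" for j
        using sqrt_coeff_summable by (auto intro!: has_sum_cmult_right has_sum_cmult_left)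
      show "(\<lambda>j. sqrt_coeff j * (infsum sqrt_coeff UNIV * M)) summable_on UNIV"
        using sqrt_coeff_summable by (rule summable_on_cmult_left)
      have "0 \<le> M" using b[of 0] norm_ge_zero order_trans by blast
      then show "0 \<le> (case (j, k) of (j, k) \<Rightarrow> sqrt_coeff j * (sqrt_coeff k * M))" for j k by simp
    qed
    then show "(\<lambda>(j, k). sqrt_coeff j * (sqrt_coeff k * M)) summable_on UNIV \<times> UNIV" .
    show "cmod (f x) \<le> (case x of (j, k) \<Rightarrow> sqrt_coeff j * (sqrt_coeff k * M))" for x
      using b by (auto simp: f_def norm_mult intro!: mult_left_mono split: prod.split)
  qed
  have bij: "bij_betw (\<lambda>(N, j). (j, N - j)) (SIGMA N:UNIV. {..N}) (UNIV \<times> (UNIV :: nat set))"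
    by (rule bij_betw_byWitness[where f' = "\<lambda>(j, k). (j + k, j)"]) auto
  have f_sum: "f summable_on UNIV \<times> UNIV" using f_abs by (rule abs_summable_summable)
  then have g_sum: "(\<lambda>(N, j). f (j, N - j)) summable_on (SIGMA N:UNIV. {..N})"
    using summable_on_reindex_bij_betw[OF bij, of f] by (simp add: case_prod_unfold)
  have "(\<Sum>\<^sub>\<infinity>j. ?c j * (\<Sum>\<^sub>\<infinity>k. ?c k * b (j + k))) = (\<Sum>\<^sub>\<infinity>j. \<Sum>\<^sub>\<infinity>k. f (j, k))"
  proof (rule infsum_cong)
    fix j :: nat
    have "(\<lambda>k. ?c k * b (j + k)) summable_on UNIV"
      using b by (intro sqrt_coeff_mult_summable)
    then show "?c j * (\<Sum>\<^sub>\<infinity>k. ?c k * b (j + k)) = (\<Sum>\<^sub>\<infinity>k. f (j, k))"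
      unfolding f_def by (simp add: infsum_cmult_right)
  qed
  also have "\<dots> = infsum f (UNIV \<times> UNIV)"
    using f_sum by (subst infsum_Sigma'_banach) (auto simp: case_prod_unfold)
  also have "\<dots> = (\<Sum>\<^sub>\<infinity>(N, j)\<in>(SIGMA N:UNIV. {..N}). f (j, N - j))"
    using infsum_reindex_bij_betw[OF bij, of f] by (simp add: case_prod_unfold)
  also have "\<dots> = (\<Sum>\<^sub>\<infinity>N. \<Sum>\<^sub>\<infinity>j\<in>{..N}. f (j, N - j))"
    using infsum_Sigma'_banach[OF g_sum] by simp
  also have "\<dots> = (\<Sum>\<^sub>\<infinity>N. 2 * (?c N * b N) - (if N = 1 then b 1 else 0))"
  proof (rule infsum_cong)
    fix N :: nat
    have "(\<Sum>\<^sub>\<infinity>j\<in>{..N}. f (j, N - j)) = of_real (\<Sum>j\<le>N. sqrt_coeff j * sqrt_coeff (N - j)) * b N"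
      by (simp add: f_def sum_distrib_right mult.assoc)
    then show "(\<Sum>\<^sub>\<infinity>j\<in>{..N}. f (j, N - j)) = 2 * (?c N * b N) - (if N = 1 then b 1 else 0)"
      unfolding sqrt_coeff_convolution by (simp add: left_diff_distrib)
  qed
  also have "\<dots> = 2 * (\<Sum>\<^sub>\<infinity>k. ?c k * b k) - b 1"
  proof (rule infsumI)
    have "((\<lambda>N. ?c N * b N) has_sum (\<Sum>\<^sub>\<infinity>k. ?c k * b k)) UNIV"
      using b by (intro has_sum_infsum sqrt_coeff_mult_summable)
    moreover have "((\<lambda>N. if N = 1 then b 1 else 0) has_sum b 1) (UNIV :: nat set)"
      by (rule has_sum_finite_neutralI[of "{1}"]) auto
    ultimately show "((\<lambda>N. 2 * (?c N * b N) - (if N = 1 then b 1 else 0)) has_sum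
        2 * (\<Sum>\<^sub>\<infinity>k. ?c k * b k) - b 1) UNIV"
      unfolding diff_conv_add_uminus
      by (intro has_sum_add has_sum_uminusI has_sum_cmult_right)
  qed
  finally show ?thesis .
qed

context hilbert
begin

text \<open>Polarisation: the form is real at x + y and at x + i y, which forces both parts of <P x,
  y> to match those of the conjugate of <P y, x>.\<close>

lemma positive_selfadjoint:
  assumes P: "positive_operator H P" and x: "x \<in> carrier H" and y: "y \<in> carrier H"
  shows "hinner H (P x) y = hinner H x (P y)"
proof -
  have b: "bounded_operator H H P" using P by (simp add: positive_operator_def)
  note [simp] = bop_closed[OF b] bop_add[OF b] bop_smult[OF b]
  have im: "Im (hinner H (P z) z) = 0" if "z \<in> carrier H" for z
    using P that by (simp add: positive_operator_def)
  have "Im (hinner H (P x) y + hinner H (P y) x) = 0"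
    using im[of "x \<oplus> y"] im[OF x] im[OF y] x y by simp
  moreover have "Im (- \<i> * hinner H (P x) y + \<i> * hinner H (P y) x) = 0"
    using im[of "x \<oplus> \<i> \<odot> y"] im[OF x] im[OF y] x y by simp
  ultimately have "hinner H (P x) y = cnj (hinner H (P y) x)" by (simp add: complex_eq_iff)
  then show ?thesis using inner_commute[of "P y" x] x y by simp
qed

text \<open>The root is I - S with S the sum of the c_k Q^k, c_k = \<open>sqrt_coeff k\<close>,
  since S^2 = 2 S - Q. The series is summed weakly, in scalar products, and S is recovered by
  Riesz's theorem. \<open>hsqrt\<close> is a choice, so exhibiting one such root establishes its
  properties.\<close>

lemma hsqrt:
  assumes Q: "bounded_operator H H Q"
    and selfadj: "\<And>x y. x \<in> carrier H \<Longrightarrow> y \<in> carrier H \<Longrightarrow> hinner H (Q x) y = hinner H x (Q y)"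
    and contr: "\<And>x. x \<in> carrier H \<Longrightarrow> hnorm H (Q x) \<le> hnorm H x"
    and P: "\<And>x. x \<in> carrier H \<Longrightarrow> P x = x \<ominus> Q x"
  shows "positive_operator H (hsqrt H P)"
    and "\<And>x. x \<in> carrier H \<Longrightarrow> hsqrt H P (hsqrt H P x) = P x"
proof -
  let ?c = "\<lambda>k. complex_of_real (sqrt_coeff k)"
  have Qb: "bounded_operator H H (Q ^^ k)" for k
    by (rule bounded_operator_funpow[OF hilbert_axioms Q])
  note [simp] = bop_closed[OF Qb] bop_add[OF Qb] bop_smult[OF Qb]
  have Q1 [simp]: "Q x \<in> carrier H" if "x \<in> carrier H" for x using bop_closed[OF Q that] .
  have Qn: "hnorm H ((Q ^^ k) x) \<le> hnorm H x" if x: "x \<in> carrier H" for x k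
  proof (induction k)
    case (Suc k)
    then show ?case using contr[of "(Q ^^ k) x"] x by simp
  qed simp
  have Qs: "hinner H ((Q ^^ k) x) y = hinner H x ((Q ^^ k) y)"
    if "x \<in> carrier H" "y \<in> carrier H" for x y k
    using that by (induction k arbitrary: x) (simp_all add: selfadj funpow_swap1)
  have bd: "cmod (hinner H ((Q ^^ k) x) v) \<le> hnorm H x * hnorm H v"
    if "x \<in> carrier H" "v \<in> carrier H" for x v k
    using Cauchy_Schwarz[of "(Q ^^ k) x" v] that Qn[of x k]
    by (meson bop_closed[OF Qb] mult_right_mono norm_nonneg order_trans)
  \<comment> \<open>With Q^k on the side of h the sum is linear in h, as Riesz's theorem
    requires.\<close>
  have ex: "\<exists>s\<in>carrier H. \<forall>h\<in>carrier H. (\<Sum>\<^sub>\<infinity>k. ?c k * hinner H ((Q ^^ k) h) x) = hinner H h s"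
    if x: "x \<in> carrier H" for x
  proof (rule Riesz)
    fix y z assume yz: "y \<in> carrier H" "z \<in> carrier H"
    have "(\<lambda>k. ?c k * hinner H ((Q ^^ k) y) x) summable_on UNIV"
      "(\<lambda>k. ?c k * hinner H ((Q ^^ k) z) x) summable_on UNIV"
      using bd x yz by (intro sqrt_coeff_mult_summable; blast)+
    from infsum_add[OF this]
    show "(\<Sum>\<^sub>\<infinity>k. ?c k * hinner H ((Q ^^ k) (y \<oplus> z)) x)
      = (\<Sum>\<^sub>\<infinity>k. ?c k * hinner H ((Q ^^ k) y) x) + (\<Sum>\<^sub>\<infinity>k. ?c k * hinner H ((Q ^^ k) z) x)"
      using x yz by (simp add: distrib_left)
  next
    fix a y assume y: "y \<in> carrier H"
    have "(\<lambda>k. ?c k * hinner H ((Q ^^ k) y) x) summable_on UNIV"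
      using bd x y by (intro sqrt_coeff_mult_summable; blast)
    from infsum_cmult_right[OF this, of a]
    show "(\<Sum>\<^sub>\<infinity>k. ?c k * hinner H ((Q ^^ k) (a \<odot> y)) x)
      = a * (\<Sum>\<^sub>\<infinity>k. ?c k * hinner H ((Q ^^ k) y) x)"
      using x y by (simp add: mult.left_commute)
    show "cmod (\<Sum>\<^sub>\<infinity>k. ?c k * hinner H ((Q ^^ k) y) x) \<le> hnorm H x * hnorm H y"
      using bd[OF y x] by (subst mult.commute) (rule sqrt_coeff_infsum_bound)
  qed
  have "\<exists>S. \<forall>x\<in>carrier H. S x \<in> carrier H \<and>
      (\<forall>h\<in>carrier H. (\<Sum>\<^sub>\<infinity>k. ?c k * hinner H ((Q ^^ k) h) x) = hinner H h (S x))"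
    using ex by (intro bchoice) blast
  then obtain S where S [simp]: "\<And>x. x \<in> carrier H \<Longrightarrow> S x \<in> carrier H"
    and Sr: "\<And>x h. x \<in> carrier H \<Longrightarrow> h \<in> carrier H \<Longrightarrow>
      (\<Sum>\<^sub>\<infinity>k. ?c k * hinner H ((Q ^^ k) h) x) = hinner H h (S x)" by blast
  have Sl: "hinner H (S x) h = (\<Sum>\<^sub>\<infinity>k. ?c k * hinner H ((Q ^^ k) x) h)"
    if "x \<in> carrier H" "h \<in> carrier H" for x h
  proof -
    have "hinner H (S x) h = cnj (\<Sum>\<^sub>\<infinity>k. ?c k * hinner H ((Q ^^ k) h) x)"
      using that Sr inner_commute[of h "S x"] by simp
    also have "\<dots> = (\<Sum>\<^sub>\<infinity>k. cnj (?c k * hinner H ((Q ^^ k) h) x))"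
      by (rule infsum_cnj[symmetric])
    also have "\<dots> = (\<Sum>\<^sub>\<infinity>k. ?c k * hinner H ((Q ^^ k) x) h)"
    proof (rule infsum_cong)
      show "cnj (?c k * hinner H ((Q ^^ k) h) x) = ?c k * hinner H ((Q ^^ k) x) h" for k
        using that inner_commute[of "(Q ^^ k) h" x] Qs[of x h k] by simp
    qed
    finally show ?thesis .
  qed
  have Ss: "hinner H (S x) y = hinner H x (S y)" if "x \<in> carrier H" "y \<in> carrier H" for x y
    using that Sl Sr by simp
  have S_add: "S (x \<oplus> y) = S x \<oplus> S y" if "x \<in> carrier H" "y \<in> carrier H" for x y
    by (rule eqI) (use that Ss in auto)
  have S_smult: "S (a \<odot> x) = a \<odot> S x" if "x \<in> carrier H" for x a
    by (rule eqI) (use that Ss in auto)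
  have S_bd: "cmod (hinner H (S x) y) \<le> hnorm H x * hnorm H y" if "x \<in> carrier H" "y \<in> carrier H" for x y
    unfolding Sl[OF that] using bd[OF that] by (rule sqrt_coeff_infsum_bound)
  have S_norm: "hnorm H (S x) \<le> hnorm H x" if x: "x \<in> carrier H" for x
  proof -
    have "hnorm H (S x) * hnorm H (S x) \<le> hnorm H x * hnorm H (S x)"
      using S_bd[OF x S[OF x]] x complex_Re_le_cmod[of "hinner H (S x) (S x)"] norm_sq[of "S x"]
      by (simp add: power2_eq_square)
    then show ?thesis using x norm_nonneg[OF S[OF x]] norm_nonneg[OF x]
      by (metis mult_right_le_imp_le order_le_less)
  qed
  have Qadd: "(Q ^^ k) ((Q ^^ j) x) = (Q ^^ (j + k)) x" for j k x
    by (metis add.commute comp_apply funpow_add)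
  have SS: "hinner H (S (S x)) v = 2 * hinner H (S x) v - hinner H (Q x) v"
    if x: "x \<in> carrier H" and v: "v \<in> carrier H" for x v
  proof -
    have "hinner H (S (S x)) v = hinner H (S x) (S v)" using x v Ss by simp
    also have "\<dots> = (\<Sum>\<^sub>\<infinity>j. ?c j * hinner H ((Q ^^ j) x) (S v))" using x v Sl by simp
    also have "\<dots> = (\<Sum>\<^sub>\<infinity>j. ?c j * (\<Sum>\<^sub>\<infinity>k. ?c k * hinner H ((Q ^^ (j + k)) x) v))"
      using x v Sr by (simp flip: Sr add: Qadd)
    also have "\<dots> = 2 * (\<Sum>\<^sub>\<infinity>k. ?c k * hinner H ((Q ^^ k) x) v) - hinner H ((Q ^^ 1) x) v"
      using bd[OF x v] by (rule sqrt_coeff_double_infsum)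
    finally show ?thesis using Sl[OF x v] by simp
  qed
  define R where "R x = x \<ominus> S x" for x
  have R [simp]: "R x \<in> carrier H" if "x \<in> carrier H" for x using that by (simp add: R_def)
  have "positive_operator H R \<and> (\<forall>x\<in>carrier H. R (R x) = P x)"
    unfolding positive_operator_def
  proof (intro conjI ballI)
    show "bounded_operator H H R"
    proof (rule bounded_operatorI[where C = 2])
      show "R (x \<oplus> y) = R x \<oplus> R y" if "x \<in> carrier H" "y \<in> carrier H" for x y
        by (rule eqI) (use that S_add in \<open>auto simp: R_def\<close>)
      show "R (c \<odot> x) = c \<odot> R x" if "x \<in> carrier H" for x c
        by (rule eqI) (use that S_smult in \<open>auto simp: R_def algebra_simps\<close>)
      show "hnorm H (R x) \<le> 2 * hnorm H x" if "x \<in> carrier H" for x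
        using norm_triangle_diff[of x "S x"] S_norm[OF that] that by (simp add: R_def)
    qed auto
    fix x assume x: "x \<in> carrier H"
    show "R (R x) = P x"
    proof (rule eqI)
      show "hinner H (R (R x)) v = hinner H (P x) v" if v: "v \<in> carrier H" for v
      proof -
        have "hinner H (S (R x)) v = hinner H (S x) v - hinner H (S (S x)) v"
          using x v Ss by (simp add: R_def)
        then show ?thesis using x v SS by (simp add: R_def P)
      qed
    qed (use x P in auto)
    have "hinner H (S x) x = cnj (hinner H (S x) x)"
      using Ss[OF x x] inner_commute[of "S x" x] x by simp
    then have "Im (hinner H (S x) x) = 0" by (simp add: complex_eq_iff)
    then show "Im (hinner H (R x) x) = 0" using x by (simp add: R_def inner_self)
    \<comment> \<open>The coefficients sum to at most 1, so S is a contraction and I - S is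
      positive.\<close>
    have "Re (hinner H (S x) x) \<le> hnorm H x * hnorm H x"
      using S_bd[OF x x] complex_Re_le_cmod order_trans by blast
    then show "0 \<le> Re (hinner H (R x) x)"
      using x by (simp add: R_def inner_self power2_eq_square)
  qed
  then have "positive_operator H (hsqrt H P) \<and> (\<forall>x\<in>carrier H. hsqrt H P (hsqrt H P x) = P x)"
    unfolding hsqrt_def
    by (rule someI[where P = "\<lambda>R. positive_operator H R \<and> (\<forall>x\<in>carrier H. R (R x) = P x)"])
  then show "positive_operator H (hsqrt H P)"
    and "\<And>x. x \<in> carrier H \<Longrightarrow> hsqrt H P (hsqrt H P x) = P x" by auto
qed

end

section \<open>Self-inversive polynomials\<close>

text \<open>The multiset of roots is listed as a function on {1..degree}, the indexing that
  \<open>esym\<close> works with.\<close>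

lemma complex_poly_factorization:
  fixes P :: "complex poly"
  assumes "P \<noteq> 0"
  shows "\<exists>u :: nat \<Rightarrow> complex. \<forall>z. poly P z = Polynomial.lead_coeff P * (\<Prod>k\<in>{1..Polynomial.degree P}. z - u k)"
proof -
  obtain A where A: "size A = Polynomial.degree P" "P = Polynomial.smult (Polynomial.lead_coeff P) (\<Prod>x\<in>#A. [:-x, 1:])"
    using alg_closed_imp_factorization[OF assms] by blast
  obtain xs where xs: "mset xs = A" using ex_mset by blast
  define u where "u k = xs ! (k - 1)" for k
  have "poly P z = Polynomial.lead_coeff P * (\<Prod>k\<in>{1..Polynomial.degree P}. z - u k)" for z
  proof -
    have "poly P z = Polynomial.lead_coeff P * (\<Prod>x\<in>#A. z - x)"
      by (subst A(2)) (simp add: poly_prod_mset image_mset.compositionality o_def)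
    also have "(\<Prod>x\<in>#A. z - x) = (\<Prod>x\<leftarrow>xs. z - x)"
      unfolding xs[symmetric] by (simp flip: mset_map prod_mset_prod_list)
    also have "\<dots> = (\<Prod>k<Polynomial.degree P. z - xs ! k)"
      using A(1) xs by (auto simp: prod.list_conv_set_nth atLeast0LessThan)
    also have "\<dots> = (\<Prod>k\<in>{1..Polynomial.degree P}. z - u k)"
      by (rule prod.reindex_bij_witness[of _ "\<lambda>k. k - 1" Suc]) (auto simp: u_def)
    finally show ?thesis .
  qed
  then show ?thesis by blast
qed

text \<open>Expand the product over subsets and collect the subsets by cardinality.\<close>

lemma vieta:
  "(\<Prod>k\<in>{1..n}. z - u k) = (\<Sum>i\<le>n. (-1) ^ i * esym n i u * z ^ (n - i))"
proof -
  have "(\<Prod>k\<in>{1..n}. z - u k) = (\<Prod>k\<in>{1..n}. - u k + z)" by simp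
  also have "\<dots> = (\<Sum>B\<in>Pow {1..n}. prod (\<lambda>x. - u x) B * prod (\<lambda>x. z) ({1..n} - B))"
    by (rule prod_add) simp
  also have "\<dots> = (\<Sum>B\<in>Pow {1..n}. (-1) ^ card B * (\<Prod>x\<in>B. u x) * z ^ (n - card B))"
    by (rule sum.cong) (auto simp: prod_uminus card_Diff_subset finite_subset)
  also have "\<dots> = (\<Sum>i\<le>n. \<Sum>B\<in>{B \<in> Pow {1..n}. card B = i}. (-1) ^ card B * (\<Prod>x\<in>B. u x) * z ^ (n - card B))"
    by (rule sum.group[symmetric])
      (use card_mono[of "{1..n}"] in fastforce)+
  also have "\<dots> = (\<Sum>i\<le>n. (-1) ^ i * esym n i u * z ^ (n - i))"
    by (intro sum.cong) (auto simp: esym_def sum_distrib_left sum_distrib_right)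
  finally show ?thesis .
qed

text \<open>The difference of the squares factors as (|z|^2 - 1) (1 - |\<beta>|^2). Blaschke factors
  thus have modulus at least 1 outside the disc; the form without a quotient also covers |\<beta>| =
  1.\<close>

lemma norm_blaschke_le:
  assumes "cmod \<beta> \<le> 1" "1 \<le> cmod z"
  shows "cmod (1 - cnj \<beta> * z) \<le> cmod (z - \<beta>)"
proof (rule power2_le_imp_le)
  have "(cmod (z - \<beta>))\<^sup>2 - (cmod (1 - cnj \<beta> * z))\<^sup>2 = ((cmod z)\<^sup>2 - 1) * (1 - (cmod \<beta>)\<^sup>2)"
    unfolding cmod_power2 by (simp add: power2_eq_square algebra_simps)
  moreover have "\<dots> \<ge> 0" using assms by (simp add: power_le_one)
  ultimately show "(cmod (1 - cnj \<beta> * z))\<^sup>2 \<le> (cmod (z - \<beta>))\<^sup>2" by linarith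
qed simp

text \<open>Cohn's argument: at a zero of \<open>P\<close> outside the closed disc, self-inversiveness identifies
  \<open>z P'(z)\<close> with the reciprocal polynomial of \<open>P'\<close>, which is at most \<open>P'\<close> in modulus there.\<close>

lemma self_inversive_zeros_on_circle:
  fixes a :: "nat \<Rightarrow> complex"
  assumes n: "n \<ge> 1" and a0: "a 0 = 1" and an: "cmod (a n) = 1"
    and self: "\<And>i. i \<le> n \<Longrightarrow> a i = a n * cnj (a (n - i))"
    and crit: "\<And>z. cmod z > 1 \<Longrightarrow>
      (\<Sum>i<n. (-1) ^ i * (of_nat (n - i) / of_nat n) * a i * z ^ (n - 1 - i)) \<noteq> 0"
  shows "\<exists>u. (\<forall>k\<in>{1..n}. cmod (u k) = 1) \<and> (\<forall>i\<le>n. a i = esym n i u)"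
proof -
  \<comment> \<open>With the alternating signs the elementary symmetric functions of the zeros are
    the \<open>a i\<close> themselves.\<close>
  define P where "P = (\<Sum>i\<le>n. Polynomial.monom ((-1) ^ i * a i) (n - i))"
  have coeffP: "Polynomial.coeff P j = (if j \<le> n then (-1) ^ (n - j) * a (n - j) else 0)" for j
  proof -
    have "Polynomial.coeff P j = (\<Sum>i\<le>n. if n - i = j then (-1) ^ i * a i else 0)"
      by (simp add: P_def coeff_sum)
    also have "\<dots> = (\<Sum>i\<in>(if j \<le> n then {n - j} else {}). (-1) ^ i * a i)"
    proof (rule sum.mono_neutral_cong_right)
      show "{..n} \<supseteq> (if j \<le> n then {n - j} else {})" by auto
    qed (auto split: if_splits)
    finally show ?thesis by (simp split: if_splits)
  qed
  have degP: "Polynomial.degree P = n"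
    by (rule antisym) (auto intro!: degree_le le_degree simp: coeffP a0)
  have leadP: "Polynomial.lead_coeff P = 1" by (simp add: degP coeffP a0)
  then have P0: "P \<noteq> 0" by auto
  have polyP: "poly P z = (\<Sum>i\<le>n. (-1) ^ i * a i * z ^ (n - i))" for z
    by (simp add: P_def poly_sum poly_monom)
  define D where "D = Polynomial.pderiv P"
  have degD: "Polynomial.degree D = n - 1" by (simp add: D_def degree_pderiv degP)
  have leadD: "Polynomial.lead_coeff D = of_nat n"
    using n by (simp add: degD) (simp add: D_def coeff_pderiv coeffP a0)
  then have D0: "D \<noteq> 0" using n by auto
  have polyD: "poly D z = (\<Sum>i<n. (-1) ^ i * of_nat (n - i) * a i * z ^ (n - 1 - i))" for z
  proof -
    have "poly D z = (\<Sum>i\<le>n. (-1) ^ i * of_nat (n - i) * a i * z ^ (n - 1 - i))"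
      by (simp add: D_def P_def higher_pderiv_sum[of 1, simplified] pderiv_monom poly_sum poly_monom ac_simps)
    also have "\<dots> = (\<Sum>i<n. (-1) ^ i * of_nat (n - i) * a i * z ^ (n - 1 - i))"
      by (rule sum.mono_neutral_right) auto
    finally show ?thesis .
  qed
  have critD: "poly D z \<noteq> 0" if "cmod z > 1" for z
  proof -
    have "poly D z = of_nat n * (\<Sum>i<n. (-1) ^ i * (of_nat (n - i) / of_nat n) * a i * z ^ (n - 1 - i))"
      using n by (simp add: polyD sum_distrib_left field_simps)
    then show ?thesis using crit[OF that] n by simp
  qed
  obtain \<beta> where \<beta>: "\<And>z. poly D z = of_nat n * (\<Prod>k\<in>{1..n-1}. z - \<beta> k)"
    using complex_poly_factorization[OF D0] leadD degD by auto
  have \<beta>1: "cmod (\<beta> k) \<le> 1" if k: "k \<in> {1..n-1}" for k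
  proof -
    have "poly D (\<beta> k) = 0" using k by (auto simp: \<beta> prod_zero_iff)
    then show ?thesis using critD by (meson not_le)
  qed
  \<comment> \<open>Up to sign n P - z P' has the coefficients i a_i. Reversing the index turns the
    factor i into n - i, the factor of the derivative, and self-inversiveness turns a_(n-i) into a_n
    times the conjugate of a_i.\<close>
  have rev: "of_nat n * poly P z - z * poly D z = (-1) ^ n * a n * (z ^ (n - 1) * cnj (poly D (1 / cnj z)))"
    if z: "z \<noteq> 0" for z
  proof -
    have "z * poly D z = (\<Sum>i\<le>n. (-1) ^ i * of_nat (n - i) * a i * z ^ (n - i))"
    proof -
      have "z * poly D z = (\<Sum>i<n. (-1) ^ i * of_nat (n - i) * a i * z ^ (n - i))"
        unfolding polyD sum_distrib_left
      proof (rule sum.cong)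
        show "z * ((-1) ^ i * of_nat (n - i) * a i * z ^ (n - 1 - i)) =
            (-1) ^ i * of_nat (n - i) * a i * z ^ (n - i)" if "i \<in> {..<n}" for i
          using that Suc_diff_Suc[of i n] by (simp flip: power_Suc)
      qed simp
      also have "\<dots> = (\<Sum>i\<le>n. (-1) ^ i * of_nat (n - i) * a i * z ^ (n - i))"
        by (rule sum.mono_neutral_left) auto
      finally show ?thesis .
    qed
    then have "of_nat n * poly P z - z * poly D z = (\<Sum>i\<le>n. (-1) ^ i * of_nat i * a i * z ^ (n - i))"
      unfolding polyP sum_distrib_left
      by (simp add: algebra_simps of_nat_diff flip: sum_subtractf)
    also have "\<dots> = (\<Sum>i\<le>n. (-1) ^ n * a n * ((-1) ^ i * of_nat (n - i) * cnj (a i) * z ^ i))"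
    proof (rule sum.reindex_bij_witness[of _ "\<lambda>i. n - i" "\<lambda>i. n - i"])
      show "(-1) ^ n * a n * ((-1) ^ (n - i) * of_nat (n - (n - i)) * cnj (a (n - i)) * z ^ (n - i))
          = (-1) ^ i * of_nat i * a i * z ^ (n - i)" if "i \<in> {..n}" for i
      proof -
        have "(-1 :: complex) ^ n * (-1) ^ (n - i) = (-1) ^ i"
          using that by (auto simp: minus_one_power_iff)
        then show ?thesis using that self[of i]
          by (simp add: ac_simps)
      qed
    qed auto
    also have "\<dots> = (-1) ^ n * a n * (\<Sum>i<n. (-1) ^ i * of_nat (n - i) * cnj (a i) * z ^ i)"
      unfolding sum_distrib_left by (rule sum.mono_neutral_right) auto
    also have "(\<Sum>i<n. (-1) ^ i * of_nat (n - i) * cnj (a i) * z ^ i)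
        = z ^ (n - 1) * cnj (poly D (1 / cnj z))"
      unfolding polyD cnj_sum sum_distrib_left
    proof (rule sum.cong)
      show "(-1) ^ i * of_nat (n - i) * cnj (a i) * z ^ i =
        z ^ (n - 1) * cnj ((-1) ^ i * of_nat (n - i) * a i * (1 / cnj z) ^ (n - 1 - i))"
        if "i \<in> {..<n}" for i
      proof -
        have "z ^ (n - 1) = z ^ i * z ^ (n - 1 - i)" using that by (simp flip: power_add)
        then show ?thesis using z by (simp add: power_one_over)
      qed
    qed simp
    finally show ?thesis .
  qed
  have outside: "poly P z \<noteq> 0" if z: "cmod z > 1" for z
  proof
    assume P: "poly P z = 0"
    have z0: "z \<noteq> 0" using z by auto
    have "z ^ (n - 1) * cnj (poly D (1 / cnj z)) = of_nat n * (\<Prod>k\<in>{1..n-1}. 1 - cnj (\<beta> k) * z)"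
    proof -
      have "z ^ (n - 1) * cnj (poly D (1 / cnj z))
          = of_nat n * ((\<Prod>k\<in>{1..n-1}. z) * (\<Prod>k\<in>{1..n-1}. 1 / z - cnj (\<beta> k)))"
        by (simp add: \<beta>)
      also have "(\<Prod>k\<in>{1..n-1}. z) * (\<Prod>k\<in>{1..n-1}. 1 / z - cnj (\<beta> k))
          = (\<Prod>k\<in>{1..n-1}. 1 - cnj (\<beta> k) * z)"
        unfolding prod.distrib[symmetric] using z0 by (intro prod.cong) (auto simp: field_simps)
      finally show ?thesis .
    qed
    then have "cmod (z ^ (n - 1) * cnj (poly D (1 / cnj z)))
        = real n * (\<Prod>k\<in>{1..n-1}. cmod (1 - cnj (\<beta> k) * z))"
      by (simp only: norm_mult norm_of_nat prod_norm)
    also have "\<dots> \<le> real n * (\<Prod>k\<in>{1..n-1}. cmod (z - \<beta> k))"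
      using z \<beta>1 by (intro mult_left_mono prod_mono conjI norm_blaschke_le) auto
    also have "\<dots> = cmod (poly D z)" by (simp add: \<beta> norm_mult prod_norm)
    finally have "cmod (z ^ (n - 1) * cnj (poly D (1 / cnj z))) \<le> cmod (poly D z)" .
    moreover have "cmod (z * poly D z) = cmod (z ^ (n - 1) * cnj (poly D (1 / cnj z)))"
      using arg_cong[OF rev[OF z0], of cmod] P an by (simp add: norm_mult norm_power)
    ultimately have "cmod (z * poly D z) \<le> cmod (poly D z)" by simp
    moreover have "cmod (poly D z) > 0" using critD[OF z] by simp
    ultimately show False using z by (simp add: norm_mult)
  qed
  \<comment> \<open>Zeros are symmetric under z -> 1 / cnj z, so a zero inside would reflect to one
    outside; 0 is no zero because |a n| = 1.\<close>
  have inside: "poly P z \<noteq> 0" if z: "cmod z < 1" for z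
  proof (cases "z = 0")
    case True
    have "poly P 0 = (-1) ^ n * a n" by (simp add: poly_0_coeff_0 coeffP)
    then show ?thesis using True an by auto
  next
    case False
    have "poly P z = (-1) ^ n * a n * (z ^ n * cnj (poly P (1 / cnj z)))"
    proof -
      have "z ^ n * cnj (poly P (1 / cnj z)) = (\<Sum>i\<le>n. (-1) ^ i * cnj (a i) * z ^ i)"
        unfolding polyP cnj_sum sum_distrib_left
      proof (rule sum.cong)
        show "z ^ n * cnj ((-1) ^ i * a i * (1 / cnj z) ^ (n - i)) = (-1) ^ i * cnj (a i) * z ^ i"
          if "i \<in> {..n}" for i
        proof -
          have "z ^ n = z ^ i * z ^ (n - i)" using that by (simp flip: power_add)
          then show ?thesis using False by (simp add: power_one_over)
        qed
      qed simp
      moreover have "(\<Sum>i\<le>n. (-1) ^ n * a n * ((-1) ^ i * cnj (a i) * z ^ i)) = poly P z"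
        unfolding polyP
      proof (rule sum.reindex_bij_witness[of _ "\<lambda>i. n - i" "\<lambda>i. n - i"])
        show "(-1) ^ (n - i) * a (n - i) * z ^ (n - (n - i)) = (-1) ^ n * a n * ((-1) ^ i * cnj (a i) * z ^ i)"
          if "i \<in> {..n}" for i
        proof -
          have "(-1 :: complex) ^ (n - i) = (-1) ^ n * (-1) ^ i"
            using that by (auto simp: minus_one_power_iff)
          then show ?thesis using that self[of "n - i"] by (simp add: ac_simps)
        qed
      qed auto
      ultimately show ?thesis by (simp add: sum_distrib_left)
    qed
    moreover have "poly P (1 / cnj z) \<noteq> 0"
      using False z by (intro outside) (simp add: norm_divide)
    moreover have "a n \<noteq> 0" using an by auto
    ultimately show ?thesis using False by simp
  qed
  obtain u where u: "\<And>z. poly P z = (\<Prod>k\<in>{1..n}. z - u k)"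
    using complex_poly_factorization[OF P0] leadP degP by auto
  have "cmod (u k) = 1" if "k \<in> {1..n}" for k
  proof -
    have "poly P (u k) = 0" using that by (auto simp: u prod_zero_iff)
    then show ?thesis using inside outside by (meson linorder_neqE_linordered_idom)
  qed
  \<comment> \<open>Vieta rebuilds P from its zeros, and equal polynomial functions have equal
    coefficients.\<close>
  moreover have "a i = esym n i u" if i: "i \<le> n" for i
  proof -
    define Q where "Q = (\<Sum>i\<le>n. Polynomial.monom ((-1) ^ i * esym n i u) (n - i))"
    have "poly Q z = poly P z" for z
      unfolding u vieta Q_def by (simp add: poly_sum poly_monom)
    then have "poly Q = poly P" by (rule ext)
    then have "Q = P" by (simp add: poly_eq_poly_eq_iff)
    have "Polynomial.coeff Q (n - i) = (\<Sum>j\<le>n. if n - j = n - i then (-1) ^ j * esym n j u else 0)"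
      by (simp add: Q_def coeff_sum)
    also have "\<dots> = (\<Sum>j\<in>{i}. (-1) ^ j * esym n j u)"
      using i by (intro sum.mono_neutral_cong_right) auto
    finally have "Polynomial.coeff Q (n - i) = (-1) ^ i * esym n i u" by simp
    then show ?thesis using \<open>Q = P\<close> i by (simp add: coeffP)
  qed
  ultimately show ?thesis by blast
qed

section \<open>Points of the distinguished boundary\<close>

lemma unimodular_root:
  assumes "cmod u = 1" "m \<ge> 1"
  shows "\<exists>z. cmod z = 1 \<and> z ^ m = u"
proof -
  obtain t where t: "u = cis t" using assms(1) by (metis rcis_cmod_Arg rcis_def mult_1 of_real_1)
  have "cis (t / real m) ^ m = u" using assms(2) by (simp add: Complex.DeMoivre t)
  then show ?thesis by (intro exI[of _ "cis (t / real m)"]) simp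
qed

lemma esym_top: "esym n n u = (\<Prod>k\<in>{1..n}. u k)"
proof -
  have "{A. A \<subseteq> {1..n} \<and> card A = n} = {{1..n}}"
    using card_subset_eq[of "{1..n}"] by auto
  then show ?thesis by (simp add: esym_def)
qed

text \<open>The \<open>w i\<close>, completed by \<open>w n ^ p\<close> as last coefficient, form a
  self-inversive polynomial with unimodular zeros u_k. Any m-th roots z_k of the u_k give the first
  n - 1 coordinates; the last coordinate then agrees with \<open>w n\<close> up to a p-th root of
  unity, which a rotation of one z_k removes.\<close>

lemma Theta_boundaryI:
  assumes n: "n \<ge> 2" and m: "m \<ge> 1" and p: "p \<ge> 1" "p dvd m"
    and w: "w \<in> cspace n" and wn: "cmod (w n) = 1"
    and self: "\<And>i. i \<in> {1..n-1} \<Longrightarrow> w i = w n ^ p * cnj (w (n - i))"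
    and crit: "\<And>z. cmod z > 1 \<Longrightarrow>
      z ^ (n - 1) + (\<Sum>i\<in>{1..n-1}. (-1) ^ i * (of_nat (n - i) / of_nat n) * w i * z ^ (n - 1 - i)) \<noteq> 0"
  shows "w \<in> Theta_boundary n m p"
proof -
  \<comment> \<open>The p-th power of the last coordinate of \<open>theta_map\<close> is the product
    of the z_k^m, hence the last coefficient \<open>w n ^ p\<close>.\<close>
  define a where "a i = (if i = 0 then 1 else if i = n then w n ^ p else w i)" for i
  have an: "cmod (a n) = 1" using wn n by (simp add: a_def norm_power)
  have anc: "a n * cnj (a n) = 1" using an complex_norm_square[of "a n"] by simp
  have "\<exists>u. (\<forall>k\<in>{1..n}. cmod (u k) = 1) \<and> (\<forall>i\<le>n. a i = esym n i u)"
  proof (rule self_inversive_zeros_on_circle)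
    show "a i = a n * cnj (a (n - i))" if "i \<le> n" for i
      using that anc self[of i] n by (auto simp: a_def)
    have "(\<Sum>i<n. (-1) ^ i * (of_nat (n - i) / of_nat n) * a i * z ^ (n - 1 - i))
      = z ^ (n - 1) + (\<Sum>i\<in>{1..n-1}. (-1) ^ i * (of_nat (n - i) / of_nat n) * w i * z ^ (n - 1 - i))" for z
    proof -
      have "{..<n} = insert 0 {1..n-1}" using n by auto
      then have "(\<Sum>i<n. (-1) ^ i * (of_nat (n - i) / of_nat n) * a i * z ^ (n - 1 - i))
        = z ^ (n - 1) + (\<Sum>i\<in>{1..n-1}. (-1) ^ i * (of_nat (n - i) / of_nat n) * a i * z ^ (n - 1 - i))"
        using n by (simp add: a_def)
      also have "(\<Sum>i\<in>{1..n-1}. (-1) ^ i * (of_nat (n - i) / of_nat n) * a i * z ^ (n - 1 - i))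
        = (\<Sum>i\<in>{1..n-1}. (-1) ^ i * (of_nat (n - i) / of_nat n) * w i * z ^ (n - 1 - i))"
        using n by (intro sum.cong) (auto simp: a_def)
      finally show ?thesis .
    qed
    then show "(\<Sum>i<n. (-1) ^ i * (of_nat (n - i) / of_nat n) * a i * z ^ (n - 1 - i)) \<noteq> 0"
      if "cmod z > 1" for z using crit[OF that] by simp
  qed (use n an in \<open>auto simp: a_def\<close>)
  then obtain u where u: "\<And>k. k \<in> {1..n} \<Longrightarrow> cmod (u k) = 1" "\<And>i. i \<le> n \<Longrightarrow> a i = esym n i u"
    by blast
  define q where "q = m div p"
  have q: "m = q * p" "q \<ge> 1" using p m by (auto simp: q_def Suc_le_eq dvd_div_eq_0_iff)
  have "\<exists>z. \<forall>k\<in>{1..n}. cmod (z k) = 1 \<and> z k ^ m = u k"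
    using unimodular_root[OF u(1) m] by (intro bchoice) blast
  then obtain z where z: "\<And>k. k \<in> {1..n} \<Longrightarrow> cmod (z k) = 1" "\<And>k. k \<in> {1..n} \<Longrightarrow> z k ^ m = u k"
    by blast
  define v where "v = (\<Prod>k\<in>{1..n}. z k) ^ q"
  have v1: "cmod v = 1" using z by (simp add: v_def norm_power flip: prod_norm)
  have vp: "v ^ p = w n ^ p"
  proof -
    have "v ^ p = (\<Prod>k\<in>{1..n}. z k ^ m)" by (simp add: v_def q prod_power_distrib power_mult)
    also have "\<dots> = esym n n u" using z by (simp add: esym_top)
    also have "\<dots> = w n ^ p" using u(2)[of n] n by (simp add: a_def)
    finally show ?thesis .
  qed
  \<comment> \<open>\<zeta>^m = (w n / v)^p = 1, so multiplying one z_k by \<zeta> leaves every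
    z_k^m unchanged while the last coordinate moves from \<open>v\<close> to
    \<open>w n\<close>.\<close>
  obtain \<zeta> where \<zeta>: "cmod \<zeta> = 1" "\<zeta> ^ q = w n / v"
    using unimodular_root[of "w n / v" q] v1 wn q by (auto simp: norm_divide)
  have \<zeta>m: "\<zeta> ^ m = 1"
    using v1 by (simp add: q power_mult \<zeta> power_divide vp) (use wn in auto)
  define y where "y k = (if k \<in> {1..n} then (if k = 1 then \<zeta> else 1) * z k else 0)" for k
  have y: "y \<in> cspace n" "\<And>k. k \<in> {1..n} \<Longrightarrow> cmod (y k) = 1" "\<And>k. k \<in> {1..n} \<Longrightarrow> y k ^ m = u k"
    using z \<zeta> \<zeta>m by (auto simp: y_def cspace_def norm_mult power_mult_distrib)
  have esym: "esym n i (\<lambda>k. y k ^ m) = esym n i u" for i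
    unfolding esym_def by (intro sum.cong prod.cong) (use y in auto)
  have "(\<Prod>k\<in>{1..n}. y k) = (\<Prod>k\<in>{1..n}. (if k = 1 then \<zeta> else 1) * z k)"
    by (rule prod.cong) (auto simp: y_def)
  also have "\<dots> = (\<Prod>k\<in>{1..n}. if k = 1 then \<zeta> else 1) * (\<Prod>k\<in>{1..n}. z k)"
    by (rule prod.distrib)
  also have "(\<Prod>k\<in>{1..n}. if k = 1 then \<zeta> else 1) = \<zeta>" using n by (simp add: prod.delta)
  finally have "(\<Prod>k\<in>{1..n}. y k) ^ q = \<zeta> ^ q * v" by (simp add: power_mult_distrib v_def)
  moreover have "v \<noteq> 0" using v1 by auto
  ultimately have yq: "(\<Prod>k\<in>{1..n}. y k) ^ q = w n" by (simp add: \<zeta>)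
  have "theta_map n m p y i = w i" for i
    using u(2)[of i] w yq n by (auto simp: theta_map_def esym a_def q_def cspace_def)
  then have "w = theta_map n m p y" by auto
  then show ?thesis unfolding Theta_boundary_def using y by blast
qed

section \<open>Koszul complexes and joint approximate eigenvalues\<close>

context two_hilbert
begin

lemma bounded_operator_smult:
  assumes T: "bounded_operator H K T"
  shows "bounded_operator H K (\<lambda>x. a \<odot>\<^bsub>K\<^esub> T x)"
proof -
  note [simp] = bop_closed[OF T] bop_add[OF T] bop_smult[OF T]
  obtain C where C: "C > 0" "\<And>x. x \<in> carrier H \<Longrightarrow> hnorm K (T x) \<le> C * hnorm H x"
    using bop_bound[OF H.hilbert_axioms T] by blast
  show ?thesis
  proof (rule bounded_operatorI)
    show "hnorm K (a \<odot>\<^bsub>K\<^esub> T x) \<le> (cmod a * C) * hnorm H x" if "x \<in> carrier H" for x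
      using mult_left_mono[OF C(2)[OF that], of "cmod a"] that by (simp add: mult.assoc)
    show "a \<odot>\<^bsub>K\<^esub> T (c \<odot>\<^bsub>H\<^esub> x) = c \<odot>\<^bsub>K\<^esub> (a \<odot>\<^bsub>K\<^esub> T x)" if "x \<in> carrier H" for x c
      by (rule K.eqI) (use that in auto)
  qed (auto simp: K.smult_add_right)
qed

lemma bounded_operator_add:
  assumes S: "bounded_operator H K S" and T: "bounded_operator H K T"
  shows "bounded_operator H K (\<lambda>x. S x \<oplus>\<^bsub>K\<^esub> T x)"
proof -
  note [simp] = bop_closed[OF T] bop_add[OF T] bop_smult[OF T]
    bop_closed[OF S] bop_add[OF S] bop_smult[OF S]
  obtain C where C: "C > 0" "\<And>x. x \<in> carrier H \<Longrightarrow> hnorm K (T x) \<le> C * hnorm H x"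
    using bop_bound[OF H.hilbert_axioms T] by blast
  obtain B where B: "B > 0" "\<And>x. x \<in> carrier H \<Longrightarrow> hnorm K (S x) \<le> B * hnorm H x"
    using bop_bound[OF H.hilbert_axioms S] by blast
  show ?thesis
  proof (rule bounded_operatorI)
    show "hnorm K (S x \<oplus>\<^bsub>K\<^esub> T x) \<le> (B + C) * hnorm H x" if "x \<in> carrier H" for x
      using K.norm_triangle[of "S x" "T x"] B(2)[OF that] C(2)[OF that] that
      by (simp add: distrib_right)
    show "S (x \<oplus>\<^bsub>H\<^esub> y) \<oplus>\<^bsub>K\<^esub> T (x \<oplus>\<^bsub>H\<^esub> y) = (S x \<oplus>\<^bsub>K\<^esub> T x) \<oplus>\<^bsub>K\<^esub> (S y \<oplus>\<^bsub>K\<^esub> T y)"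
      if "x \<in> carrier H" "y \<in> carrier H" for x y
      by (rule K.eqI) (use that in auto)
  qed (auto simp: K.smult_add_right)
qed

lemma bounded_operator_diff:
  assumes S: "bounded_operator H K S" and T: "bounded_operator H K T"
  shows "bounded_operator H K (\<lambda>x. S x \<ominus>\<^bsub>K\<^esub> T x)"
proof -
  have "bounded_operator H K (\<lambda>x. S x \<oplus>\<^bsub>K\<^esub> (-1) \<odot>\<^bsub>K\<^esub> T x)"
    by (intro bounded_operator_add bounded_operator_smult S T)
  moreover have "S x \<oplus>\<^bsub>K\<^esub> (-1) \<odot>\<^bsub>K\<^esub> T x = S x \<ominus>\<^bsub>K\<^esub> T x" if "x \<in> carrier H" for x
    using bop_closed[OF T that] by (simp add: a_minus_def K.inv_eq_smult)
  ultimately show ?thesis unfolding bounded_operator_def by (simp add: Pi_iff)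
qed

lemma bounded_operator_zero: "bounded_operator H K (\<lambda>x. \<zero>\<^bsub>K\<^esub>)"
proof (rule bounded_operatorI[where C = 0])
  show "\<zero>\<^bsub>K\<^esub> = c \<odot>\<^bsub>K\<^esub> \<zero>\<^bsub>K\<^esub>" for c by (rule K.eqI) auto
qed auto

lemma bounded_operator_cong:
  assumes "bounded_operator H K S" "\<And>x. x \<in> carrier H \<Longrightarrow> T x = S x"
  shows "bounded_operator H K T"
  using assms unfolding bounded_operator_def by (simp add: Pi_iff)

lemma bounded_operator_finsum:
  assumes "finite F" "\<And>i. i \<in> F \<Longrightarrow> bounded_operator H K (T i)"
  shows "bounded_operator H K (\<lambda>x. finsum K (\<lambda>i. T i x) F)"
  using assms
proof (induction F rule: finite_induct)
  case empty
  then show ?case using bounded_operator_zero by simp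
next
  case (insert a F)
  then have "bounded_operator H K (\<lambda>x. T a x \<oplus>\<^bsub>K\<^esub> finsum K (\<lambda>i. T i x) F)"
    by (intro bounded_operator_add) auto
  then show ?case
  proof (rule bounded_operator_cong)
    fix x assume x: "x \<in> carrier H"
    have "T i x \<in> carrier K" if "i \<in> insert a F" for i
      using bop_closed[OF insert.prems[OF that] x] .
    then show "finsum K (\<lambda>i. T i x) (insert a F) = T a x \<oplus>\<^bsub>K\<^esub> finsum K (\<lambda>i. T i x) F"
      using insert.hyps by (simp add: Pi_iff)
  qed
qed

end

sublocale hilbert \<subseteq> self: two_hilbert H H ..

section \<open>Exactness of the Koszul complex\<close>

definition ksign :: "nat \<Rightarrow> nat set \<Rightarrow> complex" where
  "ksign i I = (-1) ^ card {j\<in>I. j < i}"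

text \<open>i and k are distinct, so the presence of the smaller one flips the sign attached to the
  larger, and not conversely. It says that exterior multiplication by e_i and contraction along e_k
  anticommute.\<close>

lemma ksign_cross:
  assumes "finite I" "i \<in> I" "k \<notin> I"
  shows "ksign i I * ksign k (I - {i}) + ksign k I * ksign i (insert k I) = 0"
proof (cases "i < k")
  case True
  have "{j\<in>I. j < k} = insert i {j\<in>I - {i}. j < k}" using assms True by auto
  then have "card {j\<in>I. j < k} = Suc (card {j\<in>I - {i}. j < k})" using assms by simp
  moreover have "{j\<in>insert k I. j < i} = {j\<in>I. j < i}" using True by auto
  ultimately show ?thesis by (simp add: ksign_def)
next
  case False
  then have "k < i" using assms by (metis linorder_neqE_nat)
  then have "{j\<in>insert k I. j < i} = insert k {j\<in>I. j < i}" by auto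
  then have "card {j\<in>insert k I. j < i} = Suc (card {j\<in>I. j < i})" using assms by simp
  moreover have "{j\<in>I - {i}. j < k} = {j\<in>I. j < k}" using \<open>k < i\<close> by auto
  ultimately show ?thesis by (simp add: ksign_def)
qed

text \<open>The sign counts only indices below i, so exterior multiplication by e_i and contraction
  along e_i share it.\<close>

lemma ksign_remove: "ksign i (I - {i}) = ksign i I" and ksign_insert: "ksign i (insert i I) = ksign i I"
proof -
  have "{j\<in>I - {i}. j < i} = {j\<in>I. j < i}" "{j\<in>insert i I. j < i} = {j\<in>I. j < i}" by auto
  then show "ksign i (I - {i}) = ksign i I" "ksign i (insert i I) = ksign i I"
    by (simp_all add: ksign_def)
qed

lemma ksign_square [simp]: "ksign i I * ksign i I = 1"
  by (simp add: ksign_def flip: power_mult_distrib)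

context hilbert
begin

text \<open>The operators \<open>B\<close> give a contracting homotopy of the Koszul complex.\<close>

lemma koszul_exactI:
  assumes M: "\<And>i. i \<in> {1..r} \<Longrightarrow> bounded_operator H H (M i)"
    and B: "\<And>i. i \<in> {1..r} \<Longrightarrow> bounded_operator H H (B i)"
    and comm: "\<And>i j x. i \<in> {1..r} \<Longrightarrow> j \<in> {1..r} \<Longrightarrow> x \<in> carrier H \<Longrightarrow> B i (M j x) = M j (B i x)"
    and unit: "\<And>x. x \<in> carrier H \<Longrightarrow> finsum H (\<lambda>i. M i (B i x)) {1..r} = x"
  shows "koszul_exact H r M"
  unfolding koszul_exact_def
proof (intro ballI impI)
  fix \<xi> assume \<xi>: "\<xi> \<in> Pow {1..r} \<rightarrow> carrier H" and d: "\<forall>I\<in>Pow {1..r}. koszul_d H M \<xi> I = \<zero>"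
  have \<xi>c: "\<xi> I \<in> carrier H" if "I \<subseteq> {1..r}" for I using \<xi> that by auto
  have Mc: "M i x \<in> carrier H" if "i \<in> {1..r}" "x \<in> carrier H" for i x using bop_closed[OF M] that by auto
  have Bc: "B i x \<in> carrier H" if "i \<in> {1..r}" "x \<in> carrier H" for i x using bop_closed[OF B] that by auto
  \<comment> \<open>The homotopy h: the sum of the \<open>B k\<close> combined with contraction
    along e_k. Then d h + h d is the sum of the M_i B_i, which is the identity, and d \<xi> = 0
    leaves \<xi> = d (h \<xi>).\<close>
  define \<eta> where "\<eta> I = finsum H (\<lambda>k. ksign k I \<odot> B k (\<xi> (insert k I))) ({1..r} - I)" for I
  have \<eta>c: "\<eta> I \<in> carrier H" if "I \<subseteq> {1..r}" for I
    unfolding \<eta>_def by (intro finsum_closed) (use that \<xi>c Bc in auto)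
  have "\<xi> I = koszul_d H M \<eta> I" if I: "I \<subseteq> {1..r}" for I
  proof (rule eqI)
    have fin: "finite I" using I finite_subset by blast
    have dsum: "koszul_d H M \<zeta> J = finsum H (\<lambda>i. ksign i J \<odot> M i (\<zeta> (J - {i}))) J" for \<zeta> J
      by (simp add: koszul_d_def ksign_def)
    show "\<xi> I \<in> carrier H" using \<xi>c I .
    have M\<eta>: "M i (\<eta> (I - {i})) \<in> carrier H" if "i \<in> I" for i
      using I that by (intro Mc \<eta>c) auto
    show "koszul_d H M \<eta> I \<in> carrier H"
      unfolding dsum by (intro finsum_closed) (use M\<eta> in auto)
    fix v assume v: "v \<in> carrier H"
    let ?b = "\<lambda>i k. hinner H (M i (B k (\<xi> (insert k (I - {i}))))) v"
    \<comment> \<open>Component I of d (h \<xi>): the terms k = i give M_i B_i with i in I, the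
      others are mixed.\<close>
    have dd: "hinner H (koszul_d H M \<eta> I) v = (\<Sum>i\<in>I. hinner H (M i (B i (\<xi> I))) v)
      + (\<Sum>i\<in>I. \<Sum>k\<in>{1..r}-I. ksign i I * ksign k (I - {i}) * ?b i k)"
    proof -
      have "hinner H (koszul_d H M \<eta> I) v = (\<Sum>i\<in>I. ksign i I * hinner H (M i (\<eta> (I - {i}))) v)"
        unfolding dsum using fin M\<eta> v by (subst inner_finsum_left) auto
      also have "\<dots> = (\<Sum>i\<in>I. hinner H (M i (B i (\<xi> I))) v
          + (\<Sum>k\<in>{1..r}-I. ksign i I * ksign k (I - {i}) * ?b i k))"
      proof (rule sum.cong)
        fix i assume i: "i \<in> I"
        then have ir: "i \<in> {1..r}" using I by auto
        have J: "{1..r} - (I - {i}) = insert i ({1..r} - I)" using i I by auto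
        have sub: "insert k (I - {i}) \<subseteq> {1..r}" if "k \<in> insert i ({1..r} - I)" for k
          using that I ir by auto
        have Bk: "B k (\<xi> (insert k (I - {i}))) \<in> carrier H" if "k \<in> insert i ({1..r} - I)" for k
          by (intro Bc \<xi>c sub that) (use that ir in auto)
        have "M i (\<eta> (I - {i})) = finsum H (\<lambda>k. M i (ksign k (I - {i}) \<odot> B k (\<xi> (insert k (I - {i})))))
            (insert i ({1..r} - I))"
          unfolding \<eta>_def J by (rule self.bop_finsum[OF M[OF ir]]) (use Bk in auto)
        then have "hinner H (M i (\<eta> (I - {i}))) v
            = (\<Sum>k\<in>insert i ({1..r} - I). hinner H (M i (ksign k (I - {i}) \<odot> B k (\<xi> (insert k (I - {i}))))) v)"
          by simp (rule inner_finsum_left, use Bk Mc[OF ir] v in auto)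
        also have "\<dots> = (\<Sum>k\<in>insert i ({1..r} - I). ksign k (I - {i}) * ?b i k)"
          by (rule sum.cong) (use Bk Mc[OF ir] v bop_smult[OF M[OF ir]] in auto)
        also have "\<dots> = ksign i I * hinner H (M i (B i (\<xi> I))) v
            + (\<Sum>k\<in>{1..r}-I. ksign k (I - {i}) * ?b i k)"
          using i by (simp add: ksign_remove insert_absorb)
        finally show "ksign i I * hinner H (M i (\<eta> (I - {i}))) v = hinner H (M i (B i (\<xi> I))) v
          + (\<Sum>k\<in>{1..r}-I. ksign i I * ksign k (I - {i}) * ?b i k)"
          by (simp add: distrib_left sum_distrib_left mult.assoc flip: mult.assoc[of "ksign i I" "ksign i I"])
      qed simp
      finally show ?thesis by (simp add: sum.distrib)
    qed
    \<comment> \<open>Component I of h (d \<xi>), which vanishes: here the terms i = k give M_k B_k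
      with k outside I.\<close>
    have hd: "0 = (\<Sum>k\<in>{1..r}-I. hinner H (M k (B k (\<xi> I))) v)
      + (\<Sum>k\<in>{1..r}-I. \<Sum>i\<in>I. ksign k I * ksign i (insert k I) * ?b i k)"
    proof -
      have "0 = hinner H (M k (B k (\<xi> I))) v + (\<Sum>i\<in>I. ksign k I * ksign i (insert k I) * ?b i k)"
        if k: "k \<in> {1..r} - I" for k
      proof -
        have kr: "k \<in> {1..r}" using k by auto
        have sub: "insert k I - {i} \<subseteq> {1..r}" if "i \<in> insert k I" for i using I kr by auto
        have ir: "i \<in> {1..r}" if "i \<in> insert k I" for i using that I kr by auto
        have Mk: "M i (\<xi> (insert k I - {i})) \<in> carrier H" if "i \<in> insert k I" for i
          by (intro Mc \<xi>c sub ir that)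
        have "B k (koszul_d H M \<xi> (insert k I)) = \<zero>"
          using d I kr self.bop_zero[OF B[OF kr]] by auto
        then have "0 = hinner H (B k (koszul_d H M \<xi> (insert k I))) v" using v by simp
        also have "B k (koszul_d H M \<xi> (insert k I))
            = finsum H (\<lambda>i. B k (ksign i (insert k I) \<odot> M i (\<xi> (insert k I - {i})))) (insert k I)"
          unfolding dsum by (rule self.bop_finsum[OF B[OF kr]]) (use fin Mk in auto)
        also have "hinner H \<dots> v
            = (\<Sum>i\<in>insert k I. hinner H (B k (ksign i (insert k I) \<odot> M i (\<xi> (insert k I - {i})))) v)"
          using fin Mk Bc[OF kr] v by (intro inner_finsum_left) auto
        also have "\<dots> = (\<Sum>i\<in>insert k I. ksign i (insert k I) * hinner H (M i (B k (\<xi> (insert k I - {i})))) v)"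
        proof (rule sum.cong)
          fix i assume i: "i \<in> insert k I"
          have x: "\<xi> (insert k I - {i}) \<in> carrier H" using sub[OF i] \<xi>c by blast
          show "hinner H (B k (ksign i (insert k I) \<odot> M i (\<xi> (insert k I - {i})))) v
            = ksign i (insert k I) * hinner H (M i (B k (\<xi> (insert k I - {i})))) v"
            using bop_smult[OF B[OF kr] Mc[OF ir[OF i] x]] comm[OF kr ir[OF i] x]
              Mc[OF ir[OF i] Bc[OF kr x]] v by simp
        qed simp
        also have "\<dots> = ksign k I * hinner H (M k (B k (\<xi> I))) v
            + (\<Sum>i\<in>I. ksign i (insert k I) * ?b i k)"
        proof -
          have "insert k I - {k} = I" using k by auto
          moreover have "(\<Sum>i\<in>I. ksign i (insert k I) * hinner H (M i (B k (\<xi> (insert k I - {i})))) v)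
              = (\<Sum>i\<in>I. ksign i (insert k I) * ?b i k)"
          proof (rule sum.cong)
            fix i assume "i \<in> I"
            then have "insert k I - {i} = insert k (I - {i})" using k by auto
            then show "ksign i (insert k I) * hinner H (M i (B k (\<xi> (insert k I - {i})))) v
              = ksign i (insert k I) * ?b i k" by simp
          qed simp
          ultimately show ?thesis using fin k by (simp add: ksign_insert)
        qed
        finally have "ksign k I * 0 = ksign k I * (ksign k I * hinner H (M k (B k (\<xi> I))) v
            + (\<Sum>i\<in>I. ksign i (insert k I) * ?b i k))" by simp
        then show ?thesis
          by (simp add: distrib_left sum_distrib_left mult.assoc flip: mult.assoc[of "ksign k I" "ksign k I"])
      qed
      then have "(\<Sum>k\<in>{1..r}-I. (0::complex)) = (\<Sum>k\<in>{1..r}-I. hinner H (M k (B k (\<xi> I))) v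
          + (\<Sum>i\<in>I. ksign k I * ksign i (insert k I) * ?b i k))" by (intro sum.cong) auto
      then show ?thesis by (simp add: sum.distrib)
    qed
    have cancel: "(\<Sum>i\<in>I. \<Sum>k\<in>{1..r}-I. ksign i I * ksign k (I - {i}) * ?b i k)
      + (\<Sum>k\<in>{1..r}-I. \<Sum>i\<in>I. ksign k I * ksign i (insert k I) * ?b i k) = 0"
    proof -
      have "(\<Sum>k\<in>{1..r}-I. \<Sum>i\<in>I. ksign k I * ksign i (insert k I) * ?b i k)
        = (\<Sum>i\<in>I. \<Sum>k\<in>{1..r}-I. ksign k I * ksign i (insert k I) * ?b i k)" by (rule sum.swap)
      then have "(\<Sum>i\<in>I. \<Sum>k\<in>{1..r}-I. ksign i I * ksign k (I - {i}) * ?b i k)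
      + (\<Sum>k\<in>{1..r}-I. \<Sum>i\<in>I. ksign k I * ksign i (insert k I) * ?b i k)
        = (\<Sum>i\<in>I. \<Sum>k\<in>{1..r}-I. (ksign i I * ksign k (I - {i}) + ksign k I * ksign i (insert k I)) * ?b i k)"
        by (simp add: distrib_right flip: sum.distrib)
      also have "\<dots> = 0" using ksign_cross[OF fin] by (intro sum.neutral ballI) auto
      finally show ?thesis .
    qed
    \<comment> \<open>a and b are the diagonal sums over the complement of I and over I, c and d the
      mixed sums of \<open>dd\<close> and \<open>hd\<close>.\<close>
    have arith: "x = y" if "x = a + b" "y = b + c" "0 = a + d" "c + d = 0" for x y a b c d :: complex
    proof -
      have "a + d = c + d" using that by simp
      then show ?thesis using that(1,2) by simp
    qed
    have "hinner H (\<xi> I) v = hinner H (finsum H (\<lambda>i. M i (B i (\<xi> I))) {1..r}) v"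
      using unit[OF \<xi>c[OF I]] by simp
    also have "\<dots> = (\<Sum>i\<in>{1..r}. hinner H (M i (B i (\<xi> I))) v)"
      by (intro inner_finsum_left) (use \<xi>c[OF I] Bc Mc v in auto)
    also have "\<dots> = (\<Sum>i\<in>{1..r}-I. hinner H (M i (B i (\<xi> I))) v) + (\<Sum>i\<in>I. hinner H (M i (B i (\<xi> I))) v)"
      using I by (intro sum.subset_diff) auto
    finally show "hinner H (\<xi> I) v = hinner H (koszul_d H M \<eta> I) v"
      by (rule arith[OF _ dd hd cancel])
  qed
  then show "\<exists>\<eta>\<in>Pow {1..r} \<rightarrow> carrier H. \<forall>I\<in>Pow {1..r}. \<xi> I = koszul_d H M \<eta> I"
    using \<eta>c by (intro bexI[of _ \<eta>]) auto
qed

text \<open>\<open>B i = P\<^sup>-\<^sup>1 M\<^sub>i\<^sup>*\<close> with \<open>P = \<Sum> M\<^sub>i\<^sup>* M\<^sub>i\<close>.\<close>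

lemma koszul_exact_coercive:
  assumes M: "\<And>i. i \<in> {1..r} \<Longrightarrow> bounded_operator H H (M i)"
    and Ms: "\<And>i. i \<in> {1..r} \<Longrightarrow> bounded_operator H H (Ms i)"
    and adj: "\<And>i x y. i \<in> {1..r} \<Longrightarrow> x \<in> carrier H \<Longrightarrow> y \<in> carrier H \<Longrightarrow>
      hinner H (M i x) y = hinner H x (Ms i y)"
    and MM: "\<And>i j x. i \<in> {1..r} \<Longrightarrow> j \<in> {1..r} \<Longrightarrow> x \<in> carrier H \<Longrightarrow> M i (M j x) = M j (M i x)"
    and MsM: "\<And>i j x. i \<in> {1..r} \<Longrightarrow> j \<in> {1..r} \<Longrightarrow> x \<in> carrier H \<Longrightarrow> Ms i (M j x) = M j (Ms i x)"
    and c: "c > 0" "\<And>x. x \<in> carrier H \<Longrightarrow> c * (hnorm H x)\<^sup>2 \<le> (\<Sum>i\<in>{1..r}. (hnorm H (M i x))\<^sup>2)"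
  shows "koszul_exact H r M"
proof -
  have Mc: "M i x \<in> carrier H" if "i \<in> {1..r}" "x \<in> carrier H" for i x using bop_closed[OF M] that by auto
  have Msc: "Ms i x \<in> carrier H" if "i \<in> {1..r}" "x \<in> carrier H" for i x using bop_closed[OF Ms] that by auto
  have adj': "hinner H (Ms i x) y = hinner H x (M i y)"
    if "i \<in> {1..r}" "x \<in> carrier H" "y \<in> carrier H" for i x y
    using adj[of i y x] inner_commute[of "M i y" x] inner_commute[of y "Ms i x"] that Mc Msc by simp
  define P where "P x = finsum H (\<lambda>i. Ms i (M i x)) {1..r}" for x
  have P: "bounded_operator H H P"
    unfolding P_def
    by (intro self.bounded_operator_finsum bounded_operator_comp[OF hilbert_axioms hilbert_axioms M Ms]) auto
  note Pc = bop_closed[OF P]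
  have Pin: "hinner H (P x) y = (\<Sum>i\<in>{1..r}. hinner H (M i x) (M i y))"
    if "x \<in> carrier H" "y \<in> carrier H" for x y
    unfolding P_def using that Mc Msc by (subst inner_finsum_left) (auto simp: adj')
  have Pin': "hinner H x (P y) = (\<Sum>i\<in>{1..r}. hinner H (M i x) (M i y))"
    if "x \<in> carrier H" "y \<in> carrier H" for x y
    unfolding P_def using that Mc Msc by (subst inner_finsum_right) (auto simp: adj)
  have coer: "c * (hnorm H x)\<^sup>2 \<le> Re (hinner H (P x) x)" if x: "x \<in> carrier H" for x
  proof -
    have "Re (hinner H (P x) x) = (\<Sum>i\<in>{1..r}. (hnorm H (M i x))\<^sup>2)"
      using x Mc by (simp add: Pin Re_sum norm_sq)
    then show ?thesis using c(2)[OF x] by simp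
  qed
  have inj: "x = y" if "P x = P y" "x \<in> carrier H" "y \<in> carrier H" for x y
  proof -
    have "P (x \<ominus> y) = \<zero>" using that self.bop_diff[OF P] Pc by (simp add: minus_eq_zero_iff)
    then have "c * (hnorm H (x \<ominus> y))\<^sup>2 \<le> 0" using coer[of "x \<ominus> y"] that by simp
    then have "hnorm H (x \<ominus> y) = 0" using c(1) by (simp add: mult_le_0_iff)
    then show ?thesis using that by (simp add: minus_eq_zero_iff)
  qed
  \<comment> \<open>Coercivity makes P injective, and surjective by \<open>coercive_surj\<close>.
    The inverse R inherits from P that it commutes with the \<open>M j\<close>.\<close>
  have "\<exists>R. \<forall>y\<in>carrier H. R y \<in> carrier H \<and> P (R y) = y"
    by (intro bchoice ballI) (use coercive_surj[OF P _ c(1) coer] Pin Pin' in auto)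
  then obtain R where Rc: "\<And>y. y \<in> carrier H \<Longrightarrow> R y \<in> carrier H" and PR: "\<And>y. y \<in> carrier H \<Longrightarrow> P (R y) = y"
    by blast
  have RP: "R (P x) = x" if "x \<in> carrier H" for x
    using inj[of "R (P x)" x] PR Rc Pc that by simp
  have R: "bounded_operator H H R"
  proof (rule bounded_operatorI[where C = "1 / c"])
    show "R (x \<oplus> y) = R x \<oplus> R y" if "x \<in> carrier H" "y \<in> carrier H" for x y
      by (rule inj) (use that PR Rc bop_add[OF P] in auto)
    show "R (a \<odot> x) = a \<odot> R x" if "x \<in> carrier H" for a x
      by (rule inj) (use that PR Rc bop_smult[OF P] in auto)
    fix x assume x: "x \<in> carrier H"
    have "c * (hnorm H (R x))\<^sup>2 \<le> Re (hinner H x (R x))" using coer[OF Rc[OF x]] PR[OF x] by simp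
    also have "\<dots> \<le> hnorm H x * hnorm H (R x)"
      using Cauchy_Schwarz[OF x Rc[OF x]] complex_Re_le_cmod order_trans by blast
    finally have *: "(c * hnorm H (R x)) * hnorm H (R x) \<le> hnorm H x * hnorm H (R x)"
      by (simp add: power2_eq_square)
    have "c * hnorm H (R x) \<le> hnorm H x"
    proof (cases "hnorm H (R x) = 0")
      case True
      then show ?thesis using x by simp
    next
      case False
      then have "0 < hnorm H (R x)" using norm_nonneg[OF Rc[OF x]] by linarith
      then show ?thesis using * by (rule mult_right_le_imp_le[rotated])
    qed
    then show "hnorm H (R x) \<le> 1 / c * hnorm H x" using c(1) by (simp add: field_simps)
  qed (use Rc in auto)
  have MP: "M j (P x) = P (M j x)" if j: "j \<in> {1..r}" and x: "x \<in> carrier H" for j x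
  proof -
    have "M j (P x) = finsum H (\<lambda>i. M j (Ms i (M i x))) {1..r}"
      unfolding P_def by (rule self.bop_finsum[OF M[OF j]]) (use x Mc Msc in auto)
    also have "\<dots> = P (M j x)"
      unfolding P_def by (rule finsum_cong') (use j x Mc Msc MM MsM in auto)
    finally show ?thesis .
  qed
  have MR: "M j (R x) = R (M j x)" if "j \<in> {1..r}" "x \<in> carrier H" for j x
    by (rule inj) (use that PR Rc Mc MP[symmetric] in auto)
  show ?thesis
  proof (rule koszul_exactI)
    show "bounded_operator H H (\<lambda>x. R (Ms i x))" if "i \<in> {1..r}" for i
      using bounded_operator_comp[OF hilbert_axioms hilbert_axioms Ms[OF that] R] .
    show "R (Ms i (M j x)) = M j (R (Ms i x))" if "i \<in> {1..r}" "j \<in> {1..r}" "x \<in> carrier H" for i j x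
      using that MsM MR Msc by simp
    show "finsum H (\<lambda>i. M i (R (Ms i x))) {1..r} = x" if x: "x \<in> carrier H" for x
    proof -
      have "finsum H (\<lambda>i. M i (R (Ms i x))) {1..r} = finsum H (\<lambda>i. R (Ms i (M i x))) {1..r}"
        by (rule finsum_cong') (use x MR Msc Mc Rc MsM in auto)
      also have "\<dots> = R (P x)"
        unfolding P_def by (rule self.bop_finsum[OF R, symmetric]) (use x Mc Msc in auto)
      finally show ?thesis using RP x by simp
    qed
  qed (use M in auto)
qed

section \<open>Approximate eigenvalues along a fixed sequence\<close>

definition approx_eigen :: "(nat \<Rightarrow> 'a) \<Rightarrow> ('a \<Rightarrow> 'a) \<Rightarrow> complex \<Rightarrow> bool" where
  "approx_eigen f T w \<longleftrightarrow> (\<lambda>k. hnorm H (T (f k) \<ominus> w \<odot> f k)) \<longlonglongrightarrow> 0"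

lemma approx_eigenI:
  assumes "\<And>k. f k \<in> carrier H" "bounded_operator H H T"
    and "\<And>k. hnorm H (T (f k) \<ominus> w \<odot> f k) \<le> b k" "b \<longlonglongrightarrow> 0"
  shows "approx_eigen f T w"
  unfolding approx_eigen_def
  by (rule tendsto_sandwich[OF _ _ tendsto_const assms(4)])
    (use assms(3) bop_closed[OF assms(2)] assms(1) in auto)

text \<open>S T - v w = S (T - w) + w (S - v). With the rules for sums and multiples this makes the
  approximate eigenvalue along one sequence multiplicative and linear in the operator, so relations
  between operators pass to the eigenvalues.\<close>

lemma approx_eigen_comp:
  assumes f: "\<And>k. f k \<in> carrier H" and S: "bounded_operator H H S" and T: "bounded_operator H H T"
    and "approx_eigen f S v" "approx_eigen f T w"
  shows "approx_eigen f (\<lambda>x. S (T x)) (v * w)"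
proof -
  obtain C where C: "C > 0" "\<And>x. x \<in> carrier H \<Longrightarrow> hnorm H (S x) \<le> C * hnorm H x"
    using bop_bound[OF hilbert_axioms S] by blast
  note [simp] = bop_closed[OF S] bop_closed[OF T] f
  show ?thesis
  proof (rule approx_eigenI)
    show "hnorm H (S (T (f k)) \<ominus> (v * w) \<odot> f k)
      \<le> C * hnorm H (T (f k) \<ominus> w \<odot> f k) + cmod w * hnorm H (S (f k) \<ominus> v \<odot> f k)" for k
    proof -
      have "S (T (f k)) \<ominus> (v * w) \<odot> f k = S (T (f k) \<ominus> w \<odot> f k) \<oplus> w \<odot> (S (f k) \<ominus> v \<odot> f k)"
        by (rule eqI) (auto simp: self.bop_diff[OF S] bop_smult[OF S] algebra_simps)
      then show ?thesis
        using norm_triangle[of "S (T (f k) \<ominus> w \<odot> f k)" "w \<odot> (S (f k) \<ominus> v \<odot> f k)"]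
          C(2)[of "T (f k) \<ominus> w \<odot> f k"] by simp
    qed
    show "(\<lambda>k. C * hnorm H (T (f k) \<ominus> w \<odot> f k) + cmod w * hnorm H (S (f k) \<ominus> v \<odot> f k)) \<longlonglongrightarrow> 0"
      using assms(4,5) unfolding approx_eigen_def
      by (intro tendsto_add_zero tendsto_mult_right_zero)
  qed (use bounded_operator_comp[OF hilbert_axioms hilbert_axioms T S] in auto)
qed

lemma approx_eigen_smult:
  assumes f: "\<And>k. f k \<in> carrier H" and T: "bounded_operator H H T" and "approx_eigen f T w"
  shows "approx_eigen f (\<lambda>x. a \<odot> T x) (a * w)"
proof -
  have "hnorm H (a \<odot> T (f k) \<ominus> (a * w) \<odot> f k) = cmod a * hnorm H (T (f k) \<ominus> w \<odot> f k)" for k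
  proof -
    have "a \<odot> T (f k) \<ominus> (a * w) \<odot> f k = a \<odot> (T (f k) \<ominus> w \<odot> f k)"
      by (rule eqI) (auto simp: f bop_closed[OF T] algebra_simps)
    then show ?thesis by (simp add: f bop_closed[OF T])
  qed
  then show ?thesis
    using assms(3) tendsto_mult_right_zero unfolding approx_eigen_def by auto
qed

lemma approx_eigen_add:
  assumes f: "\<And>k. f k \<in> carrier H" and S: "bounded_operator H H S" and T: "bounded_operator H H T"
    and "approx_eigen f S v" "approx_eigen f T w"
  shows "approx_eigen f (\<lambda>x. S x \<oplus> T x) (v + w)"
proof (rule approx_eigenI)
  note [simp] = bop_closed[OF S] bop_closed[OF T] f
  show "hnorm H ((S (f k) \<oplus> T (f k)) \<ominus> (v + w) \<odot> f k)
      \<le> hnorm H (S (f k) \<ominus> v \<odot> f k) + hnorm H (T (f k) \<ominus> w \<odot> f k)" for k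
  proof -
    have "(S (f k) \<oplus> T (f k)) \<ominus> (v + w) \<odot> f k = (S (f k) \<ominus> v \<odot> f k) \<oplus> (T (f k) \<ominus> w \<odot> f k)"
      by (rule eqI) (auto simp: algebra_simps)
    then show ?thesis using norm_triangle by simp
  qed
  show "(\<lambda>k. hnorm H (S (f k) \<ominus> v \<odot> f k) + hnorm H (T (f k) \<ominus> w \<odot> f k)) \<longlonglongrightarrow> 0"
    using assms(4,5) unfolding approx_eigen_def by (rule tendsto_add_zero)
qed (use f self.bounded_operator_add S T in auto)

lemma approx_eigen_id: "(\<And>k. f k \<in> carrier H) \<Longrightarrow> approx_eigen f (\<lambda>x. x) 1"
  unfolding approx_eigen_def by (simp add: minus_eq_zero_iff[THEN iffD2])

lemma approx_eigen_funpow: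
  assumes f: "\<And>k. f k \<in> carrier H" and T: "bounded_operator H H T" and "approx_eigen f T w"
  shows "approx_eigen f (T ^^ l) (w ^ l)"
proof (induction l)
  case 0
  then show ?case using approx_eigen_id[OF f] by (simp add: id_def)
next
  case (Suc l)
  then show ?case
    using approx_eigen_comp[OF f T bounded_operator_funpow[OF hilbert_axioms T] assms(3) Suc]
    by (simp add: o_def)
qed

text \<open>On unit vectors the eigenvalue is a limit of scalar products. It is therefore unique,
  and adjoints can be brought in by moving an operator to the other side.\<close>

lemma approx_eigen_inner:
  assumes f: "\<And>k. f k \<in> carrier H" "\<And>k. hnorm H (f k) = 1" and T: "bounded_operator H H T"
    and "approx_eigen f T w"
  shows "(\<lambda>k. hinner H (T (f k)) (f k)) \<longlonglongrightarrow> w"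
proof -
  note [simp] = bop_closed[OF T] f
  have "(\<lambda>k. hinner H (T (f k)) (f k) - w) \<longlonglongrightarrow> 0"
  proof (rule Lim_null_comparison[OF _ assms(4)[unfolded approx_eigen_def]])
    have "cmod (hinner H (T (f k)) (f k) - w) \<le> hnorm H (T (f k) \<ominus> w \<odot> f k)" for k
      using Cauchy_Schwarz[of "T (f k) \<ominus> w \<odot> f k" "f k"] by (simp add: inner_self)
    then show "\<forall>\<^sub>F k in sequentially. cmod (hinner H (T (f k)) (f k) - w) \<le> hnorm H (T (f k) \<ominus> w \<odot> f k)"
      by simp
  qed
  then show ?thesis by (simp add: LIM_zero_iff)
qed

text \<open>Failure of coercivity for every c > 0 produces the sequence: the k-th vector belongs to
  c = (1 / Suc k)^2. Joint normality enters as \<open>NsN\<close>, commutation of each adjoint with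
  every operator, which for Laurent operators can be read off a formula for the adjoint.\<close>

lemma taylor_spectrum_approx_eigen:
  assumes N: "\<And>i. i \<in> {1..r} \<Longrightarrow> bounded_operator H H (N i)"
    and Ns: "\<And>i. i \<in> {1..r} \<Longrightarrow> bounded_operator H H (Ns i)"
    and adj: "\<And>i x y. i \<in> {1..r} \<Longrightarrow> x \<in> carrier H \<Longrightarrow> y \<in> carrier H \<Longrightarrow>
      hinner H (N i x) y = hinner H x (Ns i y)"
    and NN: "\<And>i j x. i \<in> {1..r} \<Longrightarrow> j \<in> {1..r} \<Longrightarrow> x \<in> carrier H \<Longrightarrow> N i (N j x) = N j (N i x)"
    and NsN: "\<And>i j x. i \<in> {1..r} \<Longrightarrow> j \<in> {1..r} \<Longrightarrow> x \<in> carrier H \<Longrightarrow> Ns i (N j x) = N j (Ns i x)"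
    and w: "w \<in> taylor_spectrum H r N"
  shows "\<exists>f. (\<forall>k. f k \<in> carrier H \<and> hnorm H (f k) = 1) \<and> (\<forall>i\<in>{1..r}. approx_eigen f (N i) (w i))"
proof -
  define M where "M i x = N i x \<ominus> w i \<odot> x" for i x
  define Ms where "Ms i x = Ns i x \<ominus> cnj (w i) \<odot> x" for i x
  have Nc: "N i x \<in> carrier H" if "i \<in> {1..r}" "x \<in> carrier H" for i x using bop_closed[OF N] that by auto
  have Nsc: "Ns i x \<in> carrier H" if "i \<in> {1..r}" "x \<in> carrier H" for i x using bop_closed[OF Ns] that by auto
  have Mb: "bounded_operator H H (M i)" "bounded_operator H H (Ms i)" if "i \<in> {1..r}" for i
    unfolding M_def Ms_def
    by (intro self.bounded_operator_diff self.bounded_operator_smult N Ns that bounded_operator_id)+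
  have adjM: "hinner H (M i x) y = hinner H x (Ms i y)" if "i \<in> {1..r}" "x \<in> carrier H" "y \<in> carrier H" for i x y
    using that adj Nc Nsc by (simp add: M_def Ms_def)
  have lin: "N i (N j x \<ominus> a \<odot> x) = N i (N j x) \<ominus> a \<odot> N i x"
    if "i \<in> {1..r}" "j \<in> {1..r}" "x \<in> carrier H" for i j x a
    using that self.bop_diff[OF N] bop_smult[OF N] Nc by simp
  have lin2: "Ns i (N j x \<ominus> a \<odot> x) = Ns i (N j x) \<ominus> a \<odot> Ns i x"
    if "i \<in> {1..r}" "j \<in> {1..r}" "x \<in> carrier H" for i j x a
    using that self.bop_diff[OF Ns] bop_smult[OF Ns] Nc by simp
  have lin3: "N j (Ns i x \<ominus> a \<odot> x) = N j (Ns i x) \<ominus> a \<odot> N j x"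
    if "i \<in> {1..r}" "j \<in> {1..r}" "x \<in> carrier H" for i j x a
    using that self.bop_diff[OF N] bop_smult[OF N] Nsc by simp
  have MM: "M i (M j x) = M j (M i x)" if "i \<in> {1..r}" "j \<in> {1..r}" "x \<in> carrier H" for i j x
    by (rule eqI) (use that NN[of i j x] in \<open>auto simp: M_def lin Nc algebra_simps\<close>)
  have MsM: "Ms i (M j x) = M j (Ms i x)" if "i \<in> {1..r}" "j \<in> {1..r}" "x \<in> carrier H" for i j x
    by (rule eqI) (use that NsN[of i j x] in \<open>auto simp: M_def Ms_def lin2 lin3 Nc Nsc algebra_simps\<close>)
  have nex: "\<not> koszul_exact H r M" using w by (simp add: taylor_spectrum_def M_def[abs_def])
  have no: "\<exists>x\<in>carrier H. (\<Sum>i\<in>{1..r}. (hnorm H (M i x))\<^sup>2) < c * (hnorm H x)\<^sup>2" if "c > 0" for c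
  proof (rule ccontr)
    assume "\<not> ?thesis"
    then have *: "c * (hnorm H x)\<^sup>2 \<le> (\<Sum>i\<in>{1..r}. (hnorm H (M i x))\<^sup>2)" if "x \<in> carrier H" for x
      using that by (auto simp: not_less)
    have "koszul_exact H r M"
      by (rule koszul_exact_coercive[OF Mb adjM MM MsM \<open>c > 0\<close> *])
    with nex show False by blast
  qed
  have "\<exists>x. x \<in> carrier H \<and> hnorm H x = 1 \<and> (\<Sum>i\<in>{1..r}. (hnorm H (M i x))\<^sup>2) < c" if c: "c > 0" for c
  proof -
    obtain x where x: "x \<in> carrier H" "(\<Sum>i\<in>{1..r}. (hnorm H (M i x))\<^sup>2) < c * (hnorm H x)\<^sup>2"
      using no[OF c] by blast
    have nz: "hnorm H x \<noteq> 0"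
    proof
      assume "hnorm H x = 0"
      then have "(\<Sum>i\<in>{1..r}. (hnorm H (M i x))\<^sup>2) < 0" using x(2) by simp
      moreover have "0 \<le> (\<Sum>i\<in>{1..r}. (hnorm H (M i x))\<^sup>2)" by (intro sum_nonneg) auto
      ultimately show False by simp
    qed
    define y where "y = of_real (1 / hnorm H x) \<odot> x"
    have y: "y \<in> carrier H" "hnorm H y = 1"
      using x nz norm_nonneg[OF x(1)] by (auto simp: y_def norm_divide simp del: norm_nonneg)
    have "(hnorm H (M i y))\<^sup>2 = (hnorm H (M i x))\<^sup>2 / (hnorm H x)\<^sup>2" if "i \<in> {1..r}" for i
      using bop_smult[OF Mb(1)[OF that] x(1)] bop_closed[OF Mb(1)[OF that] x(1)]
      by (simp add: y_def norm_divide power_divide)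
    then have "(\<Sum>i\<in>{1..r}. (hnorm H (M i y))\<^sup>2) = (\<Sum>i\<in>{1..r}. (hnorm H (M i x))\<^sup>2) / (hnorm H x)\<^sup>2"
      by (simp add: sum_divide_distrib)
    also have "\<dots> < c" using x(2) nz by (simp add: pos_divide_less_eq)
    finally show ?thesis using y by blast
  qed
  then have "\<exists>x. x \<in> carrier H \<and> hnorm H x = 1 \<and> (\<Sum>i\<in>{1..r}. (hnorm H (M i x))\<^sup>2) < (1 / Suc k)\<^sup>2" for k
    by simp
  from choice[OF allI[OF this]]
  obtain f where "\<forall>k. f k \<in> carrier H \<and> hnorm H (f k) = 1 \<and>
      (\<Sum>i\<in>{1..r}. (hnorm H (M i (f k)))\<^sup>2) < (1 / Suc k)\<^sup>2" by (rule exE) (rule that)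
  then have f: "\<And>k. f k \<in> carrier H" "\<And>k. hnorm H (f k) = 1"
    "\<And>k. (\<Sum>i\<in>{1..r}. (hnorm H (M i (f k)))\<^sup>2) < (1 / Suc k)\<^sup>2" by simp_all
  have "approx_eigen f (N i) (w i)" if i: "i \<in> {1..r}" for i
  proof (rule approx_eigenI[OF f(1) N[OF i]])
    show "hnorm H (N i (f k) \<ominus> w i \<odot> f k) \<le> 1 / Suc k" for k
    proof (rule power2_le_imp_le)
      have "(hnorm H (M i (f k)))\<^sup>2 \<le> (\<Sum>i\<in>{1..r}. (hnorm H (M i (f k)))\<^sup>2)"
        using i by (intro member_le_sum) auto
      then show "(hnorm H (N i (f k) \<ominus> w i \<odot> f k))\<^sup>2 \<le> (1 / Suc k)\<^sup>2"
        using f(3)[of k] by (simp add: M_def)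
    qed simp
    show "(\<lambda>k. 1 / real (Suc k)) \<longlonglongrightarrow> 0"
      using LIMSEQ_inverse_real_of_nat by (simp add: inverse_eq_divide)
  qed
  then show ?thesis using f by blast
qed

end

section \<open>Two-sided sequence spaces\<close>

text \<open>Over a space on \<open>'k\<close> the vectors have type
  \<open>int \<Rightarrow> 'k\<close>, the type that \<open>Theta_isometry\<close> prescribes. Sums
  over the integers are unordered, hence the infinite sums over a set.\<close>

definition ell2 :: "'a hspace \<Rightarrow> (int \<Rightarrow> 'a) hspace" where
  "ell2 H =
     \<lparr>carrier = {f. (\<forall>j. f j \<in> carrier H) \<and> (\<lambda>j. (hnorm H (f j))\<^sup>2) summable_on UNIV},
      monoid.mult = undefined, one = undefined,
      ring.zero = (\<lambda>j. \<zero>\<^bsub>H\<^esub>), add = (\<lambda>f g j. f j \<oplus>\<^bsub>H\<^esub> g j),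
      smult = (\<lambda>c f j. c \<odot>\<^bsub>H\<^esub> f j),
      hinner = (\<lambda>f g. \<Sum>\<^sub>\<infinity>j. hinner H (f j) (g j))\<rparr>"

lemma ell2_simps [simp]:
  "\<zero>\<^bsub>ell2 H\<^esub> = (\<lambda>j. \<zero>\<^bsub>H\<^esub>)"
  "f \<oplus>\<^bsub>ell2 H\<^esub> g = (\<lambda>j. f j \<oplus>\<^bsub>H\<^esub> g j)"
  "c \<odot>\<^bsub>ell2 H\<^esub> f = (\<lambda>j. c \<odot>\<^bsub>H\<^esub> f j)"
  by (simp_all add: ell2_def)

lemma ell2_hinner: "hinner (ell2 H) f g = (\<Sum>\<^sub>\<infinity>j. hinner H (f j) (g j))"
  by (simp add: ell2_def)

text \<open>\<open>shift 1\<close> is the bilateral shift, and \<open>shift (- s)\<close> is both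
  the inverse and the adjoint of \<open>shift s\<close>.\<close>

definition shift :: "int \<Rightarrow> (int \<Rightarrow> 'a) \<Rightarrow> int \<Rightarrow> 'a" where
  "shift s f j = f (j - s)"

definition diag :: "('a \<Rightarrow> 'a) \<Rightarrow> (int \<Rightarrow> 'a) \<Rightarrow> int \<Rightarrow> 'a" where
  "diag T f j = T (f j)"

lemma shift_shift: "shift s (shift t f) = shift (s + t) f"
  by (simp add: shift_def fun_eq_iff algebra_simps)

lemma shift_0 [simp]: "shift 0 f = f"
  by (simp add: shift_def fun_eq_iff)

lemma shift_diag: "shift s (diag T f) = diag T (shift s f)"
  by (simp add: shift_def diag_def fun_eq_iff)

lemma shift_funpow: "(shift s ^^ k) f = shift (int k * s) f"
  by (induction k) (simp_all add: shift_shift algebra_simps)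

lemma bij_diff_int: "bij_betw (\<lambda>j. j - s) (UNIV :: int set) UNIV"
  by (rule bij_betw_byWitness[where f' = "\<lambda>j. j + s"]) auto

context hilbert
begin

lemma ell2_mem_iff:
  "f \<in> carrier (ell2 H) \<longleftrightarrow>
     (\<forall>j. f j \<in> carrier H) \<and> (\<lambda>j. (hnorm H (f j))\<^sup>2) summable_on UNIV"
  by (simp only: ell2_def partial_object.simps mem_Collect_eq)

lemma ell2_memI:
  "(\<And>j. f j \<in> carrier H) \<Longrightarrow> (\<lambda>j. (hnorm H (f j))\<^sup>2) summable_on UNIV \<Longrightarrow> f \<in> carrier (ell2 H)"
  unfolding ell2_mem_iff by blast

lemma ell2_closed [simp]: "f \<in> carrier (ell2 H) \<Longrightarrow> f j \<in> carrier H"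
  unfolding ell2_mem_iff by blast

lemma ell2_summable: "f \<in> carrier (ell2 H) \<Longrightarrow> (\<lambda>j. (hnorm H (f j))\<^sup>2) summable_on UNIV"
  unfolding ell2_mem_iff by blast

text \<open>Cauchy-Schwarz in each entry dominates the products by the sum of the squares. So the
  inner product is the value of a convergent sum and not the default 0 of
  \<open>infsum\<close>.\<close>

lemma ell2_inner:
  assumes "f \<in> carrier (ell2 H)" "g \<in> carrier (ell2 H)"
  shows "((\<lambda>j. hinner H (f j) (g j)) has_sum hinner (ell2 H) f g) UNIV"
proof -
  have "(\<lambda>j. cmod (hinner H (f j) (g j))) summable_on UNIV"
  proof (rule Infinite_Sum.abs_summable_on_comparison_test')
    show "(\<lambda>j. (hnorm H (f j))\<^sup>2 + (hnorm H (g j))\<^sup>2) summable_on UNIV"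
      using assms by (intro summable_on_add ell2_summable)
    show "cmod (hinner H (f j) (g j)) \<le> (hnorm H (f j))\<^sup>2 + (hnorm H (g j))\<^sup>2" for j
    proof -
      have "cmod (hinner H (f j) (g j)) \<le> hnorm H (f j) * hnorm H (g j)"
        using assms by (intro Cauchy_Schwarz) auto
      also have "\<dots> \<le> (hnorm H (f j))\<^sup>2 + (hnorm H (g j))\<^sup>2"
      proof -
        have "0 \<le> hnorm H (f j) * hnorm H (g j)" using assms by (intro mult_nonneg_nonneg) auto
        then show ?thesis
          using sum_squares_bound[of "hnorm H (f j)" "hnorm H (g j)"] unfolding mult.assoc by linarith
      qed
      finally show ?thesis .
    qed
  qed
  then have "(\<lambda>j. hinner H (f j) (g j)) summable_on UNIV" by (rule abs_summable_summable)
  then show ?thesis unfolding ell2_hinner by (rule has_sum_infsum)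
qed

lemma norm_add_sq_le:
  assumes "x \<in> carrier H" "y \<in> carrier H"
  shows "(hnorm H (x \<oplus> y))\<^sup>2 \<le> 2 * (hnorm H x)\<^sup>2 + 2 * (hnorm H y)\<^sup>2"
  using norm_add_sq[OF assms] norm_diff_sq[OF assms] zero_le_power2[of "hnorm H (x \<ominus> y)"] by linarith

lemma ell2_add: "f \<in> carrier (ell2 H) \<Longrightarrow> g \<in> carrier (ell2 H) \<Longrightarrow> (\<lambda>j. f j \<oplus> g j) \<in> carrier (ell2 H)"
proof (rule ell2_memI)
  assume f: "f \<in> carrier (ell2 H)" and g: "g \<in> carrier (ell2 H)"
  have "(\<lambda>j. 2 * (hnorm H (f j))\<^sup>2 + 2 * (hnorm H (g j))\<^sup>2) summable_on UNIV"
    by (intro summable_on_add summable_on_cmult_right ell2_summable f g)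
  then show "(\<lambda>j. (hnorm H (f j \<oplus> g j))\<^sup>2) summable_on UNIV"
    by (rule summable_on_comparison_test) (use f g norm_add_sq_le in auto)
qed auto

lemma ell2_smult: "f \<in> carrier (ell2 H) \<Longrightarrow> (\<lambda>j. c \<odot> f j) \<in> carrier (ell2 H)"
  by (rule ell2_memI) (auto simp: power_mult_distrib intro!: summable_on_cmult_right ell2_summable)

lemma ell2_prehilbert: "prehilbert (ell2 H)"
proof (rule prehilbertI)
  show "\<zero>\<^bsub>ell2 H\<^esub> \<in> carrier (ell2 H)" by (simp, rule ell2_memI) auto
next
  fix f g h :: "int \<Rightarrow> 'a" and c d :: complex
  assume f: "f \<in> carrier (ell2 H)"
  show "c \<odot>\<^bsub>ell2 H\<^esub> f \<in> carrier (ell2 H)" using ell2_smult[OF f] by simp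
  show "\<zero>\<^bsub>ell2 H\<^esub> \<oplus>\<^bsub>ell2 H\<^esub> f = f" using f by simp
  show "(-1) \<odot>\<^bsub>ell2 H\<^esub> f \<oplus>\<^bsub>ell2 H\<^esub> f = \<zero>\<^bsub>ell2 H\<^esub>"
    using f by (auto simp: fun_eq_iff intro!: eqI)
  show "(c + d) \<odot>\<^bsub>ell2 H\<^esub> f = c \<odot>\<^bsub>ell2 H\<^esub> f \<oplus>\<^bsub>ell2 H\<^esub> d \<odot>\<^bsub>ell2 H\<^esub> f"
    using f by (simp add: smult_add_left)
  show "(c * d) \<odot>\<^bsub>ell2 H\<^esub> f = c \<odot>\<^bsub>ell2 H\<^esub> (d \<odot>\<^bsub>ell2 H\<^esub> f)"
    using f by (simp add: smult_assoc)
  show "1 \<odot>\<^bsub>ell2 H\<^esub> f = f" using f by simp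
  have ff: "((\<lambda>j. (hnorm H (f j))\<^sup>2) has_sum Re (hinner (ell2 H) f f)) UNIV"
    using has_sum_Re[OF ell2_inner[OF f f]] f by (simp add: norm_sq)
  show "0 \<le> Re (hinner (ell2 H) f f)" using ff by (rule has_sum_nonneg) simp
  show "f = \<zero>\<^bsub>ell2 H\<^esub>" if "hinner (ell2 H) f f = 0"
  proof -
    have z: "((\<lambda>j. (hnorm H (f j))\<^sup>2) has_sum 0) UNIV" using ff that by simp
    have "(hnorm H (f j))\<^sup>2 \<le> 0" for j
      using finite_sum_le_has_sum[OF z, of "{j}"] by simp
    then have "f j = \<zero>" for j using f by simp
    then show ?thesis by auto
  qed
  assume g: "g \<in> carrier (ell2 H)"
  show "f \<oplus>\<^bsub>ell2 H\<^esub> g \<in> carrier (ell2 H)" using ell2_add[OF f g] by simp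
  show "f \<oplus>\<^bsub>ell2 H\<^esub> g = g \<oplus>\<^bsub>ell2 H\<^esub> f" using f g by (simp add: a_comm)
  show "c \<odot>\<^bsub>ell2 H\<^esub> (f \<oplus>\<^bsub>ell2 H\<^esub> g) = c \<odot>\<^bsub>ell2 H\<^esub> f \<oplus>\<^bsub>ell2 H\<^esub> c \<odot>\<^bsub>ell2 H\<^esub> g"
    using f g by (simp add: smult_add_right)
  show "hinner (ell2 H) (c \<odot>\<^bsub>ell2 H\<^esub> f) g = c * hinner (ell2 H) f g"
  proof -
    have "((\<lambda>j. hinner H (c \<odot> f j) (g j)) has_sum c * hinner (ell2 H) f g) UNIV"
      using has_sum_cmult_right[OF ell2_inner[OF f g], of c] f g by simp
    from has_sum_unique[OF ell2_inner[OF ell2_smult[OF f] g] this] show ?thesis by simp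
  qed
  show "hinner (ell2 H) g f = cnj (hinner (ell2 H) f g)"
  proof -
    have "((\<lambda>j. cnj (hinner H (f j) (g j))) has_sum cnj (hinner (ell2 H) f g)) UNIV"
      using ell2_inner[OF f g] by simp
    then have "((\<lambda>j. hinner H (g j) (f j)) has_sum cnj (hinner (ell2 H) f g)) UNIV"
      using f g by (simp flip: inner_commute)
    from has_sum_unique[OF ell2_inner[OF g f] this] show ?thesis .
  qed
  assume h: "h \<in> carrier (ell2 H)"
  show "(f \<oplus>\<^bsub>ell2 H\<^esub> g) \<oplus>\<^bsub>ell2 H\<^esub> h = f \<oplus>\<^bsub>ell2 H\<^esub> (g \<oplus>\<^bsub>ell2 H\<^esub> h)"
    using f g h by (simp add: a_assoc)
  show "hinner (ell2 H) (f \<oplus>\<^bsub>ell2 H\<^esub> g) h = hinner (ell2 H) f h + hinner (ell2 H) g h"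
  proof -
    have "((\<lambda>j. hinner H (f j \<oplus> g j) (h j)) has_sum hinner (ell2 H) f h + hinner (ell2 H) g h) UNIV"
      using has_sum_add[OF ell2_inner[OF f h] ell2_inner[OF g h]] f g h by simp
    from has_sum_unique[OF ell2_inner[OF ell2_add[OF f g] h] this] show ?thesis by simp
  qed
qed

lemma ell2_norm:
  assumes f: "f \<in> carrier (ell2 H)"
  shows "((\<lambda>j. (hnorm H (f j))\<^sup>2) has_sum (hnorm (ell2 H) f)\<^sup>2) UNIV"
  using has_sum_Re[OF ell2_inner[OF f f]] f prehilbert.norm_sq[OF ell2_prehilbert f]
  by (simp add: norm_sq)

lemma ell2_norm_comp:
  assumes f: "f \<in> carrier (ell2 H)"
  shows "hnorm H (f j) \<le> hnorm (ell2 H) f"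
proof (rule power2_le_imp_le)
  show "(hnorm H (f j))\<^sup>2 \<le> (hnorm (ell2 H) f)\<^sup>2"
    using finite_sum_le_has_sum[OF ell2_norm[OF f], of "{j}"] by simp
qed (use prehilbert.norm_nonneg[OF ell2_prehilbert f] in auto)

lemma ell2_norm_leI:
  assumes f: "f \<in> carrier (ell2 H)" and b: "b \<ge> 0"
    and "\<And>F. finite F \<Longrightarrow> (\<Sum>j\<in>F. (hnorm H (f j))\<^sup>2) \<le> b\<^sup>2"
  shows "hnorm (ell2 H) f \<le> b"
  using has_sum_le_finite_sums[OF ell2_norm[OF f], of "b\<^sup>2"] assms power2_le_imp_le by blast

lemma ell2_diff:
  assumes "f \<in> carrier (ell2 H)" "g \<in> carrier (ell2 H)"
  shows "f \<ominus>\<^bsub>ell2 H\<^esub> g = (\<lambda>j. f j \<ominus> g j)"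
proof -
  interpret L: prehilbert "ell2 H" by (rule ell2_prehilbert)
  have "f \<ominus>\<^bsub>ell2 H\<^esub> g = f \<oplus>\<^bsub>ell2 H\<^esub> (-1) \<odot>\<^bsub>ell2 H\<^esub> g"
    using assms by (simp only: a_minus_def L.inv_eq_smult)
  then show ?thesis using assms by (simp add: a_minus_def inv_eq_smult)
qed

text \<open>Limits are taken coordinatewise. On a finite set of coordinates the Cauchy bound passes
  to the limit in the second index, with a bound independent of the set; this yields both square
  summability of the limit and convergence in norm.\<close>

lemma ell2_hilbert: "hilbert (ell2 H)"
proof -
  interpret L: prehilbert "ell2 H" by (rule ell2_prehilbert)
  show ?thesis
  proof (rule L.hilbertI)
    fix f :: "nat \<Rightarrow> int \<Rightarrow> 'a"
    assume f: "\<And>k. f k \<in> carrier (ell2 H)"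
      and C: "\<And>e. e > 0 \<Longrightarrow> \<exists>N. \<forall>j\<ge>N. \<forall>k\<ge>N. hnorm (ell2 H) (f j \<ominus>\<^bsub>ell2 H\<^esub> f k) < e"
    have comp: "hnorm H (f k i \<ominus> f l i) \<le> hnorm (ell2 H) (f k \<ominus>\<^bsub>ell2 H\<^esub> f l)" for k l i
    proof -
      have "f k \<ominus>\<^bsub>ell2 H\<^esub> f l \<in> carrier (ell2 H)" using f by (intro L.minus_closed)
      from ell2_norm_comp[OF this, of i] show ?thesis unfolding ell2_diff[OF f f] .
    qed
    have "\<exists>x. hlim (\<lambda>k. f k i) x" for i
    proof (rule complete[of "\<lambda>k. f k i"])
      show "\<exists>N. \<forall>j\<ge>N. \<forall>k\<ge>N. hnorm H (f j i \<ominus> f k i) < e" if "e > 0" for e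
      proof -
        obtain N where N: "\<forall>j\<ge>N. \<forall>k\<ge>N. hnorm (ell2 H) (f j \<ominus>\<^bsub>ell2 H\<^esub> f k) < e"
          using C[OF \<open>e > 0\<close>] ..
        show ?thesis
          by (intro exI[of _ N] allI impI le_less_trans[OF comp]) (use N in simp)
      qed
    qed (use f in auto)
    from choice[OF allI[OF this]] obtain x where "\<forall>i. hlim (\<lambda>k. f k i) (x i)" ..
    then have x: "\<And>i. hlim (\<lambda>k. f k i) (x i)" ..
    have xc: "x i \<in> carrier H" for i using x[of i] by (simp add: hlim_def)
    have fin: "(\<Sum>i\<in>F. (hnorm H (f k i \<ominus> x i))\<^sup>2) \<le> e\<^sup>2"
      if N: "\<forall>j\<ge>N. \<forall>k\<ge>N. hnorm (ell2 H) (f j \<ominus>\<^bsub>ell2 H\<^esub> f k) < e" and k: "k \<ge> N" and F: "finite F" for N e k F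
    proof (rule LIMSEQ_le_const2)
      show "(\<lambda>l. \<Sum>i\<in>F. (hnorm H (f k i \<ominus> f l i))\<^sup>2) \<longlonglongrightarrow> (\<Sum>i\<in>F. (hnorm H (f k i \<ominus> x i))\<^sup>2)"
      proof (intro tendsto_sum tendsto_power)
        fix i
        have "hlim (\<lambda>l. f k i \<oplus> (-1) \<odot> f l i) (f k i \<oplus> (-1) \<odot> x i)"
        proof (rule hlim_add[OF _ hlim_smult[OF x]])
          show "hlim (\<lambda>l. f k i) (f k i)" using f by (simp add: hlim_def minus_eq_zero_iff[THEN iffD2])
        qed
        moreover have "f k i \<oplus> (-1) \<odot> y = f k i \<ominus> y" if "y \<in> carrier H" for y
          using that by (simp add: a_minus_def inv_eq_smult)
        ultimately have "hlim (\<lambda>l. f k i \<ominus> f l i) (f k i \<ominus> x i)" using f xc by simp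
        then show "(\<lambda>l. hnorm H (f k i \<ominus> f l i)) \<longlonglongrightarrow> hnorm H (f k i \<ominus> x i)" by (rule hlim_norm)
      qed
      have "(\<Sum>i\<in>F. (hnorm H (f k i \<ominus> f l i))\<^sup>2) \<le> e\<^sup>2" if l: "l \<ge> N" for l
      proof -
        have d: "f k \<ominus>\<^bsub>ell2 H\<^esub> f l \<in> carrier (ell2 H)" using f by auto
        have "(\<Sum>i\<in>F. (hnorm H (f k i \<ominus> f l i))\<^sup>2) \<le> (hnorm (ell2 H) (f k \<ominus>\<^bsub>ell2 H\<^esub> f l))\<^sup>2"
          using finite_sum_le_has_sum[OF ell2_norm[OF d] F] f by (simp add: ell2_diff)
        also have "\<dots> \<le> e\<^sup>2"
          using N k l d by (intro power_mono) (auto intro: less_imp_le)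
        finally show ?thesis .
      qed
      then show "\<exists>N. \<forall>l\<ge>N. (\<Sum>i\<in>F. (hnorm H (f k i \<ominus> f l i))\<^sup>2) \<le> e\<^sup>2" by blast
    qed
    have dmem: "(\<lambda>i. f k i \<ominus> x i) \<in> carrier (ell2 H)"
      if N: "\<forall>j\<ge>N. \<forall>k\<ge>N. hnorm (ell2 H) (f j \<ominus>\<^bsub>ell2 H\<^esub> f k) < e" and k: "k \<ge> N" for N e k
    proof (rule ell2_memI)
      show "(\<lambda>j. (hnorm H (f k j \<ominus> x j))\<^sup>2) summable_on UNIV"
        by (rule nonneg_bdd_above_summable_on) (use fin[OF N k] in \<open>auto intro!: bdd_aboveI2\<close>)
    qed (use f xc in auto)
    have xmem: "x \<in> carrier (ell2 H)"
    proof -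
      obtain N where N: "\<forall>j\<ge>N. \<forall>k\<ge>N. hnorm (ell2 H) (f j \<ominus>\<^bsub>ell2 H\<^esub> f k) < 1"
        using C[of 1] by auto
      have "(\<lambda>i. f N i \<oplus> (-1) \<odot> (f N i \<ominus> x i)) \<in> carrier (ell2 H)"
        using ell2_add[OF f ell2_smult[OF dmem[OF N order_refl]]] .
      moreover have "f N i \<oplus> (-1) \<odot> (f N i \<ominus> x i) = x i" for i
        by (rule eqI) (use f xc in auto)
      ultimately show ?thesis by simp
    qed
    have "L.hlim f x"
    proof (rule L.hlimI[OF xmem f], rule LIMSEQ_I)
      fix r :: real assume r: "r > 0"
      obtain N where N: "\<forall>j\<ge>N. \<forall>k\<ge>N. hnorm (ell2 H) (f j \<ominus>\<^bsub>ell2 H\<^esub> f k) < r / 2"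
        using C[of "r / 2"] r by auto
      have "norm (hnorm (ell2 H) (f k \<ominus>\<^bsub>ell2 H\<^esub> x) - 0) < r" if "k \<ge> N" for k
      proof -
        have "hnorm (ell2 H) (f k \<ominus>\<^bsub>ell2 H\<^esub> x) \<le> r / 2"
          unfolding ell2_diff[OF f xmem]
          by (rule ell2_norm_leI[OF dmem[OF N that] _ fin[OF N that]]) (use r in auto)
        moreover have "0 \<le> hnorm (ell2 H) (f k \<ominus>\<^bsub>ell2 H\<^esub> x)" using f xmem by simp
        ultimately show ?thesis using r by simp
      qed
      then show "\<exists>no. \<forall>k\<ge>no. norm (hnorm (ell2 H) (f k \<ominus>\<^bsub>ell2 H\<^esub> x) - 0) < r" by blast
    qed
    then show "\<exists>x. L.hlim f x" by blast
  qed
qed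

section \<open>Shifts and coordinatewise operators\<close>

interpretation L: hilbert "ell2 H"
  by (rule ell2_hilbert)

lemma ell2_shift: "f \<in> carrier (ell2 H) \<Longrightarrow> shift s f \<in> carrier (ell2 H)"
  using summable_on_reindex_bij_betw[OF bij_diff_int[of s], of "\<lambda>j. (hnorm H (f j))\<^sup>2"]
  by (intro ell2_memI) (auto simp: shift_def ell2_summable)

lemma ell2_shift_norm:
  assumes "f \<in> carrier (ell2 H)"
  shows "hnorm (ell2 H) (shift s f) = hnorm (ell2 H) f"
proof -
  have "((\<lambda>j. (hnorm H (shift s f j))\<^sup>2) has_sum (hnorm (ell2 H) f)\<^sup>2) UNIV"
    using has_sum_reindex_bij_betw[OF bij_diff_int[of s], of "\<lambda>j. (hnorm H (f j))\<^sup>2"] ell2_norm[OF assms]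
    by (simp add: shift_def)
  then have "(hnorm (ell2 H) (shift s f))\<^sup>2 = (hnorm (ell2 H) f)\<^sup>2"
    by (rule has_sum_unique[OF ell2_norm[OF ell2_shift[OF assms]]])
  then show ?thesis by (rule power2_eq_imp_eq) (use assms ell2_shift[OF assms] in auto)
qed

lemma ell2_shift_bounded: "bounded_operator (ell2 H) (ell2 H) (shift s)"
proof (rule bounded_operatorI[where C = 1])
  show "hnorm (ell2 H) (shift s f) \<le> 1 * hnorm (ell2 H) f" if "f \<in> carrier (ell2 H)" for f
    using ell2_shift_norm[OF that] by simp
qed (auto simp: ell2_shift fun_eq_iff shift_def[abs_def] intro: ell2_shift[unfolded shift_def[abs_def]])

lemma ell2_shift_inner:
  assumes "f \<in> carrier (ell2 H)" "g \<in> carrier (ell2 H)"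
  shows "hinner (ell2 H) (shift s f) g = hinner (ell2 H) f (shift (-s) g)"
proof -
  have "((\<lambda>j. hinner H (f (j - s)) (shift (-s) g (j - s))) has_sum hinner (ell2 H) f (shift (-s) g)) UNIV"
    using ell2_inner[OF assms(1) ell2_shift[OF assms(2)], of "-s"]
      has_sum_reindex_bij_betw[OF bij_diff_int[of s], of "\<lambda>j. hinner H (f j) (shift (-s) g j)"] by simp
  then have "((\<lambda>j. hinner H (shift s f j) (g j)) has_sum hinner (ell2 H) f (shift (-s) g)) UNIV"
    by (simp add: shift_def)
  from has_sum_unique[OF ell2_inner[OF ell2_shift[OF assms(1)] assms(2)] this] show ?thesis .
qed

lemma ell2_diag:
  assumes T: "bounded_operator H H T" and C: "C \<ge> 0" "\<And>x. x \<in> carrier H \<Longrightarrow> hnorm H (T x) \<le> C * hnorm H x"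
    and f: "f \<in> carrier (ell2 H)"
  shows "diag T f \<in> carrier (ell2 H)" and "hnorm (ell2 H) (diag T f) \<le> C * hnorm (ell2 H) f"
proof -
  have sq: "(hnorm H (diag T f j))\<^sup>2 \<le> C\<^sup>2 * (hnorm H (f j))\<^sup>2" for j
    using power_mono[OF C(2)[of "f j"], of 2] f bop_closed[OF T] by (simp add: diag_def power_mult_distrib)
  show mem: "diag T f \<in> carrier (ell2 H)"
  proof (rule ell2_memI)
    show "(\<lambda>j. (hnorm H (diag T f j))\<^sup>2) summable_on UNIV"
      by (rule summable_on_comparison_test[OF summable_on_cmult_right[OF ell2_summable[OF f], of "C\<^sup>2"] sq]) auto
  qed (use f bop_closed[OF T] in \<open>auto simp: diag_def\<close>)
  have "(hnorm (ell2 H) (diag T f))\<^sup>2 \<le> C\<^sup>2 * (hnorm (ell2 H) f)\<^sup>2"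
    by (rule has_sum_mono[OF ell2_norm[OF mem] has_sum_cmult_right[OF ell2_norm[OF f]] sq])
  then have "(hnorm (ell2 H) (diag T f))\<^sup>2 \<le> (C * hnorm (ell2 H) f)\<^sup>2"
    by (simp add: power_mult_distrib)
  then show "hnorm (ell2 H) (diag T f) \<le> C * hnorm (ell2 H) f"
    by (rule power2_le_imp_le) (use C f in auto)
qed

lemma ell2_diag_bounded:
  assumes T: "bounded_operator H H T"
  shows "bounded_operator (ell2 H) (ell2 H) (diag T)"
proof -
  obtain C where C: "C > 0" "\<And>x. x \<in> carrier H \<Longrightarrow> hnorm H (T x) \<le> C * hnorm H x"
    using bop_bound[OF hilbert_axioms T] by blast
  show ?thesis
    by (rule bounded_operatorI[OF _ _ _ ell2_diag(2)[OF T less_imp_le[OF C(1)] C(2)]])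
      (auto simp: ell2_diag(1)[OF T less_imp_le[OF C(1)] C(2)]
        diag_def fun_eq_iff bop_add[OF T] bop_smult[OF T])
qed

lemma ell2_diag_inner:
  assumes S: "bounded_operator H H S" and T: "bounded_operator H H T"
    and adj: "\<And>x y. x \<in> carrier H \<Longrightarrow> y \<in> carrier H \<Longrightarrow> hinner H (S x) y = hinner H x (T y)"
    and f: "f \<in> carrier (ell2 H)" and g: "g \<in> carrier (ell2 H)"
  shows "hinner (ell2 H) (diag S f) g = hinner (ell2 H) f (diag T g)"
proof -
  have "((\<lambda>j. hinner H (diag S f j) (g j)) has_sum hinner (ell2 H) (diag S f) g) UNIV"
    using ell2_inner[OF bop_closed[OF ell2_diag_bounded[OF S] f] g] .
  moreover have "((\<lambda>j. hinner H (f j) (diag T g j)) has_sum hinner (ell2 H) f (diag T g)) UNIV"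
    using ell2_inner[OF f bop_closed[OF ell2_diag_bounded[OF T] g]] .
  ultimately show ?thesis using f g adj by (simp add: diag_def has_sum_unique)
qed

lemma ell2_finsum:
  assumes "finite F" "\<And>i. i \<in> F \<Longrightarrow> f i \<in> carrier (ell2 H)"
  shows "finsum (ell2 H) f F j = finsum H (\<lambda>i. f i j) F"
  using assms
proof (induction F rule: finite_induct)
  case (insert a F)
  then have "finsum (ell2 H) f (insert a F) = f a \<oplus>\<^bsub>ell2 H\<^esub> finsum (ell2 H) f F"
    by (intro L.finsum_insert) auto
  moreover have "finsum H (\<lambda>i. f i j) (insert a F) = f a j \<oplus> finsum H (\<lambda>i. f i j) F"
    using insert by (intro finsum_insert) auto
  ultimately show ?case using insert by simp
qed simp

end

section \<open>Laurent operators\<close>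

lemma infinite_unit_circle: "infinite {z. cmod z = 1}"
proof
  assume "finite {z. cmod z = 1}"
  then have "finite (Re ` {z. cmod z = 1})" by simp
  moreover have "{0..1} \<subseteq> Re ` {z. cmod z = 1}"
  proof
    fix x :: real assume x: "x \<in> {0..1}"
    then have "cmod (Complex x (sqrt (1 - x\<^sup>2))) = 1" by (simp add: cmod_def power_le_one)
    then show "x \<in> Re ` {z. cmod z = 1}" by (intro image_eqI[of _ _ "Complex x (sqrt (1 - x\<^sup>2))"]) auto
  qed
  ultimately have "finite {0..1::real}" by (rule finite_subset[rotated])
  then show False using infinite_Icc[of "0::real" 1] by simp
qed

text \<open>A nonzero polynomial has finitely many zeros, while the circle is infinite. Relations
  between symbols on the circle thus become relations between coefficients.\<close>

lemma coefficients_eq_0_on_circle: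
  fixes c :: "nat \<Rightarrow> complex"
  assumes "\<And>z. cmod z = 1 \<Longrightarrow> (\<Sum>i\<le>N. c i * z ^ i) = 0" "i \<le> N"
  shows "c i = 0"
proof (rule ccontr)
  assume "c i \<noteq> 0"
  then have "finite {z. (\<Sum>i\<le>N. c i * z ^ i) = 0}" using assms(2) polyfun_finite_roots by blast
  moreover have "{z. cmod z = 1} \<subseteq> {z. (\<Sum>i\<le>N. c i * z ^ i) = 0}" using assms(1) by auto
  ultimately show False using infinite_unit_circle finite_subset by blast
qed

definition symbol_at :: "'a hspace \<Rightarrow> nat \<Rightarrow> (nat \<Rightarrow> 'a \<Rightarrow> 'a) \<Rightarrow> complex \<Rightarrow> 'a \<Rightarrow> 'a" where
  "symbol_at H p A z x = finsum H (\<lambda>l. z ^ l \<odot>\<^bsub>H\<^esub> A l x) {..p}"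

text \<open>Multiplication by the operator polynomial with coefficients A_0, ..., A_p, seen on
  Fourier coefficients: entry j is the sum of the A_l (f (j - l)). Nothing is truncated at 0, so
  adjoints are again of this kind up to a shift.\<close>

definition laurent :: "'a hspace \<Rightarrow> nat \<Rightarrow> (nat \<Rightarrow> 'a \<Rightarrow> 'a) \<Rightarrow> (int \<Rightarrow> 'a) \<Rightarrow> int \<Rightarrow> 'a" where
  "laurent H p A f = finsum (ell2 H) (\<lambda>l. diag (A l) (shift (int l) f)) {..p}"

context hilbert
begin

lemma approx_eigen_cong:
  assumes "approx_eigen f S w" "\<And>k. f k \<in> carrier H" "\<And>x. x \<in> carrier H \<Longrightarrow> T x = S x"
  shows "approx_eigen f T w"
  using assms by (simp add: approx_eigen_def)

lemma approx_eigen_finsum: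
  assumes f: "\<And>k. f k \<in> carrier H" and "finite F"
    and "\<And>i. i \<in> F \<Longrightarrow> bounded_operator H H (T i)" "\<And>i. i \<in> F \<Longrightarrow> approx_eigen f (T i) (w i)"
  shows "approx_eigen f (\<lambda>x. finsum H (\<lambda>i. T i x) F) (\<Sum>i\<in>F. w i)"
  using assms(2-4)
proof (induction F rule: finite_induct)
  case empty
  have "\<zero> \<ominus> 0 \<odot> f k = \<zero>" for k by (rule eqI) (use f in auto)
  then show ?case by (simp add: approx_eigen_def)
next
  case (insert a F)
  have "approx_eigen f (\<lambda>x. T a x \<oplus> finsum H (\<lambda>i. T i x) F) (w a + (\<Sum>i\<in>F. w i))"
    using insert by (intro approx_eigen_add f self.bounded_operator_finsum) auto
  then have "approx_eigen f (\<lambda>x. finsum H (\<lambda>i. T i x) (insert a F)) (w a + (\<Sum>i\<in>F. w i))"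
  proof (rule approx_eigen_cong[OF _ f])
    fix x assume x: "x \<in> carrier H"
    have "T i x \<in> carrier H" if "i \<in> insert a F" for i using bop_closed[OF insert.prems(1)[OF that] x] .
    then show "finsum H (\<lambda>i. T i x) (insert a F) = T a x \<oplus> finsum H (\<lambda>i. T i x) F"
      using insert.hyps by (intro finsum_insert) auto
  qed
  then show ?case using insert.hyps by simp
qed

end

context hilbert
begin

interpretation L: hilbert "ell2 H"
  by (rule ell2_hilbert)

text \<open>The vector \<open>y (l + k)\<close> depends on l + k only, so both sides group into
  coefficients of z^s, s <= 2 p, of the two products of the symbols. These products agree on the
  circle, hence coefficient by coefficient.\<close>

lemma convolution_commute:
  assumes A: "\<And>l. l \<le> p \<Longrightarrow> bounded_operator H H (A l)"
    and B: "\<And>l. l \<le> p \<Longrightarrow> bounded_operator H H (B l)"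
    and comm: "\<And>z x. cmod z = 1 \<Longrightarrow> x \<in> carrier H \<Longrightarrow>
      symbol_at H p A z (symbol_at H p B z x) = symbol_at H p B z (symbol_at H p A z x)"
    and y: "\<And>s. y s \<in> carrier H" and v: "v \<in> carrier H"
  shows "(\<Sum>l\<le>p. \<Sum>k\<le>p. hinner H (A l (B k (y (l + k)))) v)
       = (\<Sum>l\<le>p. \<Sum>k\<le>p. hinner H (B l (A k (y (l + k)))) v)"
proof -
  define S where "S s = {(l, k) \<in> {..p} \<times> {..p}. l + k = s}" for s
  have group: "(\<Sum>l\<le>p. \<Sum>k\<le>p. g l k) = (\<Sum>s\<le>2*p. \<Sum>(l, k)\<in>S s. g l k)" for g :: "nat \<Rightarrow> nat \<Rightarrow> complex"
  proof -
    have "(\<Sum>l\<le>p. \<Sum>k\<le>p. g l k) = (\<Sum>(l, k)\<in>{..p} \<times> {..p}. g l k)" by (rule sum.cartesian_product)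
    also have "\<dots> = (\<Sum>s\<le>2*p. \<Sum>x\<in>{x \<in> {..p} \<times> {..p}. fst x + snd x = s}. case x of (l, k) \<Rightarrow> g l k)"
      by (rule sum.group[symmetric]) auto
    also have "\<dots> = (\<Sum>s\<le>2*p. \<Sum>(l, k)\<in>S s. g l k)"
      by (intro sum.cong) (auto simp: S_def)
    finally show ?thesis .
  qed
  have expand: "hinner H (symbol_at H p A z (symbol_at H p B z x)) v
      = (\<Sum>s\<le>2*p. (\<Sum>(l, k)\<in>S s. hinner H (A l (B k x)) v) * z ^ s)"
    if x: "x \<in> carrier H" and A: "\<And>l. l \<le> p \<Longrightarrow> bounded_operator H H (A l)"
      and B: "\<And>l. l \<le> p \<Longrightarrow> bounded_operator H H (B l)" for z x A B
  proof -
    have Bx: "B k x \<in> carrier H" if "k \<le> p" for k using bop_closed[OF B[OF that] x] .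
    have ABx: "A l (B k x) \<in> carrier H" if "k \<le> p" "l \<le> p" for k l using bop_closed[OF A Bx] that by blast
    have Bs: "symbol_at H p B z x \<in> carrier H" unfolding symbol_at_def using Bx by (intro finsum_closed) auto
    have "hinner H (symbol_at H p A z (symbol_at H p B z x)) v
        = (\<Sum>l\<le>p. z ^ l * hinner H (A l (symbol_at H p B z x)) v)"
      unfolding symbol_at_def[of H p A] using bop_closed[OF A Bs] v by (subst inner_finsum_left) auto
    also have "\<dots> = (\<Sum>l\<le>p. \<Sum>k\<le>p. z ^ (l + k) * hinner H (A l (B k x)) v)"
    proof (rule sum.cong)
      fix l assume "l \<in> {..p}"
      then have l: "l \<le> p" by simp
      have "A l (symbol_at H p B z x) = finsum H (\<lambda>k. A l (z ^ k \<odot> B k x)) {..p}"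
        unfolding symbol_at_def using Bx by (intro self.bop_finsum[OF A[OF l]]) auto
      then have "hinner H (A l (symbol_at H p B z x)) v = (\<Sum>k\<le>p. hinner H (A l (z ^ k \<odot> B k x)) v)"
        using bop_closed[OF A[OF l]] Bx v by (simp, intro inner_finsum_left) auto
      also have "\<dots> = (\<Sum>k\<le>p. z ^ k * hinner H (A l (B k x)) v)"
        using bop_smult[OF A[OF l] Bx] ABx l v by (intro sum.cong) auto
      finally show "z ^ l * hinner H (A l (symbol_at H p B z x)) v
        = (\<Sum>k\<le>p. z ^ (l + k) * hinner H (A l (B k x)) v)"
        by (simp add: sum_distrib_left power_add mult.assoc)
    qed simp
    also have "\<dots> = (\<Sum>s\<le>2*p. \<Sum>(l, k)\<in>S s. z ^ (l + k) * hinner H (A l (B k x)) v)"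
      by (rule group)
    also have "\<dots> = (\<Sum>s\<le>2*p. (\<Sum>(l, k)\<in>S s. hinner H (A l (B k x)) v) * z ^ s)"
      unfolding sum_distrib_right by (intro sum.cong) (auto simp: S_def mult.commute)
    finally show ?thesis .
  qed
  have coeff: "(\<Sum>(l, k)\<in>S s. hinner H (A l (B k x)) v) = (\<Sum>(l, k)\<in>S s. hinner H (B l (A k x)) v)"
    if x: "x \<in> carrier H" and s: "s \<le> 2 * p" for x s
  proof -
    let ?c = "\<lambda>s. (\<Sum>(l, k)\<in>S s. hinner H (A l (B k x)) v) - (\<Sum>(l, k)\<in>S s. hinner H (B l (A k x)) v)"
    have "(\<Sum>s\<le>2*p. ?c s * z ^ s) = 0" if "cmod z = 1" for z
      unfolding left_diff_distrib sum_subtractf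
      using expand[of x A B z, OF x A B]
        expand[of x B A z, OF x B A] comm[OF that x] by simp
    from coefficients_eq_0_on_circle[where N = "2 * p" and c = ?c, OF this s] show ?thesis by simp
  qed
  have "(\<Sum>l\<le>p. \<Sum>k\<le>p. hinner H (A l (B k (y (l + k)))) v)
      = (\<Sum>s\<le>2*p. \<Sum>(l, k)\<in>S s. hinner H (A l (B k (y (l + k)))) v)" by (rule group)
  also have "\<dots> = (\<Sum>s\<le>2*p. \<Sum>(l, k)\<in>S s. hinner H (A l (B k (y s))) v)"
    by (intro sum.cong) (auto simp: S_def)
  also have "\<dots> = (\<Sum>s\<le>2*p. \<Sum>(l, k)\<in>S s. hinner H (B l (A k (y s))) v)"
    by (rule sum.cong) (simp_all add: coeff[OF y])
  also have "\<dots> = (\<Sum>s\<le>2*p. \<Sum>(l, k)\<in>S s. hinner H (B l (A k (y (l + k)))) v)"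
    by (intro sum.cong) (auto simp: S_def)
  also have "\<dots> = (\<Sum>l\<le>p. \<Sum>k\<le>p. hinner H (B l (A k (y (l + k)))) v)" by (rule group[symmetric])
  finally show ?thesis .
qed

lemma laurent_bounded:
  assumes "\<And>l. l \<le> p \<Longrightarrow> bounded_operator H H (A l)"
  shows "bounded_operator (ell2 H) (ell2 H) (laurent H p A)"
proof -
  have "bounded_operator (ell2 H) (ell2 H) (\<lambda>f. finsum (ell2 H) (\<lambda>l. diag (A l) (shift (int l) f)) {..p})"
  proof (rule L.self.bounded_operator_finsum)
    fix l assume "l \<in> {..p}"
    then show "bounded_operator (ell2 H) (ell2 H) (\<lambda>f. diag (A l) (shift (int l) f))"
      using bounded_operator_comp[OF ell2_hilbert ell2_hilbert ell2_shift_bounded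
          ell2_diag_bounded[OF assms]] by simp
  qed simp
  then show ?thesis by (simp add: laurent_def[abs_def])
qed

lemma laurent_term_closed:
  assumes "bounded_operator H H (A l)" "f \<in> carrier (ell2 H)"
  shows "diag (A l) (shift s f) \<in> carrier (ell2 H)"
  using bop_closed[OF ell2_diag_bounded[OF assms(1)] ell2_shift[OF assms(2)]] .

lemma laurent_apply:
  assumes A: "\<And>l. l \<le> p \<Longrightarrow> bounded_operator H H (A l)" and f: "f \<in> carrier (ell2 H)"
  shows "laurent H p A f j = finsum H (\<lambda>l. A l (f (j - int l))) {..p}"
  unfolding laurent_def
  by (subst ell2_finsum) (auto simp: laurent_term_closed A f diag_def shift_def)

text \<open>Entry j of either product, tested against a vector v, is a double sum of the form
  treated in \<open>convolution_commute\<close>, with y s = f (j - s).\<close>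

lemma laurent_commute:
  assumes A: "\<And>l. l \<le> p \<Longrightarrow> bounded_operator H H (A l)"
    and B: "\<And>l. l \<le> p \<Longrightarrow> bounded_operator H H (B l)"
    and comm: "\<And>z x. cmod z = 1 \<Longrightarrow> x \<in> carrier H \<Longrightarrow>
      symbol_at H p A z (symbol_at H p B z x) = symbol_at H p B z (symbol_at H p A z x)"
    and f: "f \<in> carrier (ell2 H)"
  shows "laurent H p A (laurent H p B f) = laurent H p B (laurent H p A f)"
proof
  fix j
  have exp: "hinner H (laurent H p A (laurent H p B f) j) v
      = (\<Sum>l\<le>p. \<Sum>k\<le>p. hinner H (A l (B k (f (j - int (l + k))))) v)"
    if A: "\<And>l. l \<le> p \<Longrightarrow> bounded_operator H H (A l)" and B: "\<And>l. l \<le> p \<Longrightarrow> bounded_operator H H (B l)"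
      and v: "v \<in> carrier H" for A B v
  proof -
    have Bf: "laurent H p B f \<in> carrier (ell2 H)" using bop_closed[OF laurent_bounded[OF B] f] .
    have "hinner H (laurent H p A (laurent H p B f) j) v
        = (\<Sum>l\<le>p. hinner H (A l (laurent H p B f (j - int l))) v)"
    proof -
      have e: "laurent H p A (laurent H p B f) j = finsum H (\<lambda>l. A l (laurent H p B f (j - int l))) {..p}"
        by (rule laurent_apply) (use A Bf in auto)
      show ?thesis
        unfolding e using bop_closed[OF A ell2_closed[OF Bf]] v by (intro inner_finsum_left) auto
    qed
    also have "\<dots> = (\<Sum>l\<le>p. \<Sum>k\<le>p. hinner H (A l (B k (f (j - int (l + k))))) v)"
    proof (rule sum.cong)
      fix l assume "l \<in> {..p}"
      then have l: "l \<le> p" by simp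
      have Bc: "B k (f i) \<in> carrier H" if "k \<le> p" for k i using bop_closed[OF B[OF that] ell2_closed[OF f]] .
      have "A l (laurent H p B f (j - int l)) = finsum H (\<lambda>k. A l (B k (f (j - int l - int k)))) {..p}"
      proof -
        have e: "laurent H p B f (j - int l) = finsum H (\<lambda>k. B k (f (j - int l - int k))) {..p}"
          by (rule laurent_apply) (use B f in auto)
        show ?thesis unfolding e using Bc by (intro self.bop_finsum[OF A[OF l]]) auto
      qed
      then show "hinner H (A l (laurent H p B f (j - int l))) v
          = (\<Sum>k\<le>p. hinner H (A l (B k (f (j - int (l + k))))) v)"
      proof -
        have "hinner H (finsum H (\<lambda>k. A l (B k (f (j - int l - int k)))) {..p}) v
            = (\<Sum>k\<le>p. hinner H (A l (B k (f (j - int l - int k)))) v)"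
          by (rule inner_finsum_left) (use bop_closed[OF A[OF l] Bc] v in auto)
        then show ?thesis using \<open>A l (laurent H p B f (j - int l)) = _\<close> by (simp add: diff_diff_eq)
      qed
    qed simp
    finally show ?thesis .
  qed
  show "laurent H p A (laurent H p B f) j = laurent H p B (laurent H p A f) j"
  proof (rule eqI)
    show "laurent H p A (laurent H p B f) j \<in> carrier H" "laurent H p B (laurent H p A f) j \<in> carrier H"
      by (intro ell2_closed bop_closed[OF laurent_bounded] A B f; assumption)+
    fix v assume v: "v \<in> carrier H"
    show "hinner H (laurent H p A (laurent H p B f) j) v = hinner H (laurent H p B (laurent H p A f) j) v"
      using exp[of A B v, OF A B v] exp[of B A v, OF B A v]
        convolution_commute[OF A B comm ell2_closed[OF f] v, of "\<lambda>s. j - int s"] by simp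
  qed
qed

lemma shift_laurent:
  assumes A: "\<And>l. l \<le> p \<Longrightarrow> bounded_operator H H (A l)" and f: "f \<in> carrier (ell2 H)"
  shows "shift s (laurent H p A f) = laurent H p A (shift s f)"
proof -
  have "shift s (laurent H p A f) = finsum (ell2 H) (\<lambda>l. shift s (diag (A l) (shift (int l) f))) {..p}"
    unfolding laurent_def
    by (rule L.self.bop_finsum[OF ell2_shift_bounded]) (auto simp: laurent_term_closed A f)
  also have "\<dots> = laurent H p A (shift s f)"
    by (simp add: laurent_def shift_diag shift_shift add.commute)
  finally show ?thesis .
qed

text \<open>With U the bilateral shift, the adjoint is the sum of U^(-l) with coefficients B_(p-l);
  the substitution l -> p - l pulls out U^(-p).\<close>

lemma laurent_inner:
  assumes A: "\<And>l. l \<le> p \<Longrightarrow> bounded_operator H H (A l)"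
    and B: "\<And>l. l \<le> p \<Longrightarrow> bounded_operator H H (B l)"
    and adj: "\<And>l x y. l \<le> p \<Longrightarrow> x \<in> carrier H \<Longrightarrow> y \<in> carrier H \<Longrightarrow>
      hinner H (A l x) y = hinner H x (B (p - l) y)"
    and f: "f \<in> carrier (ell2 H)" and g: "g \<in> carrier (ell2 H)"
  shows "hinner (ell2 H) (laurent H p A f) g = hinner (ell2 H) f (shift (- int p) (laurent H p B g))"
proof -
  have "hinner (ell2 H) (laurent H p A f) g = (\<Sum>l\<le>p. hinner (ell2 H) (diag (A l) (shift (int l) f)) g)"
    unfolding laurent_def by (rule L.inner_finsum_left) (auto simp: laurent_term_closed A f g)
  also have "\<dots> = (\<Sum>l\<le>p. hinner (ell2 H) f (diag (B (p - l)) (shift (- int l) g)))"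
  proof (rule sum.cong)
    fix l assume "l \<in> {..p}"
    then have l: "l \<le> p" by simp
    have "hinner (ell2 H) (diag (A l) (shift (int l) f)) g = hinner (ell2 H) (shift (int l) f) (diag (B (p - l)) g)"
      by (rule ell2_diag_inner) (use l A B adj f g ell2_shift in auto)
    also have "\<dots> = hinner (ell2 H) f (shift (- int l) (diag (B (p - l)) g))"
      by (rule ell2_shift_inner) (use f g bop_closed[OF ell2_diag_bounded[OF B]] in auto)
    finally show "hinner (ell2 H) (diag (A l) (shift (int l) f)) g
      = hinner (ell2 H) f (diag (B (p - l)) (shift (- int l) g))" by (simp add: shift_diag)
  qed simp
  also have "\<dots> = (\<Sum>l\<le>p. hinner (ell2 H) f (diag (B l) (shift (int l - int p) g)))"
    by (rule sum.reindex_bij_witness[of _ "\<lambda>l. p - l" "\<lambda>l. p - l"]) (auto simp: of_nat_diff)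
  also have "\<dots> = hinner (ell2 H) f (finsum (ell2 H) (\<lambda>l. diag (B l) (shift (int l - int p) g)) {..p})"
    by (rule L.inner_finsum_right[symmetric]) (auto simp: laurent_term_closed B f g)
  also have "finsum (ell2 H) (\<lambda>l. diag (B l) (shift (int l - int p) g)) {..p}
      = shift (- int p) (laurent H p B g)"
  proof -
    have "shift (- int p) (laurent H p B g) = laurent H p B (shift (- int p) g)"
      by (rule shift_laurent) (use B g in auto)
    then show ?thesis by (simp add: laurent_def shift_shift)
  qed
  finally show ?thesis .
qed

lemma symbol_bounded:
  assumes "\<And>l. l \<le> p \<Longrightarrow> bounded_operator H H (A l)"
  shows "bounded_operator H H (symbol_at H p A z)"
proof -
  have "bounded_operator H H (\<lambda>x. finsum H (\<lambda>l. z ^ l \<odot> A l x) {..p})"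
    by (intro self.bounded_operator_finsum self.bounded_operator_smult) (auto simp: assms)
  then show ?thesis by (simp add: symbol_at_def[abs_def])
qed

text \<open>Along \<open>f\<close> the shift acts almost as z, so its l-th power may be replaced by
  z^l in each term of the Laurent operator. What remains applies the symbol at z in every
  coordinate.\<close>

lemma laurent_approx_eigen_symbol:
  assumes A: "\<And>l. l \<le> p \<Longrightarrow> bounded_operator H H (A l)"
    and f: "\<And>k. f k \<in> carrier (ell2 H)"
    and U: "L.approx_eigen f (shift 1) z"
    and w: "L.approx_eigen f (laurent H p A) w"
  shows "L.approx_eigen f (diag (symbol_at H p A z)) w"
proof -
  \<comment> \<open>The error A_l (U^l - z^l) of one term, U the bilateral shift; it has approximate
    eigenvalue 0.\<close>
  define G where "G l x = diag (A l) (shift (int l) x \<ominus>\<^bsub>ell2 H\<^esub> z ^ l \<odot>\<^bsub>ell2 H\<^esub> x)" for l x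
  have Gb: "bounded_operator (ell2 H) (ell2 H) (G l)" if "l \<le> p" for l
    unfolding G_def
    by (rule bounded_operator_comp[OF ell2_hilbert ell2_hilbert _ ell2_diag_bounded[OF A[OF that]]])
      (intro L.self.bounded_operator_diff ell2_shift_bounded L.self.bounded_operator_smult bounded_operator_id)
  have Ge: "L.approx_eigen f (G l) 0" if l: "l \<le> p" for l
  proof -
    obtain C where C: "C > 0" "\<And>x. x \<in> carrier (ell2 H) \<Longrightarrow> hnorm (ell2 H) (diag (A l) x) \<le> C * hnorm (ell2 H) x"
      using bop_bound[OF ell2_hilbert ell2_diag_bounded[OF A[OF l]]] by blast
    have Ul: "L.approx_eigen f (shift (int l)) (z ^ l)"
      using L.approx_eigen_funpow[OF f ell2_shift_bounded U, of l]
      by (rule L.approx_eigen_cong) (auto simp: f shift_funpow)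
    show ?thesis
    proof (rule L.approx_eigenI[OF f Gb[OF l]])
      show "(\<lambda>k. C * hnorm (ell2 H) (shift (int l) (f k) \<ominus>\<^bsub>ell2 H\<^esub> z ^ l \<odot>\<^bsub>ell2 H\<^esub> f k)) \<longlonglongrightarrow> 0"
        using Ul unfolding L.approx_eigen_def by (rule tendsto_mult_right_zero)
      have d: "shift (int l) (f k) \<ominus>\<^bsub>ell2 H\<^esub> z ^ l \<odot>\<^bsub>ell2 H\<^esub> f k \<in> carrier (ell2 H)" for k
        by (intro L.minus_closed ell2_shift L.smult_closed f)
      have "G l (f k) \<ominus>\<^bsub>ell2 H\<^esub> 0 \<odot>\<^bsub>ell2 H\<^esub> f k = G l (f k)" for k
        by (rule L.eqI) (use bop_closed[OF Gb[OF l] f] f in \<open>auto simp del: ell2_simps\<close>)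
      then show "hnorm (ell2 H) (G l (f k) \<ominus>\<^bsub>ell2 H\<^esub> 0 \<odot>\<^bsub>ell2 H\<^esub> f k)
          \<le> C * hnorm (ell2 H) (shift (int l) (f k) \<ominus>\<^bsub>ell2 H\<^esub> z ^ l \<odot>\<^bsub>ell2 H\<^esub> f k)" for k
        using C(2)[OF d] by (simp only: G_def)
    qed
  qed
  have Gs: "bounded_operator (ell2 H) (ell2 H) (\<lambda>x. finsum (ell2 H) (\<lambda>l. G l x) {..p})"
    by (intro L.self.bounded_operator_finsum) (auto simp: Gb)
  have "L.approx_eigen f (\<lambda>x. finsum (ell2 H) (\<lambda>l. G l x) {..p}) (\<Sum>l\<le>p. 0)"
    by (intro L.approx_eigen_finsum) (auto simp: f Gb Ge)
  then have "L.approx_eigen f (\<lambda>x. laurent H p A x \<oplus>\<^bsub>ell2 H\<^esub> (-1) \<odot>\<^bsub>ell2 H\<^esub> finsum (ell2 H) (\<lambda>l. G l x) {..p})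
      (w + (-1) * (\<Sum>l\<le>p. 0))"
    by (intro L.approx_eigen_add L.approx_eigen_smult w f laurent_bounded A L.self.bounded_operator_smult Gs)
  then have "L.approx_eigen f (\<lambda>x. laurent H p A x \<oplus>\<^bsub>ell2 H\<^esub> (-1) \<odot>\<^bsub>ell2 H\<^esub> finsum (ell2 H) (\<lambda>l. G l x) {..p}) w"
    by simp
  then show ?thesis
  proof (rule L.approx_eigen_cong[OF _ f])
    fix x assume x: "x \<in> carrier (ell2 H)"
    show "diag (symbol_at H p A z) x
        = laurent H p A x \<oplus>\<^bsub>ell2 H\<^esub> (-1) \<odot>\<^bsub>ell2 H\<^esub> finsum (ell2 H) (\<lambda>l. G l x) {..p}"
    proof
      fix j
      have Ax: "A l (x i) \<in> carrier H" if "l \<le> p" for l i using bop_closed[OF A[OF that] ell2_closed[OF x]] .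
      have Gj: "G l x j = A l (x (j - int l)) \<ominus> z ^ l \<odot> A l (x j)" if l: "l \<le> p" for l
      proof -
        have "G l x j = A l (x (j - int l) \<ominus> z ^ l \<odot> x j)"
          using ell2_diff[OF ell2_shift[OF x, of "int l"] ell2_smult[OF x, of "z ^ l"]]
          by (simp add: G_def diag_def shift_def)
        then show ?thesis
          using self.bop_diff[OF A[OF l]] bop_smult[OF A[OF l]] x by simp
      qed
      have fs: "finsum (ell2 H) (\<lambda>l. G l x) {..p} j = finsum H (\<lambda>l. G l x j) {..p}"
        by (rule ell2_finsum) (use bop_closed[OF Gb x] in auto)
      have Gjc: "G l x j \<in> carrier H" if "l \<le> p" for l using that Gj Ax by simp
      have "symbol_at H p A z (x j) = finsum H (\<lambda>l. A l (x (j - int l))) {..p} \<oplus> (-1) \<odot> finsum H (\<lambda>l. G l x j) {..p}"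
      proof (rule eqI)
        show "symbol_at H p A z (x j) \<in> carrier H"
          using bop_closed[OF symbol_bounded[OF A] ell2_closed[OF x]] .
        have c: "finsum H (\<lambda>l. A l (x (j - int l))) {..p} \<in> carrier H" "finsum H (\<lambda>l. G l x j) {..p} \<in> carrier H"
          using Ax Gjc by (auto intro!: finsum_closed)
        then show "finsum H (\<lambda>l. A l (x (j - int l))) {..p} \<oplus> (-1) \<odot> finsum H (\<lambda>l. G l x j) {..p} \<in> carrier H"
          by simp
        fix v assume v: "v \<in> carrier H"
        have "hinner H (finsum H (\<lambda>l. A l (x (j - int l))) {..p} \<oplus> (-1) \<odot> finsum H (\<lambda>l. G l x j) {..p}) v
            = (\<Sum>l\<le>p. hinner H (A l (x (j - int l))) v) - (\<Sum>l\<le>p. hinner H (G l x j) v)"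
        proof -
          have "hinner H (finsum H (\<lambda>l. A l (x (j - int l))) {..p}) v = (\<Sum>l\<le>p. hinner H (A l (x (j - int l))) v)"
            "hinner H (finsum H (\<lambda>l. G l x j) {..p}) v = (\<Sum>l\<le>p. hinner H (G l x j) v)"
            by (rule inner_finsum_left; use Ax Gjc v in auto)+
          then show ?thesis using c v by simp
        qed
        also have "\<dots> = (\<Sum>l\<le>p. hinner H (z ^ l \<odot> A l (x j)) v)"
          unfolding sum_subtractf[symmetric] using Ax v Gj by (intro sum.cong) auto
        also have "\<dots> = hinner H (symbol_at H p A z (x j)) v"
          unfolding symbol_at_def using Ax v by (intro inner_finsum_left[symmetric]) auto
        finally show "hinner H (symbol_at H p A z (x j)) v
          = hinner H (finsum H (\<lambda>l. A l (x (j - int l))) {..p} \<oplus> (-1) \<odot> finsum H (\<lambda>l. G l x j) {..p}) v" ..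
      qed
      then show "diag (symbol_at H p A z) x j
        = (laurent H p A x \<oplus>\<^bsub>ell2 H\<^esub> (-1) \<odot>\<^bsub>ell2 H\<^esub> finsum (ell2 H) (\<lambda>l. G l x) {..p}) j"
        using laurent_apply[where A = A and p = p and f = x and j = j, OF A x] by (simp add: fs diag_def)
    qed
  qed
qed

text \<open>\<open>bound\<close> is what Gamma-contractivity of the weighted symbols contributes: a
  lower bound for the operator polynomial at every t outside the closed disc. Its constant may
  depend on z and t, since for a given point w of the joint spectrum it is applied at z = w n and
  one t at a time.\<close>

lemma laurent_Theta_unitary:
  fixes A :: "nat \<Rightarrow> nat \<Rightarrow> 'a \<Rightarrow> 'a"
  assumes n: "n \<ge> 2" "m \<ge> 1" "p \<ge> 1" "p dvd m"
    and A: "\<And>i l. i \<in> {1..n-1} \<Longrightarrow> l \<le> p \<Longrightarrow> bounded_operator H H (A i l)"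
    and adj: "\<And>i l x y. i \<in> {1..n-1} \<Longrightarrow> l \<le> p \<Longrightarrow> x \<in> carrier H \<Longrightarrow> y \<in> carrier H \<Longrightarrow>
      hinner H (A i l x) y = hinner H x (A (n - i) (p - l) y)"
    and comm: "\<And>i j z x. i \<in> {1..n-1} \<Longrightarrow> j \<in> {1..n-1} \<Longrightarrow> cmod z = 1 \<Longrightarrow> x \<in> carrier H \<Longrightarrow>
      symbol_at H p (A i) z (symbol_at H p (A j) z x) = symbol_at H p (A j) z (symbol_at H p (A i) z x)"
    and bound: "\<And>z t. cmod z = 1 \<Longrightarrow> cmod t > 1 \<Longrightarrow> \<exists>c>0. \<forall>x\<in>carrier H. c * hnorm H x \<le>
      hnorm H (t ^ (n - 1) \<odot> x \<oplus> finsum H (\<lambda>i. ((-1) ^ i * (of_nat (n - i) / of_nat n) * t ^ (n - 1 - i))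
        \<odot> symbol_at H p (A i) z x) {1..n-1})"
  shows "Theta_unitary n m p (ell2 H) (\<lambda>i. if i = n then shift 1 else laurent H p (A i))"
proof -
  let ?L = "ell2 H"
  define N where "N i = (if i = n then shift 1 else laurent H p (A i))" for i
  define Ns where "Ns i = (if i = n then shift (-1) else (\<lambda>f. shift (- int p) (laurent H p (A (n - i)) f)))" for i
  have cases: "i = n \<or> i \<in> {1..n-1} \<and> i \<noteq> n" if "i \<in> {1..n}" for i using that by auto
  have rev: "n - i \<in> {1..n-1}" if "i \<in> {1..n-1}" for i using that by auto
  have la: "bounded_operator ?L ?L (laurent H p (A i))" if "i \<in> {1..n-1}" for i
    using laurent_bounded A that by blast
  have N: "bounded_operator ?L ?L (N i)" if "i \<in> {1..n}" for i
    using cases[OF that] la ell2_shift_bounded by (auto simp: N_def)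
  have Ns: "bounded_operator ?L ?L (Ns i)" if "i \<in> {1..n}" for i
    using cases[OF that]
  proof
    assume "i \<in> {1..n-1} \<and> i \<noteq> n"
    then show ?thesis
      using bounded_operator_comp[OF ell2_hilbert ell2_hilbert la[OF rev] ell2_shift_bounded]
      by (simp add: Ns_def)
  qed (use ell2_shift_bounded in \<open>simp add: Ns_def\<close>)
  have adjN: "hinner ?L (N i f) g = hinner ?L f (Ns i g)"
    if "i \<in> {1..n}" and f: "f \<in> carrier ?L" and g: "g \<in> carrier ?L" for i f g
    using cases[OF that(1)]
  proof
    assume i: "i \<in> {1..n-1} \<and> i \<noteq> n"
    have "hinner ?L (laurent H p (A i) f) g = hinner ?L f (shift (- int p) (laurent H p (A (n - i)) g))"
      by (rule laurent_inner) (use i rev A adj f g in auto)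
    then show ?thesis using i by (simp add: N_def Ns_def)
  qed (use ell2_shift_inner[OF f g, of 1] in \<open>simp add: N_def Ns_def\<close>)
  have lc: "laurent H p (A i) (laurent H p (A j) f) = laurent H p (A j) (laurent H p (A i) f)"
    if "i \<in> {1..n-1}" "j \<in> {1..n-1}" "f \<in> carrier ?L" for i j f
    using laurent_commute[of p "A i" "A j" f] A comm that by blast
  have sl: "shift s (laurent H p (A i) f) = laurent H p (A i) (shift s f)"
    if "i \<in> {1..n-1}" "f \<in> carrier ?L" for i f s
    using shift_laurent[of p "A i" f s] A that by blast
  have NN: "N i (N j f) = N j (N i f)" if "i \<in> {1..n}" "j \<in> {1..n}" and f: "f \<in> carrier ?L" for i j f
    using cases[OF that(1)] cases[OF that(2)] lc sl f by (auto simp: N_def)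
  have NsN: "Ns i (N j f) = N j (Ns i f)" if i: "i \<in> {1..n}" and j: "j \<in> {1..n}" and f: "f \<in> carrier ?L" for i j f
  proof (cases "i = n")
    case True
    then show ?thesis using cases[OF j] sl f by (auto simp: N_def Ns_def shift_shift)
  next
    case False
    then have ir: "n - i \<in> {1..n-1}" using i by auto
    have "laurent H p (A (n - i)) (N j f) = N j (laurent H p (A (n - i)) f)"
      using cases[OF j] lc[OF ir _ f] sl[OF ir f] by (auto simp: N_def)
    moreover have "shift (- int p) (N j g) = N j (shift (- int p) g)" if "g \<in> carrier ?L" for g
      using cases[OF j] sl[OF _ that] by (auto simp: N_def shift_shift)
    ultimately show ?thesis using False bop_closed[OF la[OF ir] f] by (simp add: Ns_def)
  qed
  have "taylor_spectrum ?L n N \<subseteq> Theta_boundary n m p"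
  proof
    fix w assume w: "w \<in> taylor_spectrum ?L n N"
    obtain f where f: "\<And>k. f k \<in> carrier ?L" "\<And>k. hnorm ?L (f k) = 1"
      and e: "\<And>i. i \<in> {1..n} \<Longrightarrow> L.approx_eigen f (N i) (w i)"
      using L.taylor_spectrum_approx_eigen[OF N Ns adjN NN NsN w] by blast
    have U: "L.approx_eigen f (shift 1) (w n)" using e[of n] n by (simp add: N_def)
    have ei: "L.approx_eigen f (laurent H p (A i)) (w i)" if "i \<in> {1..n-1}" for i
    proof -
      have "i \<in> {1..n}" "i \<noteq> n" using that by auto
      then show ?thesis using e[of i] by (simp add: N_def)
    qed
    \<comment> \<open>\<open>shift 1\<close> preserves norms, and on the unit vectors
      \<open>f k\<close> it is nearly multiplication by \<open>w n\<close>.\<close>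
    have wn: "cmod (w n) = 1"
    proof -
      have "(\<lambda>k. 1 - cmod (w n)) \<longlonglongrightarrow> 0"
      proof (rule Lim_null_comparison)
        show "(\<lambda>k. hnorm ?L (shift 1 (f k) \<ominus>\<^bsub>?L\<^esub> w n \<odot>\<^bsub>?L\<^esub> f k)) \<longlonglongrightarrow> 0"
          using U by (simp only: L.approx_eigen_def)
        have "norm (1 - cmod (w n)) \<le> hnorm ?L (shift 1 (f k) \<ominus>\<^bsub>?L\<^esub> w n \<odot>\<^bsub>?L\<^esub> f k)" for k
          using L.norm_diff_ge[OF ell2_shift[OF f(1), of 1] L.smult_closed[OF f(1), of "w n"], of k k]
            L.norm_smult[OF f(1), of "w n" k] ell2_shift_norm[OF f(1), of 1 k] f(2)[of k]
          by (simp del: ell2_simps)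
        then show "\<forall>\<^sub>F k in sequentially. norm (1 - cmod (w n))
            \<le> hnorm ?L (shift 1 (f k) \<ominus>\<^bsub>?L\<^esub> w n \<odot>\<^bsub>?L\<^esub> f k)" by simp
      qed
      then have "1 - cmod (w n) = 0" using LIMSEQ_const_iff by blast
      then show ?thesis by simp
    qed
    have cw: "cnj (w n) * w n = 1" using wn complex_norm_square[of "w n"] by (simp add: mult.commute)
    \<comment> \<open>U^(-1) - cnj w = - cnj w U^(-1) (U - w) for |w| = 1, and U^(-1) is
      isometric.\<close>
    have U': "L.approx_eigen f (shift (-1)) (cnj (w n))"
    proof (rule L.approx_eigenI[OF f(1) ell2_shift_bounded])
      show "(\<lambda>k. hnorm ?L (shift 1 (f k) \<ominus>\<^bsub>?L\<^esub> w n \<odot>\<^bsub>?L\<^esub> f k)) \<longlonglongrightarrow> 0"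
        using U by (simp only: L.approx_eigen_def)
      fix k
      let ?d = "shift 1 (f k) \<ominus>\<^bsub>?L\<^esub> w n \<odot>\<^bsub>?L\<^esub> f k"
      note [simp] = ell2_shift f(1)
      have d: "?d \<in> carrier ?L" by (simp del: ell2_simps)
      have "shift (-1) (f k) \<ominus>\<^bsub>?L\<^esub> cnj (w n) \<odot>\<^bsub>?L\<^esub> f k = (- cnj (w n)) \<odot>\<^bsub>?L\<^esub> shift (-1) ?d"
      proof (rule L.eqI)
        fix v assume v: "v \<in> carrier ?L"
        have "shift (-1) ?d = f k \<ominus>\<^bsub>?L\<^esub> w n \<odot>\<^bsub>?L\<^esub> shift (-1) (f k)"
          using L.self.bop_diff[OF ell2_shift_bounded[of "-1"], of "shift 1 (f k)" "w n \<odot>\<^bsub>?L\<^esub> f k"]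
            bop_smult[OF ell2_shift_bounded[of "-1"], of "f k" "w n"]
          by (simp add: shift_shift del: ell2_simps)
        then show "hinner ?L (shift (-1) (f k) \<ominus>\<^bsub>?L\<^esub> cnj (w n) \<odot>\<^bsub>?L\<^esub> f k) v
          = hinner ?L ((- cnj (w n)) \<odot>\<^bsub>?L\<^esub> shift (-1) ?d) v"
          using v cw by (simp add: right_diff_distrib flip: mult.assoc del: ell2_simps)
      qed (use d in \<open>simp_all del: ell2_simps\<close>)
      then show "hnorm ?L (shift (-1) (f k) \<ominus>\<^bsub>?L\<^esub> cnj (w n) \<odot>\<^bsub>?L\<^esub> f k) \<le> hnorm ?L ?d"
        using d wn L.norm_smult[OF ell2_shift[OF d]] ell2_shift_norm[OF d] by (simp del: ell2_simps)
    qed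
    show "w \<in> Theta_boundary n m p"
    proof (rule Theta_boundaryI[of n m p w, OF n _ wn])
      show "w \<in> cspace n" using w by (simp add: taylor_spectrum_def)
      fix i assume i: "i \<in> {1..n-1}"
      \<comment> \<open>The eigenvalue of the adjoint of \<open>N i\<close> is computed from the
        formula for \<open>Ns i\<close>; scalar products then identify it with the conjugate of
        \<open>w i\<close>.\<close>
      have "L.approx_eigen f (shift (- int p)) (cnj (w n) ^ p)"
        using L.approx_eigen_funpow[OF f(1) ell2_shift_bounded U', of p]
        by (rule L.approx_eigen_cong) (auto simp: f shift_funpow)
      then have "L.approx_eigen f (\<lambda>g. shift (- int p) (laurent H p (A (n - i)) g)) (cnj (w n) ^ p * w (n - i))"
        by (rule L.approx_eigen_comp[OF f(1) ell2_shift_bounded la[OF rev[OF i]] _ ei[OF rev[OF i]]])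
      moreover have "Ns i = (\<lambda>g. shift (- int p) (laurent H p (A (n - i)) g))" using i by (auto simp: Ns_def)
      ultimately have "L.approx_eigen f (Ns i) (cnj (w n) ^ p * w (n - i))" by simp
      moreover have ii: "i \<in> {1..n}" using i by auto
      ultimately have 1: "(\<lambda>k. hinner ?L (Ns i (f k)) (f k)) \<longlonglongrightarrow> cnj (w n) ^ p * w (n - i)"
        by (intro L.approx_eigen_inner f Ns)
      have "hinner ?L (N i (f k)) (f k) = cnj (hinner ?L (Ns i (f k)) (f k))" for k
        using adjN[OF ii f(1) f(1), of k k] L.inner_commute[OF bop_closed[OF Ns[OF ii] f(1)] f(1), of k k] by simp
      then have "(\<lambda>k. hinner ?L (N i (f k)) (f k)) \<longlonglongrightarrow> cnj (cnj (w n) ^ p * w (n - i))"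
        using tendsto_cnj[OF 1] by simp
      moreover have "(\<lambda>k. hinner ?L (N i (f k)) (f k)) \<longlonglongrightarrow> w i"
        by (rule L.approx_eigen_inner[OF f N[OF ii] e[OF ii]])
      ultimately show "w i = w n ^ p * cnj (w (n - i))" by (auto dest: LIMSEQ_unique)
    next
      fix t :: complex assume t: "cmod t > 1"
      let ?c = "\<lambda>i. (-1) ^ i * (of_nat (n - i) / of_nat n) * t ^ (n - 1 - i) :: complex"
      let ?S = "\<lambda>i. symbol_at H p (A i) (w n)"
      let ?q = "t ^ (n - 1) + (\<Sum>i\<in>{1..n-1}. ?c i * w i)"
      \<comment> \<open>The operator polynomial of \<open>bound\<close> at z = w n, applied in every
        coordinate. Its approximate eigenvalue \<open>?q\<close> is the number that must not
        vanish.\<close>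
      define Q where "Q x = t ^ (n - 1) \<odot>\<^bsub>?L\<^esub> x \<oplus>\<^bsub>?L\<^esub>
        finsum ?L (\<lambda>i. ?c i \<odot>\<^bsub>?L\<^esub> diag (?S i) x) {1..n-1}" for x
      have Sb: "bounded_operator H H (?S i)" if "i \<in> {1..n-1}" for i
        using symbol_bounded A that by blast
      have Db: "bounded_operator ?L ?L (diag (?S i))" if "i \<in> {1..n-1}" for i
        by (rule ell2_diag_bounded[OF Sb[OF that]])
      have De: "L.approx_eigen f (diag (?S i)) (w i)" if "i \<in> {1..n-1}" for i
        by (rule laurent_approx_eigen_symbol[OF _ f(1) U ei[OF that]]) (use A that in blast)
      have Qb: "bounded_operator ?L ?L Q"
        unfolding Q_def
        by (intro L.self.bounded_operator_add L.self.bounded_operator_smult bounded_operator_id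
            L.self.bounded_operator_finsum Db) auto
      have "L.approx_eigen f Q (t ^ (n - 1) * 1 + (\<Sum>i\<in>{1..n-1}. ?c i * w i))"
        unfolding Q_def
        by (intro L.approx_eigen_add L.approx_eigen_smult L.approx_eigen_id L.approx_eigen_finsum De Db f(1)
            L.self.bounded_operator_smult bounded_operator_id L.self.bounded_operator_finsum) auto
      then have Qe: "(\<lambda>k. hinner ?L (Q (f k)) (f k)) \<longlonglongrightarrow> ?q"
        and Qn: "(\<lambda>k. hnorm ?L (Q (f k) \<ominus>\<^bsub>?L\<^esub> ?q \<odot>\<^bsub>?L\<^esub> f k)) \<longlonglongrightarrow> 0"
        using L.approx_eigen_inner[OF f Qb] unfolding L.approx_eigen_def by simp_all
      obtain c where c: "c > 0" "\<And>x. x \<in> carrier H \<Longrightarrow> c * hnorm H x \<le>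
        hnorm H (t ^ (n - 1) \<odot> x \<oplus> finsum H (\<lambda>i. ?c i \<odot> ?S i x) {1..n-1})"
        using bound[OF wn t] by blast
      \<comment> \<open>Q acts coordinatewise, so the bound on H carries over with the same
        constant.\<close>
      have Qlow: "c * hnorm ?L x \<le> hnorm ?L (Q x)" if x: "x \<in> carrier ?L" for x
      proof (rule power2_le_imp_le)
        have Qx: "Q x \<in> carrier ?L" using bop_closed[OF Qb x] .
        have "(c * hnorm H (x j))\<^sup>2 \<le> (hnorm H (Q x j))\<^sup>2" for j
        proof (rule power_mono)
          have "finsum ?L (\<lambda>i. ?c i \<odot>\<^bsub>?L\<^esub> diag (?S i) x) {1..n-1} j
              = finsum H (\<lambda>i. (?c i \<odot>\<^bsub>?L\<^esub> diag (?S i) x) j) {1..n-1}"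
            by (rule ell2_finsum) (use bop_closed[OF Db x] in \<open>auto simp del: ell2_simps\<close>)
          then have "Q x j = t ^ (n - 1) \<odot> x j \<oplus> finsum H (\<lambda>i. ?c i \<odot> ?S i (x j)) {1..n-1}"
            by (simp add: Q_def diag_def)
          then show "c * hnorm H (x j) \<le> hnorm H (Q x j)" using c(2)[OF ell2_closed[OF x]] by simp
          show "0 \<le> c * hnorm H (x j)" using c(1) x by simp
        qed
        then show "(c * hnorm ?L x)\<^sup>2 \<le> (hnorm ?L (Q x))\<^sup>2"
          unfolding power_mult_distrib
          by (intro has_sum_mono[OF has_sum_cmult_right[OF ell2_norm[OF x]] ell2_norm[OF Qx]]) auto
      qed (use bop_closed[OF Qb x] in auto)
      \<comment> \<open>On the unit vector \<open>f k\<close> the value of Q has norm at least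
        \<open>c\<close> and is nearly \<open>?q\<close> times \<open>f k\<close>; in the limit
        \<open>c\<close> is at most the modulus of \<open>?q\<close>.\<close>
      have "c \<le> hnorm ?L (Q (f k) \<ominus>\<^bsub>?L\<^esub> ?q \<odot>\<^bsub>?L\<^esub> f k) + cmod ?q" for k
      proof -
        note Qf = bop_closed[OF Qb f(1)]
        have "hnorm ?L (Q (f k)) - hnorm ?L (?q \<odot>\<^bsub>?L\<^esub> f k) \<le> hnorm ?L (Q (f k) \<ominus>\<^bsub>?L\<^esub> ?q \<odot>\<^bsub>?L\<^esub> f k)"
          using L.norm_diff_ge[OF Qf L.smult_closed[OF f(1)], of k ?q k] by linarith
        moreover have "hnorm ?L (?q \<odot>\<^bsub>?L\<^esub> f k) = cmod ?q" using L.norm_smult[OF f(1), of ?q k] f(2)[of k] by simp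
        moreover have "c \<le> hnorm ?L (Q (f k))" using Qlow[OF f(1), of k] f(2)[of k] by simp
        ultimately show ?thesis by linarith
      qed
      moreover have "(\<lambda>k. hnorm ?L (Q (f k) \<ominus>\<^bsub>?L\<^esub> ?q \<odot>\<^bsub>?L\<^esub> f k) + cmod ?q) \<longlonglongrightarrow> 0 + cmod ?q"
        by (intro tendsto_add Qn tendsto_const)
      ultimately have "c \<le> 0 + cmod ?q" by (intro LIMSEQ_le_const) auto
      then have "?q \<noteq> 0" using c(1) by auto
      then show "t ^ (n - 1) + (\<Sum>i\<in>{1..n-1}. (-1) ^ i * (of_nat (n - i) / of_nat n) * w i * t ^ (n - 1 - i)) \<noteq> 0"
        by (simp add: ac_simps)
    qed
  qed
  moreover have "normal_operator ?L (N i)" if i: "i \<in> {1..n}" for i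
    unfolding normal_operator_def
  proof (intro conjI ballI N i)
    fix f assume f: "f \<in> carrier ?L"
    have ha: "hadjoint ?L ?L (N i) g = Ns i g" if g: "g \<in> carrier ?L" for g
      by (rule L.self.hadjoint_unique) (use bop_closed[OF Ns[OF i] g] adjN[OF i _ g] in auto)
    show "N i (hadjoint ?L ?L (N i) f) = hadjoint ?L ?L (N i) (N i f)"
      using ha[OF f] ha[OF bop_closed[OF N[OF i] f]] NsN[OF i i f] by simp
  qed
  moreover have "commuting_tuple ?L n N"
    unfolding commuting_tuple_def using N NN by blast
  ultimately have "Theta_unitary n m p ?L N" unfolding Theta_unitary_def by blast
  then show ?thesis by (simp only: N_def[abs_def])
qed

end

section \<open>Spectral sets and the Hardy space tensor product\<close>

lemma holomorphic_several_const:
  "openin (top_of_set (cspace r)) U \<Longrightarrow> holomorphic_several r U (\<lambda>z. c)"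
  by (simp add: holomorphic_several_def)

lemma holomorphic_several_coord:
  assumes "openin (top_of_set (cspace r)) U"
  shows "holomorphic_several r U (\<lambda>z. z j)"
proof -
  have "(\<lambda>w. (z(i := w)) j) field_differentiable at (z i)" for z i and j :: nat
    by (cases "i = j") auto
  moreover have "continuous_on U (\<lambda>z. z j)"
    by (rule continuous_on_subset[OF continuous_on_product_coordinates]) auto
  ultimately show ?thesis using assms unfolding holomorphic_several_def by blast
qed

lemma holomorphic_several_add:
  "holomorphic_several r U f \<Longrightarrow> holomorphic_several r U g \<Longrightarrow> holomorphic_several r U (\<lambda>z. f z + g z)"
  unfolding holomorphic_several_def by (auto intro!: continuous_intros derivative_intros)

lemma holomorphic_several_mult:
  "holomorphic_several r U f \<Longrightarrow> holomorphic_several r U g \<Longrightarrow> holomorphic_several r U (\<lambda>z. f z * g z)"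
  unfolding holomorphic_several_def
  by (auto intro!: continuous_intros derivative_intros simp: fun_upd_triv)

lemma holomorphic_several_inverse:
  "holomorphic_several r U f \<Longrightarrow> (\<And>z. z \<in> U \<Longrightarrow> f z \<noteq> 0) \<Longrightarrow> holomorphic_several r U (\<lambda>z. inverse (f z))"
  unfolding holomorphic_several_def
  by (auto intro!: continuous_intros derivative_intros simp: fun_upd_triv)

lemma holomorphic_several_sum:
  assumes "openin (top_of_set (cspace r)) U" "finite F" "\<And>i. i \<in> F \<Longrightarrow> holomorphic_several r U (f i)"
  shows "holomorphic_several r U (\<lambda>z. \<Sum>i\<in>F. f i z)"
  using assms(2,3)
  by (induction F rule: finite_induct)
    (auto intro: holomorphic_several_const[OF assms(1)] holomorphic_several_add)

text \<open>By Vieta the value is the product of the t - z_k with |z_k| <= 1 < |t|.\<close>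

lemma Gamma_set_polynomial_nonzero:
  assumes s: "s \<in> Gamma_set r" and t: "cmod t > 1"
  shows "t ^ r + (\<Sum>i\<in>{1..r}. (-1) ^ i * t ^ (r - i) * s i) \<noteq> 0"
proof -
  obtain z where z: "\<And>k. k \<in> {1..r} \<Longrightarrow> cmod (z k) \<le> 1" "\<And>i. i \<in> {1..r} \<Longrightarrow> s i = esym r i z"
  proof -
    obtain z where "s = (\<lambda>i. if i \<in> {1..r} then esym r i z else 0)" "\<forall>k\<in>{1..r}. cmod (z k) \<le> 1"
      using s unfolding Gamma_set_def by blast
    then show ?thesis using that[of z] by simp
  qed
  have "{A. A \<subseteq> {1..r} \<and> card A = 0} = {{}}" by (auto simp: finite_subset)
  then have e0: "esym r 0 z = 1" by (simp add: esym_def)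
  have "(\<Prod>k\<in>{1..r}. t - z k) = (\<Sum>i\<le>r. (-1) ^ i * esym r i z * t ^ (r - i))" by (rule vieta)
  also have "{..r} = insert 0 {1..r}" by auto
  also have "(\<Sum>i\<in>insert 0 {1..r}. (-1) ^ i * esym r i z * t ^ (r - i))
      = t ^ r + (\<Sum>i\<in>{1..r}. (-1) ^ i * t ^ (r - i) * s i)"
    using z by (simp add: e0 ac_simps)
  finally have "t ^ r + (\<Sum>i\<in>{1..r}. (-1) ^ i * t ^ (r - i) * s i) = (\<Prod>k\<in>{1..r}. t - z k)" ..
  moreover have "t - z k \<noteq> 0" if "k \<in> {1..r}" for k using z(1)[OF that] t by auto
  ultimately show ?thesis by simp
qed

text \<open>For \<open>|t| > 1\<close> the function \<open>s \<mapsto> t\<^sup>r - s\<^sub>1 t\<^sup>r\<^sup>-\<^sup>1 + \<dots>\<close> has no zero on \<open>Gamma_set r\<close>, so the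
  functional calculus inverts the operator it defines.\<close>

lemma (in hilbert) Gamma_contraction_bounded_below:
  assumes G: "Gamma_contraction r H S" and t: "cmod t > 1"
  shows "\<exists>c>0. \<forall>x\<in>carrier H. c * hnorm H x \<le>
    hnorm H (t ^ r \<odot> x \<oplus> finsum H (\<lambda>i. ((-1) ^ i * t ^ (r - i)) \<odot> S i x) {1..r})"
proof -
  let ?sp = "taylor_spectrum H r S"
  obtain \<Phi> where S: "commuting_tuple H r S" and sp: "?sp \<subseteq> Gamma_set r" and \<Phi>: "taylor_calculus H r S \<Phi>"
    using G unfolding Gamma_contraction_def spectral_set_def by blast
  have Sb: "bounded_operator H H (S i)" if "i \<in> {1..r}" for i
    using S that by (simp add: commuting_tuple_def)
  note \<Phi>1 = \<Phi>[unfolded taylor_calculus_def, THEN conjunct1]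
  note \<Phi>2 = \<Phi>[unfolded taylor_calculus_def, THEN conjunct2]
  have \<Phi>b: "bounded_operator H H (\<Phi> f)" if "holomorphic_near r ?sp f" for f
    by (rule \<Phi>1[rule_format, OF that])
  have \<Phi>_cong: "\<Phi> f x = \<Phi> g x"
    if "?sp \<subseteq> U" "holomorphic_several r U f" "holomorphic_several r U g" "\<And>z. z \<in> U \<Longrightarrow> f z = g z" "x \<in> carrier H"
    for U f g x
    by (rule \<Phi>2[THEN conjunct1, rule_format, of U]) (fact that)+
  have \<Phi>_const: "\<Phi> (\<lambda>z. c) x = c \<odot> x" if "x \<in> carrier H" for c x
    by (rule \<Phi>2[THEN conjunct2, THEN conjunct1, rule_format, OF that])
  have \<Phi>_coord: "\<Phi> (\<lambda>z. z i) x = S i x" if "i \<in> {1..r}" "x \<in> carrier H" for i x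
    by (rule \<Phi>2[THEN conjunct2, THEN conjunct2, THEN conjunct1, rule_format, OF that])
  have \<Phi>_alg: "\<Phi> (\<lambda>z. f z + g z) x = \<Phi> f x \<oplus> \<Phi> g x" "\<Phi> (\<lambda>z. f z * g z) x = \<Phi> f (\<Phi> g x)"
    if "holomorphic_near r ?sp f" "holomorphic_near r ?sp g" "x \<in> carrier H" for f g x
    using \<Phi>2[THEN conjunct2, THEN conjunct2, THEN conjunct2, THEN conjunct1, rule_format, OF that] by simp_all
  have spc: "?sp \<subseteq> cspace r" by (auto simp: taylor_spectrum_def)
  have op: "openin (top_of_set (cspace r)) (cspace r)" by simp
  have nearI: "holomorphic_near r ?sp f" if "holomorphic_several r (cspace r) f" for f
    using spc that unfolding holomorphic_near_def by blast
  note hs = holomorphic_several_const[OF op] holomorphic_several_coord[OF op]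
    holomorphic_several_add holomorphic_several_mult holomorphic_several_sum[OF op]
  \<comment> \<open>The index set F is a parameter so that the calculus can be evaluated on
    \<open>q\<close> one monomial at a time.\<close>
  define q where "q F z = t ^ r + (\<Sum>i\<in>F. (-1) ^ i * t ^ (r - i) * z i)" for F and z :: "nat \<Rightarrow> complex"
  have qh: "holomorphic_several r (cspace r) (q F)" if "finite F" for F
    unfolding q_def[abs_def] using that by (intro hs)
  have \<Phi>q: "\<Phi> (q F) x = t ^ r \<odot> x \<oplus> finsum H (\<lambda>i. ((-1) ^ i * t ^ (r - i)) \<odot> S i x) F"
    if x: "x \<in> carrier H" and F: "finite F" "F \<subseteq> {1..r}" for x F
    using F
  proof (induction F rule: finite_induct)
    case empty
    then show ?case using \<Phi>_const[OF x] x by (simp add: q_def[abs_def])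
  next
    case (insert a F)
    let ?c = "(-1) ^ a * t ^ (r - a)"
    have a: "a \<in> {1..r}" using insert by auto
    have Sx: "S i x \<in> carrier H" if "i \<in> insert a F" for i
      using bop_closed[OF Sb x] that insert.prems by auto
    have "q (insert a F) = (\<lambda>z. q F z + ?c * z a)"
      using insert.hyps by (auto simp: q_def fun_eq_iff algebra_simps)
    then have "\<Phi> (q (insert a F)) x = \<Phi> (q F) x \<oplus> \<Phi> (\<lambda>z. ?c * z a) x"
      using \<Phi>_alg(1)[OF nearI nearI x, of "q F" "\<lambda>z. ?c * z a"] qh[OF insert.hyps(1)] hs by simp
    also have "\<Phi> (\<lambda>z. ?c * z a) x = \<Phi> (\<lambda>z. ?c) (\<Phi> (\<lambda>z. z a) x)"
      by (rule \<Phi>_alg(2)[OF nearI nearI x]) (intro hs)+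
    also have "\<dots> = ?c \<odot> S a x"
      using \<Phi>_coord[OF a x] \<Phi>_const[OF Sx[of a], of ?c] by simp
    also have "\<Phi> (q F) x = t ^ r \<odot> x \<oplus> finsum H (\<lambda>i. ((-1) ^ i * t ^ (r - i)) \<odot> S i x) F"
      using insert by simp
    finally have *: "\<Phi> (q (insert a F)) x
        = t ^ r \<odot> x \<oplus> finsum H (\<lambda>i. ((-1) ^ i * t ^ (r - i)) \<odot> S i x) F \<oplus> ?c \<odot> S a x" .
    have "finsum H (\<lambda>i. ((-1) ^ i * t ^ (r - i)) \<odot> S i x) F \<in> carrier H"
      by (rule finsum_closed) (use Sx in auto)
    moreover have "finsum H (\<lambda>i. ((-1) ^ i * t ^ (r - i)) \<odot> S i x) (insert a F)
        = ?c \<odot> S a x \<oplus> finsum H (\<lambda>i. ((-1) ^ i * t ^ (r - i)) \<odot> S i x) F"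
      by (rule finsum_insert) (use insert.hyps Sx in auto)
    ultimately show ?case
      unfolding * using x Sx[of a] by (simp add: a_assoc a_comm a_lcomm)
  qed
  let ?q = "q {1..r}"
  \<comment> \<open>The zero-free set of the polynomial is open relative to \<open>cspace r\<close>
    and contains the spectrum, so the reciprocal belongs to the calculus.\<close>
  define U where "U = {z \<in> cspace r. ?q z \<noteq> 0}"
  have Uo: "openin (top_of_set (cspace r)) U"
  proof -
    have "continuous_on (cspace r) ?q" using qh[of "{1..r}"] by (simp add: holomorphic_several_def)
    then have "openin (top_of_set (cspace r)) (cspace r \<inter> ?q -` (- {0}))"
      by (rule continuous_openin_preimage_gen) auto
    then show ?thesis by (simp add: U_def vimage_def Int_def)
  qed
  have spU: "?sp \<subseteq> U"
    using sp spc Gamma_set_polynomial_nonzero[OF _ t] by (auto simp: U_def q_def)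
  have restr: "holomorphic_several r U f" if "holomorphic_several r (cspace r) f" for f
    using that Uo unfolding holomorphic_several_def U_def by (auto intro: continuous_on_subset)
  have qU: "holomorphic_several r U ?q" by (rule restr[OF qh]) simp
  have iU: "holomorphic_several r U (\<lambda>z. inverse (?q z))"
    by (rule holomorphic_several_inverse[OF qU]) (simp add: U_def)
  have near: "holomorphic_near r ?sp (\<lambda>z. inverse (?q z))" "holomorphic_near r ?sp ?q"
    unfolding holomorphic_near_def using spU iU qU by blast+
  obtain C where C: "C > 0" "\<And>x. x \<in> carrier H \<Longrightarrow> hnorm H (\<Phi> (\<lambda>z. inverse (?q z)) x) \<le> C * hnorm H x"
    using bop_bound[OF hilbert_axioms \<Phi>b[OF near(1)]] by blast
  have "1 / C * hnorm H x \<le>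
    hnorm H (t ^ r \<odot> x \<oplus> finsum H (\<lambda>i. ((-1) ^ i * t ^ (r - i)) \<odot> S i x) {1..r})" if x: "x \<in> carrier H" for x
  proof -
    \<comment> \<open>x = (1/q)(S) q(S) x, so a bound for (1/q)(S) gives a lower bound for
      q(S).\<close>
    have "x = \<Phi> (\<lambda>z. 1) x" using \<Phi>_const[OF x, of 1] x by simp
    also have "\<dots> = \<Phi> (\<lambda>z. inverse (?q z) * ?q z) x"
      by (rule \<Phi>_cong[OF spU holomorphic_several_const[OF Uo] holomorphic_several_mult[OF iU qU] _ x])
        (simp add: U_def)
    also have "\<dots> = \<Phi> (\<lambda>z. inverse (?q z)) (\<Phi> ?q x)" by (rule \<Phi>_alg(2)[OF near x])
    finally have "hnorm H x \<le> C * hnorm H (\<Phi> ?q x)"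
      using C(2)[OF bop_closed[OF \<Phi>b[OF near(2)] x]] by simp
    then show ?thesis using C(1) \<Phi>q[OF x, of "{1..r}"] by (simp add: field_simps)
  qed
  then show ?thesis using C(1) by (intro exI[of _ "1 / C"]) auto
qed

section \<open>Taylor coefficients in the Hardy space\<close>

lemma hardy_simps [simp]:
  "f \<oplus>\<^bsub>hardy_space\<^esub> g = (\<lambda>z. f z + g z)" "c \<odot>\<^bsub>hardy_space\<^esub> f = (\<lambda>z. c * f z)"
  by (simp_all add: hardy_space_def)

lemma hardy_inner:
  "hinner hardy_space f g = (\<Sum>k. taylor_coeff f k * cnj (taylor_coeff g k))"
  by (simp add: hardy_space_def)

lemma hardy_mem_iff:
  "f \<in> carrier hardy_space \<longleftrightarrow> f holomorphic_on ball 0 1 \<and> (\<forall>z. z \<notin> ball 0 1 \<longrightarrow> f z = 0) \<and>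
     summable (\<lambda>k. (cmod (taylor_coeff f k))\<^sup>2)"
  by (simp only: hardy_space_def partial_object.simps mem_Collect_eq)

text \<open>Formal power series give the coefficients of monomials and of products with z without
  any differentiation.\<close>

lemma taylor_coeff_eq_fps_nth: "f has_fps_expansion F \<Longrightarrow> taylor_coeff f k = fps_nth F k"
  by (simp add: taylor_coeff_def fps_nth_fps_expansion)

lemma taylor_coeff_monom: "taylor_coeff (hardy_monom k) j = (if j = k then 1 else 0)"
proof -
  have "eventually (\<lambda>z :: complex. z \<in> ball 0 1) (nhds 0)" by (intro eventually_nhds_in_open) auto
  then have "eventually (\<lambda>z. hardy_monom k z = z ^ k) (nhds 0)"
    by eventually_elim (simp add: hardy_monom_def)
  then have "hardy_monom k has_fps_expansion fps_X ^ k"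
    using has_fps_expansion_cong[of "hardy_monom k" "\<lambda>z. z ^ k"] has_fps_expansion_fps_X_power by blast
  then show ?thesis by (simp add: taylor_coeff_eq_fps_nth)
qed

lemma hardy_monom_mem: "hardy_monom k \<in> carrier hardy_space"
  unfolding hardy_mem_iff
proof (intro conjI)
  have "(\<lambda>z. z ^ k) holomorphic_on ball 0 1" by (intro holomorphic_intros)
  then show "hardy_monom k holomorphic_on ball 0 1"
    by (rule holomorphic_transform) (simp add: hardy_monom_def)
  show "summable (\<lambda>j. (cmod (taylor_coeff (hardy_monom k) j))\<^sup>2)"
    by (rule summable_finite[of "{k}"]) (auto simp: taylor_coeff_monom)
qed (simp add: hardy_monom_def)

lemma taylor_coeff_mult_z:
  assumes "f \<in> carrier hardy_space"
  shows "taylor_coeff (mult_z f) k = (if k = 0 then 0 else taylor_coeff f (k - 1))"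
proof -
  have "f analytic_on {0}"
    using assms unfolding hardy_mem_iff analytic_at by (intro exI[of _ "ball 0 1"]) auto
  then have f: "f has_fps_expansion fps_expansion f 0" by (rule analytic_at_imp_has_fps_expansion_0)
  have "mult_z f has_fps_expansion fps_X * fps_expansion f 0"
    unfolding mult_z_def by (rule has_fps_expansion_mult[OF has_fps_expansion_fps_X f])
  with f show ?thesis by (simp add: taylor_coeff_eq_fps_nth)
qed

lemma mult_z_mem:
  assumes f: "f \<in> carrier hardy_space"
  shows "mult_z f \<in> carrier hardy_space"
  unfolding hardy_mem_iff
proof (intro conjI)
  show "mult_z f holomorphic_on ball 0 1"
    using f unfolding hardy_mem_iff mult_z_def by (auto intro!: holomorphic_intros)
  show "\<forall>z. z \<notin> ball 0 1 \<longrightarrow> mult_z f z = 0" using f unfolding hardy_mem_iff mult_z_def by auto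
  have "summable (\<lambda>k. (cmod (taylor_coeff (mult_z f) (Suc k)))\<^sup>2)"
    using f unfolding hardy_mem_iff by (simp add: taylor_coeff_mult_z[OF f])
  then show "summable (\<lambda>k. (cmod (taylor_coeff (mult_z f) k))\<^sup>2)" by (rule summable_Suc_iff[THEN iffD1])
qed

lemma mult_z_pow:
  assumes f: "f \<in> carrier hardy_space"
  shows "(mult_z ^^ l) f \<in> carrier hardy_space"
    and "taylor_coeff ((mult_z ^^ l) f) k = (if k < l then 0 else taylor_coeff f (k - l))"
proof (induction l arbitrary: k)
  case (Suc l)
  { case 1 show ?case using mult_z_mem[OF Suc(1)] by simp }
  { case 2 show ?case using taylor_coeff_mult_z[OF Suc(1)] Suc(2) by (auto simp: less_Suc_eq_0_disj) }
qed (use f in auto)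

lemma mult_z_pow_monom: "(mult_z ^^ l) (hardy_monom k) = hardy_monom (k + l)"
  by (induction l) (auto simp: mult_z_def hardy_monom_def fun_eq_iff)

lemma hardy_inner_monom_left: "hinner hardy_space (hardy_monom k) f = cnj (taylor_coeff f k)"
  unfolding hardy_inner taylor_coeff_monom
  by (rule sums_unique[symmetric]) (use sums_single[of k "\<lambda>j. cnj (taylor_coeff f j)"] in \<open>simp add: if_distrib if_distribR cong: if_cong\<close>)

lemma summable_sq_bound:
  fixes b :: "nat \<Rightarrow> real"
  assumes "\<And>N. (\<Sum>k<N. (b k)\<^sup>2) \<le> B"
  shows "summable (\<lambda>k. (b k)\<^sup>2)"
  by (rule summableI_nonneg_bounded[of _ B]) (use assms in auto)

section \<open>The tensor product as a space of coefficient sequences\<close>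

locale tensor_model = E: hilbert E + K: hilbert K
  for E :: "'h hspace" and K :: "'k hspace" and tens :: "(complex \<Rightarrow> complex) \<Rightarrow> 'h \<Rightarrow> 'k" +
  assumes tensor: "hilbert_tensor hardy_space E K tens"
begin

sublocale EK: two_hilbert E K ..

lemma tens_closed [simp]: "f \<in> carrier hardy_space \<Longrightarrow> x \<in> carrier E \<Longrightarrow> tens f x \<in> carrier K"
  using tensor by (simp add: hilbert_tensor_def)

lemma tens_add_right: "f \<in> carrier hardy_space \<Longrightarrow> x \<in> carrier E \<Longrightarrow> y \<in> carrier E \<Longrightarrow>
    tens f (x \<oplus>\<^bsub>E\<^esub> y) = tens f x \<oplus>\<^bsub>K\<^esub> tens f y"
  using tensor by (simp add: hilbert_tensor_def)

lemma tens_smult_right: "f \<in> carrier hardy_space \<Longrightarrow> x \<in> carrier E \<Longrightarrow>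
    tens f (c \<odot>\<^bsub>E\<^esub> x) = c \<odot>\<^bsub>K\<^esub> tens f x"
  using tensor by (simp add: hilbert_tensor_def)

lemma tens_inner: "f \<in> carrier hardy_space \<Longrightarrow> g \<in> carrier hardy_space \<Longrightarrow> x \<in> carrier E \<Longrightarrow> y \<in> carrier E \<Longrightarrow>
    hinner K (tens f x) (tens g y) = hinner hardy_space f g * hinner E x y"
  using tensor by (simp add: hilbert_tensor_def)

text \<open>The vector z^k \<otimes> x. \<open>hilbert_tensor\<close> fixes K only up to a unitary;
  in place of a concrete model K is described through the isometries \<open>e k\<close>, whose
  ranges are mutually orthogonal.\<close>

definition e :: "nat \<Rightarrow> 'h \<Rightarrow> 'k" where
  "e k = tens (hardy_monom k)"

lemma e_closed [simp]: "x \<in> carrier E \<Longrightarrow> e k x \<in> carrier K"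
  by (simp add: e_def hardy_monom_mem)

lemma e_inner: "x \<in> carrier E \<Longrightarrow> y \<in> carrier E \<Longrightarrow>
    hinner K (e j x) (e k y) = (if j = k then hinner E x y else 0)"
  by (simp add: e_def tens_inner hardy_monom_mem hardy_inner_monom_left taylor_coeff_monom)

lemma e_norm [simp]: "x \<in> carrier E \<Longrightarrow> hnorm K (e k x) = hnorm E x"
  by (simp add: hnorm_def e_inner)

lemma e_bounded: "bounded_operator E K (e k)"
proof (rule bounded_operatorI[where C = 1])
  show "e k (x \<oplus>\<^bsub>E\<^esub> y) = e k x \<oplus>\<^bsub>K\<^esub> e k y" if "x \<in> carrier E" "y \<in> carrier E" for x y
    unfolding e_def by (rule tens_add_right[OF hardy_monom_mem that])
  show "e k (c \<odot>\<^bsub>E\<^esub> x) = c \<odot>\<^bsub>K\<^esub> e k x" if "x \<in> carrier E" for c x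
    unfolding e_def by (rule tens_smult_right[OF hardy_monom_mem that])
qed auto

text \<open>The k-th Taylor coefficient of an E-valued function. As the adjoint of
  \<open>e k\<close> it is defined and bounded on all of K at once.\<close>

definition coord :: "nat \<Rightarrow> 'k \<Rightarrow> 'h" where
  "coord k = hadjoint E K (e k)"

lemma coord_closed [simp]: "F \<in> carrier K \<Longrightarrow> coord k F \<in> carrier E"
  unfolding coord_def by (rule EK.hadjoint(1)[OF e_bounded])

lemma coord_inner: "F \<in> carrier K \<Longrightarrow> x \<in> carrier E \<Longrightarrow> hinner K (e k x) F = hinner E x (coord k F)"
  unfolding coord_def by (rule EK.hadjoint(2)[OF e_bounded])

lemma coord_inner': "F \<in> carrier K \<Longrightarrow> x \<in> carrier E \<Longrightarrow> hinner K F (e k x) = hinner E (coord k F) x"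
  unfolding coord_def by (rule EK.hadjoint_left[OF e_bounded, symmetric])

lemma coord_bounded: "bounded_operator K E (coord k)"
  unfolding coord_def by (rule EK.bounded_operator_hadjoint(1)[OF e_bounded, of 1]) auto

lemma coord_eqI:
  assumes "F \<in> carrier K" "y \<in> carrier E" "\<And>x. x \<in> carrier E \<Longrightarrow> hinner K (e k x) F = hinner E x y"
  shows "coord k F = y"
  unfolding coord_def by (rule EK.hadjoint_unique) (use assms in auto)

lemma coord_e: "x \<in> carrier E \<Longrightarrow> coord j (e k x) = (if j = k then x else \<zero>\<^bsub>E\<^esub>)"
  by (rule coord_eqI) (auto simp: e_inner)

lemma e_finsum_closed:
  "(\<And>k. x k \<in> carrier E) \<Longrightarrow> finsum K (\<lambda>k. e k (x k)) F \<in> carrier K"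
  by (rule K.finsum_closed) auto

lemma e_finsum_norm:
  assumes x: "\<And>k. x k \<in> carrier E" and F: "finite F"
  shows "(hnorm K (finsum K (\<lambda>k. e k (x k)) F))\<^sup>2 = (\<Sum>k\<in>F. (hnorm E (x k))\<^sup>2)"
proof -
  let ?S = "finsum K (\<lambda>k. e k (x k)) F"
  have "hinner K ?S ?S = (\<Sum>k\<in>F. hinner K (e k (x k)) ?S)"
    by (rule K.inner_finsum_left) (use x F e_finsum_closed in auto)
  also have "\<dots> = (\<Sum>k\<in>F. \<Sum>j\<in>F. hinner K (e k (x k)) (e j (x j)))"
    by (intro sum.cong K.inner_finsum_right) (use x F in auto)
  also have "\<dots> = (\<Sum>k\<in>F. hinner E (x k) (x k))"
    using F x by (simp add: e_inner sum.delta)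
  finally show ?thesis
    using x e_finsum_closed[OF x] by (simp add: K.norm_sq E.norm_sq)
qed

lemma coord_finsum:
  assumes x: "\<And>k. x k \<in> carrier E" and F: "finite F"
  shows "coord j (finsum K (\<lambda>k. e k (x k)) F) = (if j \<in> F then x j else \<zero>\<^bsub>E\<^esub>)"
proof (rule coord_eqI)
  fix y assume y: "y \<in> carrier E"
  have "hinner K (e j y) (finsum K (\<lambda>k. e k (x k)) F) = (\<Sum>k\<in>F. hinner K (e j y) (e k (x k)))"
    by (rule K.inner_finsum_right) (use x F y in auto)
  also have "\<dots> = hinner E y (if j \<in> F then x j else \<zero>\<^bsub>E\<^esub>)"
    using F x y by (simp add: e_inner sum.delta)
  finally show "hinner K (e j y) (finsum K (\<lambda>k. e k (x k)) F) = hinner E y (if j \<in> F then x j else \<zero>\<^bsub>E\<^esub>)" .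
qed (use x e_finsum_closed in auto)

text \<open>Expand the squared distance from F to its N-th partial sum.\<close>

lemma Bessel:
  assumes F: "F \<in> carrier K"
  shows "(\<Sum>k<N. (hnorm E (coord k F))\<^sup>2) \<le> (hnorm K F)\<^sup>2"
proof -
  let ?S = "finsum K (\<lambda>k. e k (coord k F)) {..<N}"
  have S: "?S \<in> carrier K" by (rule e_finsum_closed) (use F in auto)
  have "hinner K F ?S = (\<Sum>k<N. hinner K F (e k (coord k F)))"
    by (rule K.inner_finsum_right) (use F in auto)
  also have "\<dots> = (\<Sum>k<N. hinner E (coord k F) (coord k F))" using F by (simp add: coord_inner')
  finally have "Re (hinner K F ?S) = (\<Sum>k<N. (hnorm E (coord k F))\<^sup>2)" using F by (simp add: E.norm_sq)
  moreover have "(hnorm K ?S)\<^sup>2 = (\<Sum>k<N. (hnorm E (coord k F))\<^sup>2)" by (rule e_finsum_norm) (use F in auto)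
  ultimately show ?thesis
    using K.norm_diff_sq[OF F S] zero_le_power2[of "hnorm K (F \<ominus>\<^bsub>K\<^esub> ?S)"] by simp
qed

text \<open>The squared error is the tail of the series of squared Taylor coefficients of f, times
  the squared norm of x. Density of all elementary tensors is thereby reduced to the
  monomials.\<close>

lemma tens_in_closure:
  assumes f: "f \<in> carrier hardy_space" and x: "x \<in> carrier E"
  shows "K.hlim (\<lambda>N. finsum K (\<lambda>k. e k (taylor_coeff f k \<odot>\<^bsub>E\<^esub> x)) {..<N}) (tens f x)"
proof -
  let ?S = "\<lambda>N. finsum K (\<lambda>k. e k (taylor_coeff f k \<odot>\<^bsub>E\<^esub> x)) {..<N}"
  let ?a = "\<lambda>k. (cmod (taylor_coeff f k))\<^sup>2"
  have sm: "summable ?a" using f by (simp add: hardy_mem_iff)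
  have S: "?S N \<in> carrier K" for N by (rule e_finsum_closed) (use x in auto)
  have ff: "hinner hardy_space f f = of_real (\<Sum>k. ?a k)"
    unfolding hardy_inner using sm by (simp add: suminf_of_real flip: complex_norm_square of_real_power)
  have tn: "(hnorm K (tens f x))\<^sup>2 = (\<Sum>k. ?a k) * (hnorm E x)\<^sup>2"
    using f x by (simp add: K.norm_sq E.norm_sq tens_inner ff)
  have "(hnorm K (?S N \<ominus>\<^bsub>K\<^esub> tens f x))\<^sup>2 = ((\<Sum>k. ?a k) - (\<Sum>k<N. ?a k)) * (hnorm E x)\<^sup>2" for N
  proof -
    have "hinner K (?S N) (tens f x) = (\<Sum>k<N. hinner K (e k (taylor_coeff f k \<odot>\<^bsub>E\<^esub> x)) (tens f x))"
      by (rule K.inner_finsum_left) (use f x in auto)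
    also have "\<dots> = (\<Sum>k<N. of_real (?a k) * of_real ((hnorm E x)\<^sup>2))"
    proof (rule sum.cong)
      fix k
      have "hinner K (e k (taylor_coeff f k \<odot>\<^bsub>E\<^esub> x)) (tens f x)
          = cnj (taylor_coeff f k) * (taylor_coeff f k * hinner E x x)"
        using f x by (simp add: e_def tens_inner hardy_monom_mem hardy_inner_monom_left)
      then show "hinner K (e k (taylor_coeff f k \<odot>\<^bsub>E\<^esub> x)) (tens f x) = of_real (?a k) * of_real ((hnorm E x)\<^sup>2)"
        unfolding complex_norm_square[of "taylor_coeff f k"] E.inner_self[OF x] by simp
    qed simp
    finally have "Re (hinner K (?S N) (tens f x)) = (\<Sum>k<N. ?a k) * (hnorm E x)\<^sup>2"
      by (simp add: sum_distrib_right)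
    moreover have "(hnorm K (?S N))\<^sup>2 = (\<Sum>k<N. (hnorm E (taylor_coeff f k \<odot>\<^bsub>E\<^esub> x))\<^sup>2)"
      by (rule e_finsum_norm) (use x in auto)
    then have "(hnorm K (?S N))\<^sup>2 = (\<Sum>k<N. ?a k) * (hnorm E x)\<^sup>2"
      using x by (simp add: power_mult_distrib sum_distrib_right)
    ultimately show ?thesis
      using K.norm_diff_sq[OF S tens_closed[OF f x]] tn by (simp add: left_diff_distrib)
  qed
  moreover have "(\<lambda>N. ((\<Sum>k. ?a k) - (\<Sum>k<N. ?a k)) * (hnorm E x)\<^sup>2) \<longlonglongrightarrow> ((\<Sum>k. ?a k) - (\<Sum>k. ?a k)) * (hnorm E x)\<^sup>2"
    by (intro tendsto_intros summable_LIMSEQ sm)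
  ultimately have "(\<lambda>N. (hnorm K (?S N \<ominus>\<^bsub>K\<^esub> tens f x))\<^sup>2) \<longlonglongrightarrow> 0" by simp
  then have "(\<lambda>N. sqrt ((hnorm K (?S N \<ominus>\<^bsub>K\<^esub> tens f x))\<^sup>2)) \<longlonglongrightarrow> sqrt 0" by (rule tendsto_real_sqrt)
  then show ?thesis using S f x by (intro K.hlimI) auto
qed

text \<open>Every elementary tensor is a limit of sums of vectors \<open>e k x\<close>, so
  orthogonality to these implies orthogonality to a dense span.\<close>

lemma e_total:
  assumes G: "G \<in> carrier K" and 0: "\<And>k x. x \<in> carrier E \<Longrightarrow> hinner K (e k x) G = 0"
  shows "G = \<zero>\<^bsub>K\<^esub>"
proof (rule K.dense_span_perp)
  show "{tens f x | f x. f \<in> carrier hardy_space \<and> x \<in> carrier E} \<subseteq> carrier K" by auto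
  show "htop K closure_of (hspan K {tens f x | f x. f \<in> carrier hardy_space \<and> x \<in> carrier E}) = carrier K"
    using tensor by (simp add: hilbert_tensor_def)
  fix s assume "s \<in> {tens f x | f x. f \<in> carrier hardy_space \<and> x \<in> carrier E}"
  then obtain f x where fx: "s = tens f x" "f \<in> carrier hardy_space" "x \<in> carrier E" by blast
  have "hinner K (finsum K (\<lambda>k. e k (taylor_coeff f k \<odot>\<^bsub>E\<^esub> x)) {..<N}) G = 0" for N
  proof -
    have "hinner K (finsum K (\<lambda>k. e k (taylor_coeff f k \<odot>\<^bsub>E\<^esub> x)) {..<N}) G
        = (\<Sum>k<N. hinner K (e k (taylor_coeff f k \<odot>\<^bsub>E\<^esub> x)) G)"
      by (rule K.inner_finsum_left) (use fx G in auto)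
    then show ?thesis using 0 fx by simp
  qed
  then show "hinner K s G = 0"
    using K.hlim_inner[OF tens_in_closure[OF fx(2,3)] G] LIMSEQ_unique[of "\<lambda>N. 0::complex"] fx(1) by simp
qed (rule G)

text \<open>A vector with zero coefficients is orthogonal to every \<open>e k x\<close>. Identities
  in K can now be checked coefficientwise.\<close>

lemma coord_ext:
  assumes F: "F \<in> carrier K" and G: "G \<in> carrier K" and "\<And>k. coord k F = coord k G"
  shows "F = G"
proof -
  have "F \<ominus>\<^bsub>K\<^esub> G = \<zero>\<^bsub>K\<^esub>" by (rule e_total) (use assms in \<open>auto simp: coord_inner\<close>)
  then show ?thesis using F G by (simp add: K.minus_eq_zero_iff)
qed

lemma e_dense: "htop K closure_of (hspan K {e k x | k x. x \<in> carrier E}) = carrier K"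
  by (rule K.dense_spanI) (auto intro!: e_total)

text \<open>Riesz-Fischer for the orthogonal ranges of the \<open>e k\<close>. Since
  \<open>hsuminf\<close> is a definite description, convergence and uniqueness of the limit come
  before any property of the sum.\<close>

lemma series:
  assumes x: "\<And>k. x k \<in> carrier E" and s: "summable (\<lambda>k. (hnorm E (x k))\<^sup>2)"
  shows "hsums K (\<lambda>k. e k (x k)) (hsuminf K (\<lambda>k. e k (x k)))"
    and "hsuminf K (\<lambda>k. e k (x k)) \<in> carrier K"
    and "\<And>k. coord k (hsuminf K (\<lambda>k. e k (x k))) = x k"
    and "(hnorm K (hsuminf K (\<lambda>k. e k (x k))))\<^sup>2 = (\<Sum>k. (hnorm E (x k))\<^sup>2)"
proof -
  let ?S = "\<lambda>N. finsum K (\<lambda>k. e k (x k)) {..<N}"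
  have S: "?S N \<in> carrier K" for N by (rule e_finsum_closed[OF x])
  have diff: "(hnorm K (?S M \<ominus>\<^bsub>K\<^esub> ?S N))\<^sup>2 = (\<Sum>k\<in>{N..<M}. (hnorm E (x k))\<^sup>2)" if "N \<le> M" for M N
  proof -
    have "?S M \<ominus>\<^bsub>K\<^esub> ?S N = finsum K (\<lambda>k. e k (x k)) {N..<M}"
    proof (rule K.eqI)
      fix v assume v: "v \<in> carrier K"
      have i: "hinner K (finsum K (\<lambda>k. e k (x k)) F) v = (\<Sum>k\<in>F. hinner K (e k (x k)) v)" if "finite F" for F
        by (rule K.inner_finsum_left) (use x v that in auto)
      have "(\<Sum>k<M. hinner K (e k (x k)) v) = (\<Sum>k<N. hinner K (e k (x k)) v) + (\<Sum>k\<in>{N..<M}. hinner K (e k (x k)) v)"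
        unfolding lessThan_atLeast0
        by (rule sum.atLeastLessThan_concat[symmetric]) (use that in auto)
      then show "hinner K (?S M \<ominus>\<^bsub>K\<^esub> ?S N) v = hinner K (finsum K (\<lambda>k. e k (x k)) {N..<M}) v"
        using S v i by simp
    qed (use S e_finsum_closed[OF x] in auto)
    then show ?thesis using e_finsum_norm[OF x, of "{N..<M}"] by simp
  qed
  have "\<exists>N. \<forall>j\<ge>N. \<forall>k\<ge>N. hnorm K (?S j \<ominus>\<^bsub>K\<^esub> ?S k) < r" if r: "r > 0" for r
  proof -
    have "\<exists>N. \<forall>m\<ge>N. \<forall>n. norm (\<Sum>k\<in>{m..<n}. (hnorm E (x k))\<^sup>2) < r\<^sup>2"
      using s[unfolded summable_Cauchy, rule_format, of "r\<^sup>2"] r by simp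
    then obtain N where N: "\<And>m n. m \<ge> N \<Longrightarrow> norm (\<Sum>k\<in>{m..<n}. (hnorm E (x k))\<^sup>2) < r\<^sup>2" by blast
    have lt: "hnorm K (?S j \<ominus>\<^bsub>K\<^esub> ?S k) < r" if "k \<le> j" "N \<le> k" for j k
    proof -
      have "(hnorm K (?S j \<ominus>\<^bsub>K\<^esub> ?S k))\<^sup>2 < r\<^sup>2" using diff[OF that(1)] N[OF that(2), of j] by simp
      then show ?thesis by (rule power2_less_imp_less) (use r in simp)
    qed
    have "hnorm K (?S j \<ominus>\<^bsub>K\<^esub> ?S k) < r" if "N \<le> j" "N \<le> k" for j k
    proof (cases "k \<le> j")
      case True
      then show ?thesis using lt that by blast
    next
      case False
      then show ?thesis using lt[of j k] that K.norm_diff_commute[OF S S, of j k] by simp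
    qed
    then show ?thesis by blast
  qed
  then obtain G where G: "K.hlim ?S G" using K.complete[of ?S] S by blast
  have hs: "hsums K (\<lambda>k. e k (x k)) H \<longleftrightarrow> K.hlim ?S H" for H
    unfolding hsums_def by (rule K.limitin_iff_hlim[OF S])
  have "hsuminf K (\<lambda>k. e k (x k)) = G"
    unfolding hsuminf_def hs using G K.hlim_unique by blast
  then have G': "K.hlim ?S (hsuminf K (\<lambda>k. e k (x k)))" using G by simp
  show "hsums K (\<lambda>k. e k (x k)) (hsuminf K (\<lambda>k. e k (x k)))" using G' hs by blast
  show Gc: "hsuminf K (\<lambda>k. e k (x k)) \<in> carrier K" using G' by (simp add: K.hlim_def)
  show "coord k (hsuminf K (\<lambda>k. e k (x k))) = x k" for k
  proof (rule coord_eqI[OF Gc x])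
    fix y assume y: "y \<in> carrier E"
    have "(\<lambda>N. hinner K (e k y) (?S N)) \<longlonglongrightarrow> hinner K (e k y) (hsuminf K (\<lambda>k. e k (x k)))"
      by (rule K.hlim_inner_right[OF G']) (use y in auto)
    moreover have "hinner K (e k y) (?S N) = hinner E y (if k < N then x k else \<zero>\<^bsub>E\<^esub>)" for N
      using coord_inner[OF S y] coord_finsum[OF x, of "{..<N}" k] by simp
    moreover have "eventually (\<lambda>N. hinner E y (if k < N then x k else \<zero>\<^bsub>E\<^esub>) = hinner E y (x k)) sequentially"
      using eventually_gt_at_top[of k] by eventually_elim simp
    then have "(\<lambda>N. hinner E y (if k < N then x k else \<zero>\<^bsub>E\<^esub>)) \<longlonglongrightarrow> hinner E y (x k)"
      by (rule tendsto_eventually)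
    ultimately show "hinner K (e k y) (hsuminf K (\<lambda>k. e k (x k))) = hinner E y (x k)"
      using LIMSEQ_unique by simp
  qed
  have "(\<lambda>N. (hnorm K (?S N))\<^sup>2) \<longlonglongrightarrow> (hnorm K (hsuminf K (\<lambda>k. e k (x k))))\<^sup>2"
    by (intro tendsto_power K.hlim_norm G')
  moreover have "(\<lambda>N. (hnorm K (?S N))\<^sup>2) \<longlonglongrightarrow> (\<Sum>k. (hnorm E (x k))\<^sup>2)"
    unfolding e_finsum_norm[OF x finite_lessThan] by (rule summable_LIMSEQ[OF s])
  ultimately show "(hnorm K (hsuminf K (\<lambda>k. e k (x k))))\<^sup>2 = (\<Sum>k. (hnorm E (x k))\<^sup>2)"
    using LIMSEQ_unique by blast
qed

lemma coord_summable: "F \<in> carrier K \<Longrightarrow> summable (\<lambda>k. (hnorm E (coord k F))\<^sup>2)"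
  by (rule summable_sq_bound[OF Bessel])

lemma Parseval:
  assumes F: "F \<in> carrier K"
  shows "(hnorm K F)\<^sup>2 = (\<Sum>k. (hnorm E (coord k F))\<^sup>2)"
proof -
  have "F = hsuminf K (\<lambda>k. e k (coord k F))"
    by (rule coord_ext) (use series[of "\<lambda>k. coord k F"] coord_summable[OF F] F in auto)
  then show ?thesis using series(4)[of "\<lambda>k. coord k F"] coord_summable[OF F] F by simp
qed

text \<open>\<open>op_tensor\<close> is a choice and carries no information until an operator with
  the required values exists. This one is M_z^l \<otimes> A, built from coefficients: apply A and
  move up by l.\<close>

lemma weighted_shift:
  assumes A: "bounded_operator E E A"
  shows "\<exists>B. bounded_operator K K B \<and>
    (\<forall>F\<in>carrier K. \<forall>k. coord k (B F) = (if k < l then \<zero>\<^bsub>E\<^esub> else A (coord (k - l) F)))"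
proof -
  obtain C where C: "C > 0" "\<And>x. x \<in> carrier E \<Longrightarrow> hnorm E (A x) \<le> C * hnorm E x"
    using bop_bound[OF E.hilbert_axioms A] by blast
  define y where "y F k = (if k < l then \<zero>\<^bsub>E\<^esub> else A (coord (k - l) F))" for F k
  have y: "y F k \<in> carrier E" if "F \<in> carrier K" for F k
    using that bop_closed[OF A] by (simp add: y_def)
  have ys: "summable (\<lambda>k. (hnorm E (y F k))\<^sup>2) \<and> (\<Sum>k. (hnorm E (y F k))\<^sup>2) \<le> (C * hnorm K F)\<^sup>2"
    if F: "F \<in> carrier K" for F
  proof -
    have le: "(hnorm E (A (coord k F)))\<^sup>2 \<le> C\<^sup>2 * (hnorm E (coord k F))\<^sup>2" for k
      using power_mono[OF C(2)[OF coord_closed[OF F, of k]], of 2] F bop_closed[OF A]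
      by (simp add: power_mult_distrib)
    have s1: "summable (\<lambda>k. C\<^sup>2 * (hnorm E (coord k F))\<^sup>2)" by (intro summable_mult coord_summable F)
    have s2: "summable (\<lambda>k. (hnorm E (A (coord k F)))\<^sup>2)"
      by (rule summable_comparison_test'[OF s1, of 0]) (use le in auto)
    have eq: "(\<lambda>k. (hnorm E (y F (k + l)))\<^sup>2) = (\<lambda>k. (hnorm E (A (coord k F)))\<^sup>2)" by (simp add: y_def)
    have "summable (\<lambda>k. (hnorm E (y F (k + l)))\<^sup>2)" unfolding eq by (rule s2)
    then have s3: "summable (\<lambda>k. (hnorm E (y F k))\<^sup>2)" by (rule summable_iff_shift[THEN iffD1])
    have "(\<Sum>k. (hnorm E (y F k))\<^sup>2) = (\<Sum>k. (hnorm E (A (coord k F)))\<^sup>2)"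
      using suminf_split_initial_segment[OF s3, of l] eq by (simp add: y_def)
    also have "\<dots> \<le> (\<Sum>k. C\<^sup>2 * (hnorm E (coord k F))\<^sup>2)" by (rule suminf_le[OF le s2 s1])
    also have "\<dots> = (C * hnorm K F)\<^sup>2"
      using suminf_mult[OF coord_summable[OF F], of "C\<^sup>2"] Parseval[OF F] by (simp add: power_mult_distrib)
    finally show ?thesis using s3 by blast
  qed
  define B where "B F = hsuminf K (\<lambda>k. e k (y F k))" for F
  have Bc: "B F \<in> carrier K" and Bk: "coord k (B F) = y F k"
    and Bn: "(hnorm K (B F))\<^sup>2 = (\<Sum>k. (hnorm E (y F k))\<^sup>2)" if "F \<in> carrier K" for F k
    unfolding B_def using series[of "y F"] y[OF that] ys[OF that] by auto
  have "bounded_operator K K B"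
  proof (rule bounded_operatorI)
    show "B F \<in> carrier K" if "F \<in> carrier K" for F using Bc that .
    show "B (F \<oplus>\<^bsub>K\<^esub> G) = B F \<oplus>\<^bsub>K\<^esub> B G" if "F \<in> carrier K" "G \<in> carrier K" for F G
      by (rule coord_ext) (use that Bc Bk in \<open>auto simp: y_def bop_add[OF coord_bounded] bop_add[OF A]\<close>)
    show "B (c \<odot>\<^bsub>K\<^esub> F) = c \<odot>\<^bsub>K\<^esub> B F" if "F \<in> carrier K" for F c
    proof (rule coord_ext)
      have "c \<odot>\<^bsub>E\<^esub> \<zero>\<^bsub>E\<^esub> = \<zero>\<^bsub>E\<^esub>" by (rule E.eqI) auto
      then show "coord k (B (c \<odot>\<^bsub>K\<^esub> F)) = coord k (c \<odot>\<^bsub>K\<^esub> B F)" for k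
        using that Bc Bk by (auto simp: y_def bop_smult[OF coord_bounded] bop_smult[OF A])
    qed (use that Bc in auto)
    show "hnorm K (B F) \<le> C * hnorm K F" if "F \<in> carrier K" for F
      by (rule power2_le_imp_le) (use that Bn ys C in auto)
  qed
  then show ?thesis using Bk unfolding y_def by blast
qed

text \<open>The operator of \<open>weighted_shift\<close> meets the specification, so the chosen one
  does too. Both agree on elementary tensors, hence everywhere by density, and the coefficient
  formula carries over.\<close>

lemma op_tensor_mult_z:
  assumes A: "bounded_operator E E A"
  shows "bounded_operator K K (op_tensor hardy_space E K tens (mult_z ^^ l) A)"
    and "F \<in> carrier K \<Longrightarrow> coord k (op_tensor hardy_space E K tens (mult_z ^^ l) A F)
      = (if k < l then \<zero>\<^bsub>E\<^esub> else A (coord (k - l) F))"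
    and "x \<in> carrier E \<Longrightarrow> op_tensor hardy_space E K tens (mult_z ^^ l) A (e k x) = e (k + l) (A x)"
proof -
  obtain B where B: "bounded_operator K K B"
    "\<And>F k. F \<in> carrier K \<Longrightarrow> coord k (B F) = (if k < l then \<zero>\<^bsub>E\<^esub> else A (coord (k - l) F))"
    using weighted_shift[OF A, of l] by blast
  let ?P = "\<lambda>B. bounded_operator K K B \<and>
    (\<forall>f\<in>carrier hardy_space. \<forall>x\<in>carrier E. B (tens f x) = tens ((mult_z ^^ l) f) (A x))"
  have ct: "coord k (tens f x) = taylor_coeff f k \<odot>\<^bsub>E\<^esub> x" if "f \<in> carrier hardy_space" "x \<in> carrier E" for f x k
    by (rule coord_eqI) (use that in \<open>auto simp: e_def tens_inner hardy_monom_mem hardy_inner_monom_left\<close>)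
  have "?P B"
  proof (intro conjI ballI B(1))
    fix f x assume f: "f \<in> carrier hardy_space" and x: "x \<in> carrier E"
    have "0 \<odot>\<^bsub>E\<^esub> A x = \<zero>\<^bsub>E\<^esub>" by (rule E.eqI) (use bop_closed[OF A x] in auto)
    then show "B (tens f x) = tens ((mult_z ^^ l) f) (A x)"
      using f x bop_closed[OF A x] bop_closed[OF B(1)] mult_z_pow[OF f]
      by (intro coord_ext) (auto simp: B(2) ct bop_smult[OF A])
  qed
  then have P: "?P (op_tensor hardy_space E K tens (mult_z ^^ l) A)"
    unfolding op_tensor_def by (rule someI[where P = ?P])
  then show bd: "bounded_operator K K (op_tensor hardy_space E K tens (mult_z ^^ l) A)" by blast
  show "op_tensor hardy_space E K tens (mult_z ^^ l) A (e k x) = e (k + l) (A x)" if "x \<in> carrier E"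
    using P that hardy_monom_mem by (simp add: e_def mult_z_pow_monom)
  assume F: "F \<in> carrier K"
  have "op_tensor hardy_space E K tens (mult_z ^^ l) A F = B F"
  proof (rule K.self.bop_eq_on_dense[OF _ _ bd B(1) _ F])
    show "{tens f x | f x. f \<in> carrier hardy_space \<and> x \<in> carrier E} \<subseteq> carrier K" by auto
    show "htop K closure_of (hspan K {tens f x | f x. f \<in> carrier hardy_space \<and> x \<in> carrier E}) = carrier K"
      using tensor by (simp add: hilbert_tensor_def)
    show "op_tensor hardy_space E K tens (mult_z ^^ l) A s = B s"
      if "s \<in> {tens f x | f x. f \<in> carrier hardy_space \<and> x \<in> carrier E}" for s
      using that P \<open>?P B\<close> by auto
  qed
  then show "coord k (op_tensor hardy_space E K tens (mult_z ^^ l) A F)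
      = (if k < l then \<zero>\<^bsub>E\<^esub> else A (coord (k - l) F))" using B(2)[OF F] by simp
qed

end

section \<open>The isometric dilation\<close>

lemma hnorm_carrier_update [simp]: "hnorm (H\<lparr>carrier := S\<rparr>) x = hnorm H x"
  by (simp add: hnorm_def)

section \<open>Defect operators and defect spaces\<close>

context hilbert
begin

text \<open>Q = S^*S is a self-adjoint contraction, so \<open>hsqrt\<close> applies to I - Q. The
  norm identity comes from <D x, D x> = <D D x, x> for the defect operator D.\<close>

lemma defect_operator:
  assumes S: "bounded_operator H H S" and contr: "\<And>x. x \<in> carrier H \<Longrightarrow> hnorm H (S x) \<le> hnorm H x"
  shows "bounded_operator H H (defect_operator H S)"
    and "\<And>x. x \<in> carrier H \<Longrightarrow> (hnorm H (defect_operator H S x))\<^sup>2 = (hnorm H x)\<^sup>2 - (hnorm H (S x))\<^sup>2"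
proof -
  let ?D = "defect_operator H S"
  define Q where "Q x = hadjoint H H S (S x)" for x
  have adjb: "bounded_operator H H (hadjoint H H S)"
    and adjn: "\<And>y. y \<in> carrier H \<Longrightarrow> hnorm H (hadjoint H H S y) \<le> 1 * hnorm H y"
    using self.bounded_operator_hadjoint[OF S, of 1] contr by auto
  have Q: "bounded_operator H H Q"
    unfolding Q_def by (rule bounded_operator_comp[OF hilbert_axioms hilbert_axioms S adjb])
  have Qin: "hinner H (Q x) y = hinner H (S x) (S y)" if "x \<in> carrier H" "y \<in> carrier H" for x y
    unfolding Q_def by (rule self.hadjoint_left[OF S]) (use that bop_closed[OF S] in auto)
  have Qin': "hinner H x (Q y) = hinner H (S x) (S y)" if "x \<in> carrier H" "y \<in> carrier H" for x y
    unfolding Q_def by (rule self.hadjoint(2)[OF S, symmetric]) (use that bop_closed[OF S] in auto)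
  have Qn: "hnorm H (Q x) \<le> hnorm H x" if "x \<in> carrier H" for x
    using adjn[OF bop_closed[OF S that]] contr[OF that] by (simp add: Q_def)
  have D_def: "?D = hsqrt H (\<lambda>x. x \<ominus> Q x)" by (simp add: defect_operator_def Q_def)
  have pos: "positive_operator H ?D" and sq: "\<And>x. x \<in> carrier H \<Longrightarrow> ?D (?D x) = x \<ominus> Q x"
    unfolding D_def by (rule hsqrt[OF Q]; use Qin Qin' Qn in auto)+
  show b: "bounded_operator H H ?D" using pos by (simp add: positive_operator_def)
  fix x assume x: "x \<in> carrier H"
  have "hinner H (?D x) (?D x) = hinner H (?D (?D x)) x"
    using positive_selfadjoint[OF pos bop_closed[OF b x] x] by simp
  also have "\<dots> = hinner H x x - hinner H (S x) (S x)"
    using sq[OF x] x bop_closed[OF Q x] Qin[OF x x] by simp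
  finally show "(hnorm H (?D x))\<^sup>2 = (hnorm H x)\<^sup>2 - (hnorm H (S x))\<^sup>2"
    using x bop_closed[OF b x] bop_closed[OF S x] by (simp add: norm_sq)
qed

text \<open>Vector operations and limits stay in the closure of the range. For the last claim, a
  vector in that closure which is orthogonal to the range is orthogonal to itself.\<close>

lemma defect_space:
  assumes D: "bounded_operator H H (defect_operator H S)"
  shows "hilbert (defect_space H S)"
    and "bounded_operator H (defect_space H S) (defect_operator H S)"
    and "\<And>x. x \<in> carrier (defect_space H S) \<Longrightarrow> x \<in> carrier H"
    and "\<And>x. x \<in> carrier (defect_space H S) \<Longrightarrow>
      (\<And>h. h \<in> carrier H \<Longrightarrow> hinner H (defect_operator H S h) x = 0) \<Longrightarrow> x = \<zero>"
proof -
  let ?D = "defect_operator H S"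
  let ?R = "?D ` carrier H"
  note [simp] = bop_closed[OF D]
  have R: "?R \<subseteq> carrier H" by auto
  show "hilbert (defect_space H S)"
    unfolding defect_space_def
  proof (rule closure_hilbert[OF R])
    show "\<zero> \<in> ?R" using self.bop_zero[OF D] by (intro image_eqI[of _ _ \<zero>]) auto
    show "x \<oplus> y \<in> ?R" if xy: "x \<in> ?R" "y \<in> ?R" for x y
    proof -
      obtain a b where "x = ?D a" "y = ?D b" "a \<in> carrier H" "b \<in> carrier H" using xy by blast
      then show ?thesis using bop_add[OF D, of a b] by (intro image_eqI[of _ _ "a \<oplus> b"]) auto
    qed
    show "c \<odot> x \<in> ?R" if x: "x \<in> ?R" for c x
    proof -
      obtain a where "x = ?D a" "a \<in> carrier H" using x by blast
      then show ?thesis using bop_smult[OF D, of a c] by (intro image_eqI[of _ _ "c \<odot> a"]) auto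
    qed
  qed
  have RE: "?R \<subseteq> carrier (defect_space H S)"
    using closure_of_subset[of ?R "htop H"] R by (simp add: defect_space_def)
  show "x \<in> carrier H" if "x \<in> carrier (defect_space H S)" for x
    using that closure_iff[OF R] by (simp add: defect_space_def)
  show "bounded_operator H (defect_space H S) ?D"
    using D RE unfolding bounded_operator_def by (auto simp: defect_space_def)
  fix x assume x: "x \<in> carrier (defect_space H S)"
    and 0: "\<And>h. h \<in> carrier H \<Longrightarrow> hinner H (?D h) x = 0"
  have "x \<in> htop H closure_of ?R" using x by (simp add: defect_space_def)
  then obtain f where f: "\<And>k. f k \<in> ?R" "hlim f x" using closure_iff_hlim[OF R] by blast
  have xc: "x \<in> carrier H" using f(2) by (simp add: hlim_def)
  have "hinner H (f k) x = 0" for k using f(1)[of k] 0 by auto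
  then have "hinner H x x = 0" using LIMSEQ_unique[OF hlim_inner[OF f(2) xc]] by simp
  then show "x = \<zero>" using xc by (rule inner_self_eq_0D[rotated])
qed

end

section \<open>Isometries given by their action on coefficients\<close>

context tensor_model
begin

text \<open>Parseval gives the isometry. The adjoint drops the coefficient of index 0 and moves the
  others down, so the squared norm of its j-th power at F is a tail of the Parseval series.\<close>

lemma shift_pure_isometry:
  assumes V: "bounded_operator K K V"
    and co: "\<And>F k. F \<in> carrier K \<Longrightarrow> coord k (V F) = (if k < 1 then \<zero>\<^bsub>E\<^esub> else coord (k - 1) F)"
    and Ve: "\<And>k x. x \<in> carrier E \<Longrightarrow> V (e k x) = e (k + 1) x"
  shows "pure_isometry K V"
proof -
  have norm: "hnorm K (V F) = hnorm K F" if F: "F \<in> carrier K" for F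
  proof (rule power2_eq_imp_eq)
    show "(hnorm K (V F))\<^sup>2 = (hnorm K F)\<^sup>2"
      unfolding Parseval[OF bop_closed[OF V F]] Parseval[OF F]
      using suminf_split_initial_segment[OF coord_summable[OF bop_closed[OF V F]], of 1] F
      by (simp add: co)
  qed (use F bop_closed[OF V F] in auto)
  let ?a = "hadjoint K K V"
  have ac: "?a F \<in> carrier K" if "F \<in> carrier K" for F by (rule K.self.hadjoint(1)[OF V that])
  have aco: "coord k (?a F) = coord (k + 1) F" if F: "F \<in> carrier K" for F k
  proof (rule coord_eqI)
    fix x assume x: "x \<in> carrier E"
    have "hinner K (e k x) (?a F) = hinner K (V (e k x)) F"
      using K.self.hadjoint(2)[OF V F, of "e k x"] x by simp
    then show "hinner K (e k x) (?a F) = hinner E x (coord (k + 1) F)"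
      using Ve[OF x] coord_inner[OF F x] by simp
  qed (use F ac in auto)
  have pc: "(?a ^^ j) F \<in> carrier K \<and> (\<forall>k. coord k ((?a ^^ j) F) = coord (k + j) F)" if F: "F \<in> carrier K" for F j
    by (induction j) (use F ac aco in auto)
  have "K.hlim (\<lambda>j. (?a ^^ j) F) \<zero>\<^bsub>K\<^esub>" if F: "F \<in> carrier K" for F
  proof (rule K.hlimI)
    let ?b = "\<lambda>k. (hnorm E (coord k F))\<^sup>2"
    have "(\<lambda>j. suminf ?b - (\<Sum>k<j. ?b k)) \<longlonglongrightarrow> suminf ?b - suminf ?b"
      by (intro tendsto_intros summable_LIMSEQ coord_summable F)
    moreover have "(hnorm K ((?a ^^ j) F))\<^sup>2 = suminf ?b - (\<Sum>k<j. ?b k)" for j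
    proof -
      have "(hnorm K ((?a ^^ j) F))\<^sup>2 = (\<Sum>k. (hnorm E (coord k ((?a ^^ j) F)))\<^sup>2)"
        by (rule Parseval) (use pc[OF F] in blast)
      also have "\<dots> = (\<Sum>k. ?b (k + j))" using pc[OF F, of j] by simp
      also have "\<dots> = suminf ?b - (\<Sum>k<j. ?b k)" by (rule suminf_minus_initial_segment[OF coord_summable[OF F]])
      finally show ?thesis .
    qed
    ultimately have "(\<lambda>j. (hnorm K ((?a ^^ j) F))\<^sup>2) \<longlonglongrightarrow> 0" by simp
    then have "(\<lambda>j. sqrt ((hnorm K ((?a ^^ j) F))\<^sup>2)) \<longlonglongrightarrow> sqrt 0" by (rule tendsto_real_sqrt)
    then show "(\<lambda>j. hnorm K ((?a ^^ j) F \<ominus>\<^bsub>K\<^esub> \<zero>\<^bsub>K\<^esub>)) \<longlonglongrightarrow> 0" using pc[OF F] by simp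
    show "(?a ^^ j) F \<in> carrier K" for j using pc[OF F] by blast
  qed simp
  moreover have "limitin (htop K) (\<lambda>j. (?a ^^ j) F) \<zero>\<^bsub>K\<^esub> sequentially \<longleftrightarrow> K.hlim (\<lambda>j. (?a ^^ j) F) \<zero>\<^bsub>K\<^esub>"
    if "F \<in> carrier K" for F
    by (rule K.limitin_iff_hlim) (use pc[OF that] in blast)
  ultimately have "strongly_stable_adjoint K V" unfolding strongly_stable_adjoint_def by blast
  then show ?thesis using V norm by (simp add: pure_isometry_def hisometry_def)
qed

text \<open>\<open>K\<close> embeds in the two-sided sequence space over \<open>e 0 ` carrier E\<close>, on which the Laurent
  operators with the same coefficients extend \<open>V\<close>.\<close>

lemma Theta_isometryI:
  fixes A :: "nat \<Rightarrow> nat \<Rightarrow> 'h \<Rightarrow> 'h" and V :: "nat \<Rightarrow> 'k \<Rightarrow> 'k"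
  assumes n: "n \<ge> 2" "m \<ge> 1" "p \<ge> 1" "p dvd m"
    and A: "\<And>i l. i \<in> {1..n-1} \<Longrightarrow> l \<le> p \<Longrightarrow> bounded_operator E E (A i l)"
    and adj: "\<And>i l x y. i \<in> {1..n-1} \<Longrightarrow> l \<le> p \<Longrightarrow> x \<in> carrier E \<Longrightarrow> y \<in> carrier E \<Longrightarrow>
      hinner E (A i l x) y = hinner E x (A (n - i) (p - l) y)"
    and comm: "\<And>i j z x. i \<in> {1..n-1} \<Longrightarrow> j \<in> {1..n-1} \<Longrightarrow> cmod z = 1 \<Longrightarrow> x \<in> carrier E \<Longrightarrow>
      symbol_at E p (A i) z (symbol_at E p (A j) z x) = symbol_at E p (A j) z (symbol_at E p (A i) z x)"
    and bound: "\<And>z t. cmod z = 1 \<Longrightarrow> cmod t > 1 \<Longrightarrow> \<exists>c>0. \<forall>x\<in>carrier E. c * hnorm E x \<le>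
      hnorm E (t ^ (n - 1) \<odot>\<^bsub>E\<^esub> x \<oplus>\<^bsub>E\<^esub> finsum E (\<lambda>i. ((-1) ^ i * (of_nat (n - i) / of_nat n) * t ^ (n - 1 - i))
        \<odot>\<^bsub>E\<^esub> symbol_at E p (A i) z x) {1..n-1})"
    and V: "\<And>i. i \<in> {1..n} \<Longrightarrow> bounded_operator K K (V i)"
    and Ve: "\<And>i k x. i \<in> {1..n-1} \<Longrightarrow> x \<in> carrier E \<Longrightarrow> V i (e k x) = finsum K (\<lambda>l. e (k + l) (A i l x)) {..p}"
    and Vn: "\<And>k x. x \<in> carrier E \<Longrightarrow> V n (e k x) = e (k + 1) x"
  shows "Theta_isometry n m p K V"
proof -
  \<comment> \<open>A copy of E inside K: sequences over G have type
    \<open>int \<Rightarrow> 'k\<close>, as \<open>Theta_isometry\<close> demands, whereas E lives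
    on \<open>'h\<close>.\<close>
  define G where "G = K\<lparr>carrier := e 0 ` carrier E\<rparr>"
  have Gs [simp]: "carrier G = e 0 ` carrier E" "x \<oplus>\<^bsub>G\<^esub> y = x \<oplus>\<^bsub>K\<^esub> y" "c \<odot>\<^bsub>G\<^esub> x = c \<odot>\<^bsub>K\<^esub> x"
    "\<zero>\<^bsub>G\<^esub> = \<zero>\<^bsub>K\<^esub>" "hinner G x y = hinner K x y" "hnorm G x = hnorm K x" for x y c
    by (simp_all add: G_def)
  have e0: "e 0 \<zero>\<^bsub>E\<^esub> = \<zero>\<^bsub>K\<^esub>" by (rule EK.bop_zero[OF e_bounded])
  have "hilbert G"
    unfolding G_def
  proof (rule K.subspace_hilbert)
    show "\<zero>\<^bsub>K\<^esub> \<in> e 0 ` carrier E" using e0 by (intro image_eqI[of _ _ "\<zero>\<^bsub>E\<^esub>"]) auto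
    show "x \<oplus>\<^bsub>K\<^esub> y \<in> e 0 ` carrier E" if xy: "x \<in> e 0 ` carrier E" "y \<in> e 0 ` carrier E" for x y
    proof -
      obtain a b where "x = e 0 a" "y = e 0 b" "a \<in> carrier E" "b \<in> carrier E" using xy by blast
      then show ?thesis using bop_add[OF e_bounded, of a b] by (intro image_eqI[of _ _ "a \<oplus>\<^bsub>E\<^esub> b"]) auto
    qed
    show "c \<odot>\<^bsub>K\<^esub> x \<in> e 0 ` carrier E" if x: "x \<in> e 0 ` carrier E" for c x
    proof -
      obtain a where "x = e 0 a" "a \<in> carrier E" using x by blast
      then show ?thesis using bop_smult[OF e_bounded, of a] by (intro image_eqI[of _ _ "c \<odot>\<^bsub>E\<^esub> a"]) auto
    qed
    fix f x assume f: "\<And>k. f k \<in> e 0 ` carrier E" and x: "K.hlim f x"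
    have "e 0 (coord 0 (f k)) = f k" for k using f[of k] by (auto simp: coord_e)
    moreover have "K.hlim (\<lambda>k. e 0 (coord 0 (f k))) (e 0 (coord 0 x))"
      by (rule EK.bop_hlim[OF e_bounded two_hilbert.bop_hlim[OF _ coord_bounded x]])
        (simp add: two_hilbert_def E.hilbert_axioms K.hilbert_axioms)
    ultimately have "K.hlim f (e 0 (coord 0 x))" by simp
    then have "x = e 0 (coord 0 x)" using x K.hlim_unique by blast
    moreover have "x \<in> carrier K" using x by (simp add: K.hlim_def)
    ultimately show "x \<in> e 0 ` carrier E" by (metis coord_closed imageI)
  qed auto
  then interpret G: hilbert G .
  interpret EG: two_hilbert E G ..
  interpret L: hilbert "ell2 G" by (rule G.ell2_hilbert)
  interpret KL: two_hilbert K "ell2 G" ..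
  have e_EG: "bounded_operator E G (e 0)"
    by (rule bounded_operatorI[where C = 1]) (auto simp: bop_add[OF e_bounded] bop_smult[OF e_bounded])
  have c_GE: "bounded_operator G E (coord 0)"
    by (rule bounded_operatorI[where C = 1])
      (auto simp: coord_e simp flip: bop_add[OF e_bounded] bop_smult[OF e_bounded])
  \<comment> \<open>The coefficients transported to G along the unitary \<open>e 0\<close>, whose
    inverse is \<open>coord 0\<close>.\<close>
  define A' where "A' i l y = e 0 (A i l (coord 0 y))" for i l y
  have A'e: "A' i l (e 0 x) = e 0 (A i l x)" if "x \<in> carrier E" for i l x
    using that by (simp add: A'_def coord_e)
  have A': "bounded_operator G G (A' i l)" if "i \<in> {1..n-1}" "l \<le> p" for i l
    unfolding A'_def
    by (rule bounded_operator_comp[OF G.hilbert_axioms E.hilbert_axioms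
          bounded_operator_comp[OF G.hilbert_axioms E.hilbert_axioms c_GE A[OF that]] e_EG])
  have Ac: "A i l x \<in> carrier E" if "i \<in> {1..n-1}" "l \<le> p" "x \<in> carrier E" for i l x
    using bop_closed[OF A] that by blast
  have sym_c: "symbol_at E p (A i) z x \<in> carrier E" if "i \<in> {1..n-1}" "x \<in> carrier E" for i z x
    unfolding symbol_at_def using that Ac by (intro E.finsum_closed) auto
  have sym: "symbol_at G p (A' i) z (e 0 x) = e 0 (symbol_at E p (A i) z x)"
    if i: "i \<in> {1..n-1}" and x: "x \<in> carrier E" for i z x
  proof -
    have "e 0 (symbol_at E p (A i) z x) = finsum G (\<lambda>l. e 0 (z ^ l \<odot>\<^bsub>E\<^esub> A i l x)) {..p}"
      unfolding symbol_at_def by (rule EG.bop_finsum[OF e_EG]) (use Ac[OF i _ x] in auto)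
    also have "\<dots> = symbol_at G p (A' i) z (e 0 x)"
      unfolding symbol_at_def
      by (rule G.finsum_cong') (use Ac[OF i _ x] x in \<open>auto simp: A'e simp flip: bop_smult[OF e_bounded]\<close>)
    finally show ?thesis ..
  qed
  define N where "N i = (if i = n then shift 1 else laurent G p (A' i))" for i
  have unit: "Theta_unitary n m p (ell2 G) N"
    unfolding N_def[abs_def]
  proof (rule G.laurent_Theta_unitary[OF n A'])
    show "hinner G (A' i l x) y = hinner G x (A' (n - i) (p - l) y)"
      if i: "i \<in> {1..n-1}" "l \<le> p" and xy: "x \<in> carrier G" "y \<in> carrier G" for i l x y
    proof -
      obtain a b where ab: "x = e 0 a" "y = e 0 b" "a \<in> carrier E" "b \<in> carrier E" using xy by auto
      have "n - i \<in> {1..n-1}" "p - l \<le> p" using i by auto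
      then show ?thesis using ab i Ac adj by (simp add: A'e e_inner)
    qed
    show "symbol_at G p (A' i) z (symbol_at G p (A' j) z x) = symbol_at G p (A' j) z (symbol_at G p (A' i) z x)"
      if "i \<in> {1..n-1}" "j \<in> {1..n-1}" "cmod z = 1" and x: "x \<in> carrier G" for i j z x
    proof -
      obtain a where "x = e 0 a" "a \<in> carrier E" using x by auto
      then show ?thesis using that comm[of i j z a] sym sym_c by simp
    qed
    fix z t :: complex assume z: "cmod z = 1" and t: "1 < cmod t"
    let ?c = "\<lambda>i. (-1) ^ i * (of_nat (n - i) / of_nat n) * t ^ (n - 1 - i) :: complex"
    obtain c where c: "c > 0" "\<And>x. x \<in> carrier E \<Longrightarrow> c * hnorm E x \<le>
      hnorm E (t ^ (n - 1) \<odot>\<^bsub>E\<^esub> x \<oplus>\<^bsub>E\<^esub> finsum E (\<lambda>i. ?c i \<odot>\<^bsub>E\<^esub> symbol_at E p (A i) z x) {1..n-1})"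
      using bound[OF z t] by blast
    have "c * hnorm G x \<le> hnorm G (t ^ (n - 1) \<odot>\<^bsub>G\<^esub> x \<oplus>\<^bsub>G\<^esub>
        finsum G (\<lambda>i. ?c i \<odot>\<^bsub>G\<^esub> symbol_at G p (A' i) z x) {1..n-1})" if x: "x \<in> carrier G" for x
    proof -
      obtain a where a: "x = e 0 a" "a \<in> carrier E" using x by auto
      let ?f = "finsum E (\<lambda>i. ?c i \<odot>\<^bsub>E\<^esub> symbol_at E p (A i) z a) {1..n-1}"
      have fc: "?f \<in> carrier E" by (rule E.finsum_closed) (use sym_c a in auto)
      have "e 0 ?f = finsum G (\<lambda>i. e 0 (?c i \<odot>\<^bsub>E\<^esub> symbol_at E p (A i) z a)) {1..n-1}"
        by (rule EG.bop_finsum[OF e_EG]) (use sym_c a in auto)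
      also have "\<dots> = finsum G (\<lambda>i. ?c i \<odot>\<^bsub>G\<^esub> symbol_at G p (A' i) z x) {1..n-1}"
        by (rule G.finsum_cong') (use sym_c a sym in \<open>auto simp flip: bop_smult[OF e_bounded]\<close>)
      finally have "t ^ (n - 1) \<odot>\<^bsub>G\<^esub> x \<oplus>\<^bsub>G\<^esub> finsum G (\<lambda>i. ?c i \<odot>\<^bsub>G\<^esub> symbol_at G p (A' i) z x) {1..n-1}
          = e 0 (t ^ (n - 1) \<odot>\<^bsub>E\<^esub> a \<oplus>\<^bsub>E\<^esub> ?f)"
        using a fc by (simp add: bop_add[OF e_bounded] bop_smult[OF e_bounded])
      then show ?thesis using c(2)[OF a(2)] a fc by simp
    qed
    then show "\<exists>c>0. \<forall>x\<in>carrier G. c * hnorm G x \<le> hnorm G (t ^ (n - 1) \<odot>\<^bsub>G\<^esub> x \<oplus>\<^bsub>G\<^esub>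
        finsum G (\<lambda>i. ?c i \<odot>\<^bsub>G\<^esub> symbol_at G p (A' i) z x) {1..n-1})" using c(1) by blast
  qed
  \<comment> \<open>The Taylor coefficients, extended by 0 to the negative indices.\<close>
  define J where "J F j = (if j \<ge> 0 then e 0 (coord (nat j) F) else \<zero>\<^bsub>K\<^esub>)" for F and j :: int
  have zG: "\<zero>\<^bsub>K\<^esub> \<in> e 0 ` carrier E" using e0 by (metis E.zero_closed imageI)
  \<comment> \<open>Parseval, reindexed over the nonnegative integers and extended by zero
    terms.\<close>
  have Jsum: "((\<lambda>j. (hnorm G (J F j))\<^sup>2) has_sum (hnorm K F)\<^sup>2) UNIV" if F: "F \<in> carrier K" for F
  proof -
    have "((\<lambda>k. (hnorm E (coord k F))\<^sup>2) has_sum (hnorm K F)\<^sup>2) UNIV"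
      using coord_summable[OF F] summable_sums[OF coord_summable[OF F]] Parseval[OF F]
      by (intro norm_summable_imp_has_sum) auto
    then have "(((\<lambda>j. (hnorm G (J F j))\<^sup>2) \<circ> int) has_sum (hnorm K F)\<^sup>2) UNIV"
      using F by (simp add: J_def o_def)
    then have "((\<lambda>j. (hnorm G (J F j))\<^sup>2) has_sum (hnorm K F)\<^sup>2) (range int)"
      by (subst has_sum_reindex) auto
    moreover have "((\<lambda>j. (hnorm G (J F j))\<^sup>2) has_sum (hnorm K F)\<^sup>2) (range int) \<longleftrightarrow>
        ((\<lambda>j. (hnorm G (J F j))\<^sup>2) has_sum (hnorm K F)\<^sup>2) UNIV"
    proof (rule has_sum_cong_neutral)
      fix j assume "j \<in> UNIV - range int"
      then have "j < 0" by (metis DiffD2 int_nat_eq linorder_not_less rangeI)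
      then show "(hnorm G (J F j))\<^sup>2 = 0" by (simp add: J_def)
    qed auto
    ultimately show ?thesis by blast
  qed
  have Jc: "J F \<in> carrier (ell2 G)" if F: "F \<in> carrier K" for F
    by (rule G.ell2_memI) (use Jsum[OF F] F zG in \<open>auto simp: J_def has_sum_imp_summable\<close>)
  have Jn: "hnorm (ell2 G) (J F) = hnorm K F" if F: "F \<in> carrier K" for F
    by (rule power2_eq_imp_eq)
      (use has_sum_unique[OF G.ell2_norm[OF Jc[OF F]] Jsum[OF F]] F L.norm_nonneg[OF Jc[OF F]] in auto)
  have J: "bounded_operator K (ell2 G) J"
  proof (rule bounded_operatorI[where C = 1])
    show "J (F \<oplus>\<^bsub>K\<^esub> F') = J F \<oplus>\<^bsub>ell2 G\<^esub> J F'" if "F \<in> carrier K" "F' \<in> carrier K" for F F'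
      using that by (auto simp: J_def fun_eq_iff bop_add[OF coord_bounded] bop_add[OF e_bounded])
    have "c \<odot>\<^bsub>K\<^esub> \<zero>\<^bsub>K\<^esub> = \<zero>\<^bsub>K\<^esub>" for c by (rule K.eqI) auto
    then show "J (c \<odot>\<^bsub>K\<^esub> F) = c \<odot>\<^bsub>ell2 G\<^esub> J F" if "F \<in> carrier K" for c F
      using that by (auto simp: J_def fun_eq_iff bop_smult[OF coord_bounded] bop_smult[OF e_bounded])
  qed (use Jc Jn in auto)
  have Je: "J (e k x) j = (if j = int k then e 0 x else \<zero>\<^bsub>K\<^esub>)" if "x \<in> carrier E" for k x j
    using that e0 by (auto simp: J_def coord_e)
  have Nb: "bounded_operator (ell2 G) (ell2 G) (N i)" if "i \<in> {1..n}" for i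
    using unit that by (simp add: Theta_unitary_def commuting_tuple_def)
  \<comment> \<open>\<open>N i\<close> contains only nonnegative powers of the shift, so it maps
    \<open>J (e k x)\<close> to a sequence that still vanishes at negative indices; density does the
    rest.\<close>
  have NJ: "N i (J F) = J (V i F)" if i: "i \<in> {1..n}" and F: "F \<in> carrier K" for i F
  proof (rule KL.bop_eq_on_dense[OF _ e_dense _ _ _ F])
    show "bounded_operator K (ell2 G) (\<lambda>F. N i (J F))"
      by (rule bounded_operator_comp[OF K.hilbert_axioms G.ell2_hilbert J Nb[OF i]])
    show "bounded_operator K (ell2 G) (\<lambda>F. J (V i F))"
      by (rule bounded_operator_comp[OF K.hilbert_axioms K.hilbert_axioms V[OF i] J])
    fix s assume "s \<in> {e k x | k x. x \<in> carrier E}"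
    then obtain k x where s: "s = e k x" and x: "x \<in> carrier E" by blast
    show "N i (J s) = J (V i s)"
    proof (cases "i = n")
      case True
      then show ?thesis using x by (auto simp: N_def s Vn shift_def Je fun_eq_iff)
    next
      case False
      then have ir: "i \<in> {1..n-1}" using i by auto
      have t: "diag (A' i l) (shift (int l) (J (e k x))) = J (e (k + l) (A i l x))" if l: "l \<le> p" for l
      proof
        fix j
        have "A' i l \<zero>\<^bsub>K\<^esub> = \<zero>\<^bsub>K\<^esub>" using G.self.bop_zero[OF A'[OF ir l]] by simp
        then show "diag (A' i l) (shift (int l) (J (e k x))) j = J (e (k + l) (A i l x)) j"
          using x Ac[OF ir l x] by (auto simp: diag_def shift_def Je A'e)
      qed
      have "J (V i s) = finsum (ell2 G) (\<lambda>l. J (e (k + l) (A i l x))) {..p}"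
        unfolding s Ve[OF ir x] by (rule KL.bop_finsum[OF J]) (use Ac[OF ir _ x] in auto)
      also have "\<dots> = finsum (ell2 G) (\<lambda>l. diag (A' i l) (shift (int l) (J (e k x)))) {..p}"
        by (rule L.finsum_cong') (use t Jc Ac[OF ir _ x] in auto)
      finally show ?thesis using False by (simp add: N_def laurent_def s)
    qed
  qed auto
  have "hisometry K (ell2 G) J" using J Jn by (simp add: hisometry_def)
  then show ?thesis
    unfolding Theta_isometry_def
    using V unit NJ G.ell2_hilbert[unfolded hilbert_iff] by blast
qed

end

text \<open>\<open>S\<close> stands for the adjoint of T_n and \<open>D\<close> for its defect
  operator, regarded as a map into the defect space E. \<open>stable\<close> is purity of T_n, and
  \<open>dense\<close> expresses that the range of \<open>D\<close> is dense in E.\<close>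

locale canonical_embedding = H: hilbert H + tensor_model E K tens
  for H :: "'h hspace" and E :: "'h hspace" and K :: "'k hspace"
    and tens :: "(complex \<Rightarrow> complex) \<Rightarrow> 'h \<Rightarrow> 'k" +
  fixes D S :: "'h \<Rightarrow> 'h"
  assumes D: "bounded_operator H E D"
    and S: "bounded_operator H H S"
    and defect: "\<And>x. x \<in> carrier H \<Longrightarrow> (hnorm E (D x))\<^sup>2 = (hnorm H x)\<^sup>2 - (hnorm H (S x))\<^sup>2"
    and stable: "\<And>x. x \<in> carrier H \<Longrightarrow> (\<lambda>k. hnorm H ((S ^^ k) x)) \<longlonglongrightarrow> 0"
    and dense: "\<And>x. x \<in> carrier E \<Longrightarrow> (\<And>h. h \<in> carrier H \<Longrightarrow> hinner E (D h) x = 0) \<Longrightarrow> x = \<zero>\<^bsub>E\<^esub>"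
begin

definition W :: "'h \<Rightarrow> 'k" where
  "W h = hsuminf K (\<lambda>k. e k (D ((S ^^ k) h)))"

lemma Sk: "bounded_operator H H (S ^^ k)"
  by (rule bounded_operator_funpow[OF H.hilbert_axioms S])

lemma DSk [simp]: "h \<in> carrier H \<Longrightarrow> D ((S ^^ k) h) \<in> carrier E"
  by (intro bop_closed[OF D] bop_closed[OF Sk])

lemma defect_sums:
  assumes h: "h \<in> carrier H"
  shows "(\<lambda>k. (hnorm E (D ((S ^^ k) h)))\<^sup>2) sums (hnorm H h)\<^sup>2"
proof -
  have "(\<Sum>k<N. (hnorm E (D ((S ^^ k) h)))\<^sup>2) = (hnorm H h)\<^sup>2 - (hnorm H ((S ^^ N) h))\<^sup>2" for N
    by (induction N) (use h defect bop_closed[OF Sk] in auto)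
  moreover have "(\<lambda>N. (hnorm H h)\<^sup>2 - (hnorm H ((S ^^ N) h))\<^sup>2) \<longlonglongrightarrow> (hnorm H h)\<^sup>2 - 0\<^sup>2"
    by (intro tendsto_intros stable h)
  ultimately show ?thesis by (simp add: sums_def)
qed

lemma W_series:
  assumes h: "h \<in> carrier H"
  shows "hsums K (\<lambda>k. e k (D ((S ^^ k) h))) (W h)" and "W h \<in> carrier K"
    and "coord k (W h) = D ((S ^^ k) h)" and "hnorm K (W h) = hnorm H h"
proof -
  have x: "D ((S ^^ k) h) \<in> carrier E" for k using h by simp
  note s = sums_summable[OF defect_sums[OF h]]
  show "hsums K (\<lambda>k. e k (D ((S ^^ k) h))) (W h)" "W h \<in> carrier K" "coord k (W h) = D ((S ^^ k) h)"
    unfolding W_def by (rule series[OF x s])+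
  have "W h \<in> carrier K" unfolding W_def by (rule series[OF x s])
  then show "hnorm K (W h) = hnorm H h"
    using series(4)[OF x s] sums_unique[OF defect_sums[OF h]] h
      power2_eq_imp_eq[of "hnorm K (W h)" "hnorm H h"] by (simp add: W_def)
qed

lemma W_isometry: "hisometry H K W"
proof -
  have "bounded_operator H K W"
  proof (rule bounded_operatorI[where C = 1])
    show "W (x \<oplus>\<^bsub>H\<^esub> y) = W x \<oplus>\<^bsub>K\<^esub> W y" if "x \<in> carrier H" "y \<in> carrier H" for x y
      by (rule coord_ext) (use that W_series in \<open>auto simp: bop_add[OF coord_bounded] bop_add[OF D]
        bop_add[OF Sk] bop_closed[OF Sk]\<close>)
    show "W (c \<odot>\<^bsub>H\<^esub> x) = c \<odot>\<^bsub>K\<^esub> W x" if "x \<in> carrier H" for c x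
      by (rule coord_ext) (use that W_series in \<open>auto simp: bop_smult[OF coord_bounded] bop_smult[OF D]
        bop_smult[OF Sk] bop_closed[OF Sk]\<close>)
  qed (use W_series in auto)
  then show ?thesis using W_series by (simp add: hisometry_def)
qed

text \<open>The coefficients of W (S h) are those of W h with the first one removed, so W h - V W (S
  h) = z^0 \<otimes> D h. Applying V^k puts z^k \<otimes> D h into the span, and the D h are dense
  in E.\<close>

lemma minimal:
  assumes V: "bounded_operator K K V"
    and co: "\<And>F k. F \<in> carrier K \<Longrightarrow> coord k (V F) = (if k < 1 then \<zero>\<^bsub>E\<^esub> else coord (k - 1) F)"
    and Ve: "\<And>k x. x \<in> carrier E \<Longrightarrow> V (e k x) = e (k + 1) x"
  shows "htop K closure_of (hspan K {(V ^^ k) (W h) | k h. h \<in> carrier H}) = carrier K"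
proof (rule K.dense_spanI)
  have Vk: "bounded_operator K K (V ^^ k)" for k by (rule bounded_operator_funpow[OF K.hilbert_axioms V])
  show "{(V ^^ k) (W h) | k h. h \<in> carrier H} \<subseteq> carrier K" using bop_closed[OF Vk] W_series by auto
  fix G assume G: "G \<in> carrier K"
    and 0: "\<And>s. s \<in> {(V ^^ k) (W h) | k h. h \<in> carrier H} \<Longrightarrow> hinner K s G = 0"
  have "coord k G = \<zero>\<^bsub>E\<^esub>" for k
  proof (rule dense)
    fix h assume h: "h \<in> carrier H"
    have Sh: "S h \<in> carrier H" using bop_closed[OF S h] .
    have Dh: "D h \<in> carrier E" using bop_closed[OF D h] .
    have "e 0 (D h) = W h \<ominus>\<^bsub>K\<^esub> V (W (S h))"
    proof (rule coord_ext)
      fix j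
      have "coord j (W h \<ominus>\<^bsub>K\<^esub> V (W (S h))) = coord j (W h) \<ominus>\<^bsub>E\<^esub> coord j (V (W (S h)))"
        by (rule two_hilbert.bop_diff[OF _ coord_bounded])
          (use h Sh W_series bop_closed[OF V] in \<open>auto simp: two_hilbert_def E.hilbert_axioms K.hilbert_axioms\<close>)
      also have "\<dots> = coord j (e 0 (D h))"
      proof (cases j)
        case 0
        then show ?thesis using h Sh Dh W_series[OF h] W_series[OF Sh] by (simp add: co coord_e)
      next
        case (Suc i)
        have "(S ^^ i) (S h) = S ((S ^^ i) h)" by (simp add: funpow_swap1)
        then show ?thesis using Suc h Sh Dh W_series[OF h] W_series[OF Sh] DSk[OF h, of "Suc i"]
          by (simp add: co coord_e E.minus_eq_zero_iff)
      qed
      finally show "coord j (e 0 (D h)) = coord j (W h \<ominus>\<^bsub>K\<^esub> V (W (S h)))" ..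
    qed (use h Sh Dh W_series bop_closed[OF V] in auto)
    moreover have "(V ^^ k) (e 0 (D h)) = e k (D h)" for k
      by (induction k) (use Dh Ve in auto)
    ultimately have "e k (D h) = (V ^^ k) (W h \<ominus>\<^bsub>K\<^esub> V (W (S h)))" by metis
    also have "\<dots> = (V ^^ k) (W h) \<ominus>\<^bsub>K\<^esub> (V ^^ Suc k) (W (S h))"
      using K.self.bop_diff[OF Vk] W_series[OF h] W_series[OF Sh] bop_closed[OF V] by (simp add: funpow_swap1)
    finally have "hinner K (e k (D h)) G = hinner K ((V ^^ k) (W h)) G - hinner K ((V ^^ Suc k) (W (S h))) G"
      using bop_closed[OF Vk W_series(2)[OF h]] bop_closed[OF Vk W_series(2)[OF Sh], of "Suc k"] G
      by (simp del: funpow.simps)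
    also have "\<dots> = 0" using 0 h Sh by (metis (mono_tags, lifting) diff_self mem_Collect_eq)
    finally show "hinner E (D h) (coord k G) = 0" using coord_inner[OF G Dh] by simp
  qed (use G in simp)
  moreover have "coord k \<zero>\<^bsub>K\<^esub> = \<zero>\<^bsub>E\<^esub>" for k
    by (rule two_hilbert.bop_zero[OF _ coord_bounded]) (simp add: two_hilbert_def E.hilbert_axioms K.hilbert_axioms)
  ultimately show "G = \<zero>\<^bsub>K\<^esub>" by (intro coord_ext G) auto
qed

end

theorem theorem3p4:
  fixes n m p :: nat
    and H :: "'h hspace" and T :: "nat \<Rightarrow> 'h \<Rightarrow> 'h"
    and Ts D :: "'h \<Rightarrow> 'h" and E :: "'h hspace"
    and A :: "nat \<Rightarrow> nat \<Rightarrow> 'h \<Rightarrow> 'h"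
    and K :: "'k hspace" and tens :: "(complex \<Rightarrow> complex) \<Rightarrow> 'h \<Rightarrow> 'k"
    and V :: "nat \<Rightarrow> 'k \<Rightarrow> 'k" and W :: "'h \<Rightarrow> 'k"
  assumes "n \<ge> 2" and "m \<ge> 1" and "p \<ge> 1" and "p dvd m"
    and "hilbert_space H"
    and "pure_Theta_contraction n m p H T"
    and Ts: "Ts = hadjoint H H (T n)"
    and D: "D = defect_operator H Ts"
    and E: "E = defect_space H Ts"
    and A_bounded: "\<And>i l. i \<in> {1..n - 1} \<Longrightarrow> l \<le> p \<Longrightarrow> bounded_operator E E (A i l)"
    and A_adjoint: "\<And>i l x. i \<in> {1..n - 1} \<Longrightarrow> l \<le> p \<Longrightarrow> x \<in> carrier E \<Longrightarrow>
                      A i l x = hadjoint E E (A (n - i) (p - l)) x"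
    and A_fundamental: "\<And>i h. i \<in> {1..n - 1} \<Longrightarrow> h \<in> carrier H \<Longrightarrow>
                      D (hadjoint H H (T i) h) =
                      finsum H (\<lambda>l. hadjoint E E (A i l) (D ((Ts ^^ l) h))) {..p}"
    and K: "hilbert_tensor hardy_space E K tens"
    and V_less: "\<And>i. i \<in> {1..n - 1} \<Longrightarrow>
                   V i = (\<lambda>F. finsum K (\<lambda>l. op_tensor hardy_space E K tens (mult_z ^^ l) (A i l) F) {..p})"
    and V_n: "V n = op_tensor hardy_space E K tens mult_z (\<lambda>x. x)"
    and W: "W = (\<lambda>h. hsuminf K (\<lambda>k. tens (hardy_monom k) (D ((Ts ^^ k) h))))"
  shows "(\<forall>h\<in>carrier H. hsums K (\<lambda>k. tens (hardy_monom k) (D ((Ts ^^ k) h))) (W h)) \<and>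
         hisometry H K W \<and>
         (\<forall>i\<in>{1..n}. \<forall>F\<in>carrier K. hadjoint H K W (V i F) = T i (hadjoint H K W F)) \<and>
         ((\<forall>z. cmod z = 1 \<longrightarrow>
             Gamma_contraction (n - 1) E
               (\<lambda>i x. (of_nat (n - i) / of_nat n) \<odot>\<^bsub>E\<^esub> finsum E (\<lambda>l. z ^ l \<odot>\<^bsub>E\<^esub> A i l x) {..p}))
          \<longrightarrow> Theta_isometric_dilation n m p H T K V W \<and>
              minimal_dilation n H K V W \<and>
              pure_Theta_isometry n m p K V)"
proof -
  interpret H: hilbert H using \<open>hilbert_space H\<close> by (simp add: hilbert_iff)
  have Tc: "commuting_tuple H n T" and pure: "pure_contraction H (T n)"
    and Tcon: "Theta_contraction n m p H T"
    using \<open>pure_Theta_contraction n m p H T\<close>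
    by (simp_all add: pure_Theta_contraction_def Theta_contraction_def spectral_set_def)
  have T: "bounded_operator H H (T i)" if "i \<in> {1..n}" for i
    using Tc that by (simp add: commuting_tuple_def)
  have nn: "n \<in> {1..n}" using \<open>n \<ge> 2\<close> by simp
  have TT: "T i (T n x) = T n (T i x)" if "i \<in> {1..n}" "x \<in> carrier H" for i x
    using Tc that nn by (simp add: commuting_tuple_def)
  have Ts_bounded: "bounded_operator H H Ts" and Ts_contr: "\<And>x. x \<in> carrier H \<Longrightarrow> hnorm H (Ts x) \<le> 1 * hnorm H x"
    unfolding Ts using H.self.bounded_operator_hadjoint[OF T[OF nn], of 1] pure
    by (auto simp: pure_contraction_def)
  have D_bounded: "bounded_operator H H D"
    and D_norm: "\<And>x. x \<in> carrier H \<Longrightarrow> (hnorm H (D x))\<^sup>2 = (hnorm H x)\<^sup>2 - (hnorm H (Ts x))\<^sup>2"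
    unfolding D using H.defect_operator[OF Ts_bounded] Ts_contr by auto
  note ds = H.defect_space[OF D_bounded[unfolded D], folded D E]
  interpret E: hilbert E by (rule ds(1))
  have E_norm [simp]: "hnorm E x = hnorm H x" and E_inner [simp]: "hinner E x y = hinner H x y"
    and E_zero: "\<zero>\<^bsub>E\<^esub> = \<zero>\<^bsub>H\<^esub>" for x y
    by (simp_all add: E defect_space_def)
  interpret K: hilbert K using K by (simp add: hilbert_tensor_def hilbert_iff)
  interpret M: canonical_embedding H E K tens D Ts
  proof unfold_locales
    show "hilbert_tensor hardy_space E K tens" by (rule K)
    show "bounded_operator H E D" by (rule ds(2))
    show "bounded_operator H H Ts" by (rule Ts_bounded)
    show "(hnorm E (D x))\<^sup>2 = (hnorm H x)\<^sup>2 - (hnorm H (Ts x))\<^sup>2" if "x \<in> carrier H" for x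
      using D_norm[OF that] by simp
    show "(\<lambda>k. hnorm H ((Ts ^^ k) x)) \<longlonglongrightarrow> 0" if x: "x \<in> carrier H" for x
    proof -
      have c: "(Ts ^^ k) x \<in> carrier H" for k
        using bop_closed[OF bounded_operator_funpow[OF H.hilbert_axioms Ts_bounded] x] .
      have "limitin (htop H) (\<lambda>k. (Ts ^^ k) x) \<zero>\<^bsub>H\<^esub> sequentially"
        using pure x by (simp add: pure_contraction_def strongly_stable_adjoint_def Ts)
      then have "H.hlim (\<lambda>k. (Ts ^^ k) x) \<zero>\<^bsub>H\<^esub>" using H.limitin_iff_hlim[of "\<lambda>k. (Ts ^^ k) x", OF c] by blast
      then show ?thesis using c by (simp add: H.hlim_def)
    qed
    show "x = \<zero>\<^bsub>E\<^esub>" if "x \<in> carrier E" "\<And>h. h \<in> carrier H \<Longrightarrow> hinner E (D h) x = 0" for x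
      using ds(4)[OF that(1)] that(2) by (simp add: E_zero)
  qed
  have WM: "W = M.W" unfolding W M.W_def M.e_def by simp
  have W_iso: "hisometry H K W" using M.W_isometry by (simp add: WM)
  have W_bounded: "bounded_operator H K W" using W_iso by (simp add: hisometry_def)
  have W_sums: "hsums K (\<lambda>k. tens (hardy_monom k) (D ((Ts ^^ k) h))) (W h)" if "h \<in> carrier H" for h
    using M.W_series(1)[OF that] by (simp add: WM M.e_def)
  note ot = M.op_tensor_mult_z
  have Vn_bounded: "bounded_operator K K (V n)"
    and Vn_coord: "\<And>F k. F \<in> carrier K \<Longrightarrow> M.coord k (V n F) = (if k < 1 then \<zero>\<^bsub>E\<^esub> else M.coord (k - 1) F)"
    and Vn_e: "\<And>k x. x \<in> carrier E \<Longrightarrow> V n (M.e k x) = M.e (k + 1) x"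
    unfolding V_n using ot[OF bounded_operator_id, where l = 1] by simp_all
  have V_bounded: "bounded_operator K K (V i)" if "i \<in> {1..n}" for i
  proof (cases "i = n")
    case False
    then have i: "i \<in> {1..n-1}" using that by auto
    have "bounded_operator K K (\<lambda>F. finsum K (\<lambda>l. op_tensor hardy_space E K tens (mult_z ^^ l) (A i l) F) {..p})"
      by (rule K.self.bounded_operator_finsum) (use ot(1)[OF A_bounded[OF i]] in auto)
    then show ?thesis using V_less[OF i] by simp
  qed (use Vn_bounded in simp)
  have A_closed: "A i l x \<in> carrier E" if "i \<in> {1..n-1}" "l \<le> p" "x \<in> carrier E" for i l x
    using bop_closed[OF A_bounded[OF that(1,2)] that(3)] .
  have V_e: "V i (M.e k x) = finsum K (\<lambda>l. M.e (k + l) (A i l x)) {..p}"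
    if i: "i \<in> {1..n-1}" and x: "x \<in> carrier E" for i k x
    unfolding V_less[OF i]
    by (rule K.finsum_cong') (use ot(3)[OF A_bounded[OF i]] A_closed[OF i] x in auto)
  \<comment> \<open>Adjoint form of the commutation of T_i with T_n. It lets the fundamental
    equation be used at \<open>(Ts ^^ k) h\<close> for the k-th coefficient.\<close>
  have Ti_Ts: "hadjoint H H (T i) ((Ts ^^ k) h) = (Ts ^^ k) (hadjoint H H (T i) h)"
    if i: "i \<in> {1..n}" and h: "h \<in> carrier H" for i k h
  proof (induction k)
    case (Suc k)
    let ?a = "hadjoint H H (T i)"
    have step: "?a (Ts x) = Ts (?a x)" if x: "x \<in> carrier H" for x
    proof (rule H.self.hadjoint_unique)
      show "Ts (?a x) \<in> carrier H" using bop_closed[OF Ts_bounded H.self.hadjoint(1)[OF T[OF i] x]] .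
      fix h assume h: "h \<in> carrier H"
      have "hinner H (T i h) (Ts x) = hinner H (T n (T i h)) x"
        unfolding Ts using H.self.hadjoint(2)[OF T[OF nn] x bop_closed[OF T[OF i] h]] by simp
      also have "\<dots> = hinner H (T i (T n h)) x" using TT[OF i h] by simp
      also have "\<dots> = hinner H (T n h) (?a x)"
        by (rule H.self.hadjoint(2)[OF T[OF i] x bop_closed[OF T[OF nn] h]])
      also have "\<dots> = hinner H h (Ts (?a x))"
        unfolding Ts by (rule H.self.hadjoint(2)[OF T[OF nn] H.self.hadjoint(1)[OF T[OF i] x] h])
      finally show "hinner H (T i h) (Ts x) = hinner H h (Ts (?a x))" .
    qed
    have "(Ts ^^ k) h \<in> carrier H" using bop_closed[OF M.Sk h] .
    then show ?case using step Suc by simp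
  qed simp
  \<comment> \<open>Checked on the k-th coefficient, tested against x in E: the adjoint of
    \<open>V i\<close> moves over to \<open>e k x\<close>, where \<open>V i\<close> gives a finite
    sum of monomials.\<close>
  have dilation: "hadjoint K K (V i) (W h) = W (hadjoint H H (T i) h)"
    if i: "i \<in> {1..n}" and h: "h \<in> carrier H" for i h
  proof (rule M.coord_ext)
    have Wh: "W h \<in> carrier K" using bop_closed[OF W_bounded h] .
    have ah: "hadjoint H H (T i) h \<in> carrier H" by (rule H.self.hadjoint(1)[OF T[OF i] h])
    show VW: "hadjoint K K (V i) (W h) \<in> carrier K" by (rule K.self.hadjoint(1)[OF V_bounded[OF i] Wh])
    show "W (hadjoint H H (T i) h) \<in> carrier K" using bop_closed[OF W_bounded ah] .
    fix k
    have Wc: "M.coord j (W g) = D ((Ts ^^ j) g)" if "g \<in> carrier H" for j g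
      using M.W_series(3)[OF that] by (simp add: WM)
    show "M.coord k (hadjoint K K (V i) (W h)) = M.coord k (W (hadjoint H H (T i) h))"
    proof (rule M.coord_eqI[OF VW])
      show "M.coord k (W (hadjoint H H (T i) h)) \<in> carrier E" using Wc ah by simp
      fix x assume x: "x \<in> carrier E"
      have xH: "x \<in> carrier H" using ds(3)[OF x] .
      have "hinner K (M.e k x) (hadjoint K K (V i) (W h)) = hinner K (V i (M.e k x)) (W h)"
        using K.self.hadjoint(2)[OF V_bounded[OF i] Wh, of "M.e k x"] x by simp
      also have "\<dots> = hinner E x (D ((Ts ^^ k) (hadjoint H H (T i) h)))"
      proof (cases "i = n")
        case True
        have "(Ts ^^ k) (Ts h) = Ts ((Ts ^^ k) h)" by (simp add: funpow_swap1)
        then show ?thesis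
          using True Vn_e[OF x] M.coord_inner[OF Wh x, of "k + 1"] Wc[OF h] by (simp add: Ts)
      next
        case False
        then have ir: "i \<in> {1..n-1}" using i by auto
        \<comment> \<open>Coefficient k + l of W h is coefficient l of W \<open>?h\<close>, so the
          fundamental equation at \<open>?h\<close> sums the terms.\<close>
        let ?h = "(Ts ^^ k) h"
        have hk: "?h \<in> carrier H" using bop_closed[OF M.Sk h] .
        have DE: "D ((Ts ^^ l) ?h) \<in> carrier E" for l using hk by simp
        have sE: "hadjoint E E (A i l) (D ((Ts ^^ l) ?h)) \<in> carrier E" if "l \<le> p" for l
          by (rule E.self.hadjoint(1)[OF A_bounded[OF ir that] DE])
        have "hinner K (V i (M.e k x)) (W h) = (\<Sum>l\<le>p. hinner K (M.e (k + l) (A i l x)) (W h))"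
          unfolding V_e[OF ir x] by (rule K.inner_finsum_left) (use A_closed[OF ir _ x] Wh in auto)
        also have "\<dots> = (\<Sum>l\<le>p. hinner E x (hadjoint E E (A i l) (D ((Ts ^^ l) ?h))))"
        proof (rule sum.cong)
          fix l assume "l \<in> {..p}"
          then have l: "l \<le> p" by simp
          have "(Ts ^^ (k + l)) h = (Ts ^^ l) ?h" by (metis add.commute comp_apply funpow_add)
          then have "hinner K (M.e (k + l) (A i l x)) (W h) = hinner E (A i l x) (D ((Ts ^^ l) ?h))"
            using M.coord_inner[OF Wh A_closed[OF ir l x]] Wc[OF h] by simp
          also have "\<dots> = hinner E x (hadjoint E E (A i l) (D ((Ts ^^ l) ?h)))"
            by (rule E.self.hadjoint(2)[OF A_bounded[OF ir l] DE x])
          finally show "hinner K (M.e (k + l) (A i l x)) (W h) = hinner E x (hadjoint E E (A i l) (D ((Ts ^^ l) ?h)))" .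
        qed simp
        also have "\<dots> = hinner H x (finsum H (\<lambda>l. hadjoint E E (A i l) (D ((Ts ^^ l) ?h))) {..p})"
          unfolding E_inner by (rule H.inner_finsum_right[symmetric]) (use ds(3)[OF sE] xH in auto)
        also have "\<dots> = hinner E x (D (hadjoint H H (T i) ?h))"
          using A_fundamental[OF ir hk] by simp
        finally show ?thesis using Ti_Ts[OF i h] by simp
      qed
      finally show "hinner K (M.e k x) (hadjoint K K (V i) (W h)) = hinner E x (M.coord k (W (hadjoint H H (T i) h)))"
        using Wc[OF ah] by simp
    qed
  qed
  \<comment> \<open>The identity \<open>dilation\<close> after taking adjoints.\<close>
  have intertwine: "hadjoint H K W (V i F) = T i (hadjoint H K W F)"
    if i: "i \<in> {1..n}" and F: "F \<in> carrier K" for i F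
  proof -
    interpret HK: two_hilbert H K ..
    have aF: "hadjoint H K W F \<in> carrier H" by (rule HK.hadjoint(1)[OF W_bounded F])
    show ?thesis
    proof (rule HK.hadjoint_unique[OF bop_closed[OF T[OF i] aF]])
      fix h assume h: "h \<in> carrier H"
      have Wh: "W h \<in> carrier K" using bop_closed[OF W_bounded h] .
      have ah: "hadjoint H H (T i) h \<in> carrier H" by (rule H.self.hadjoint(1)[OF T[OF i] h])
      have "hinner K (W h) (V i F) = hinner K (hadjoint K K (V i) (W h)) F"
        by (rule K.self.hadjoint_left[OF V_bounded[OF i] Wh F, symmetric])
      also have "\<dots> = hinner K (W (hadjoint H H (T i) h)) F" using dilation[OF i h] by simp
      also have "\<dots> = hinner H (hadjoint H H (T i) h) (hadjoint H K W F)"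
        by (rule HK.hadjoint(2)[OF W_bounded F ah])
      also have "\<dots> = hinner H h (T i (hadjoint H K W F))"
        by (rule H.self.hadjoint_left[OF T[OF i] h aF])
      finally show "hinner K (W h) (V i F) = hinner H h (T i (hadjoint H K W F))" .
    qed
  qed
  have "Theta_isometry n m p K V"
    if Gc: "\<And>z. cmod z = 1 \<Longrightarrow> Gamma_contraction (n - 1) E
      (\<lambda>i x. (of_nat (n - i) / of_nat n) \<odot>\<^bsub>E\<^esub> finsum E (\<lambda>l. z ^ l \<odot>\<^bsub>E\<^esub> A i l x) {..p})"
  proof (rule M.Theta_isometryI[where A = A, OF \<open>n \<ge> 2\<close> \<open>m \<ge> 1\<close> \<open>p \<ge> 1\<close> \<open>p dvd m\<close>])
    \<comment> \<open>The weights gamma_i; for 1 <= i < n they are nonzero, so they cancel from the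
      commutation relation.\<close>
    let ?g = "\<lambda>i. of_nat (n - i) / of_nat n :: complex"
    have Gc': "Gamma_contraction (n - 1) E (\<lambda>i x. ?g i \<odot>\<^bsub>E\<^esub> symbol_at E p (A i) z x)" if "cmod z = 1" for z
      using Gc[OF that] by (simp only: symbol_at_def)
    have sb: "bounded_operator E E (symbol_at E p (A i) z)" if "i \<in> {1..n-1}" for i z
      using E.symbol_bounded A_bounded that by blast
    have sc: "symbol_at E p (A i) z x \<in> carrier E" if "i \<in> {1..n-1}" "x \<in> carrier E" for i z x
      using bop_closed[OF sb[OF that(1)] that(2)] .
    show "hinner E (A i l x) y = hinner E x (A (n - i) (p - l) y)"
      if i: "i \<in> {1..n-1}" and l: "l \<le> p" and x: "x \<in> carrier E" and y: "y \<in> carrier E" for i l x y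
    proof -
      \<comment> \<open>The reversal of both indices is an involution, so the adjoint relation may
        be read from either side.\<close>
      have r: "n - i \<in> {1..n-1}" "p - l \<le> p" "n - (n - i) = i" "p - (p - l) = l" using i l by auto
      have "A (n - i) (p - l) y = hadjoint E E (A i l) y" using A_adjoint[OF r(1,2) y] r(3,4) by simp
      then show ?thesis using E.self.hadjoint(2)[OF A_bounded[OF i l] y x] by simp
    qed
    show "symbol_at E p (A i) z (symbol_at E p (A j) z x) = symbol_at E p (A j) z (symbol_at E p (A i) z x)"
      if i: "i \<in> {1..n-1}" and j: "j \<in> {1..n-1}" and z: "cmod z = 1" and x: "x \<in> carrier E" for i j z x
    proof (rule E.eqI)
      have g: "?g i \<noteq> 0" "?g j \<noteq> 0" using i j by auto
      have "commuting_tuple E (n - 1) (\<lambda>i x. ?g i \<odot>\<^bsub>E\<^esub> symbol_at E p (A i) z x)"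
        using Gc'[OF z] by (simp add: Gamma_contraction_def spectral_set_def)
      then have "?g i \<odot>\<^bsub>E\<^esub> symbol_at E p (A i) z (?g j \<odot>\<^bsub>E\<^esub> symbol_at E p (A j) z x)
          = ?g j \<odot>\<^bsub>E\<^esub> symbol_at E p (A j) z (?g i \<odot>\<^bsub>E\<^esub> symbol_at E p (A i) z x)"
        using i j x unfolding commuting_tuple_def by blast
      then have eq: "?g i \<odot>\<^bsub>E\<^esub> (?g j \<odot>\<^bsub>E\<^esub> symbol_at E p (A i) z (symbol_at E p (A j) z x))
          = ?g j \<odot>\<^bsub>E\<^esub> (?g i \<odot>\<^bsub>E\<^esub> symbol_at E p (A j) z (symbol_at E p (A i) z x))"
        using bop_smult[OF sb[OF i] sc[OF j x]] bop_smult[OF sb[OF j] sc[OF i x]] by simp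
      show c: "symbol_at E p (A i) z (symbol_at E p (A j) z x) \<in> carrier E"
        "symbol_at E p (A j) z (symbol_at E p (A i) z x) \<in> carrier E" using sc i j x by auto
      fix v assume v: "v \<in> carrier E"
      have "?g i * (?g j * hinner E (symbol_at E p (A i) z (symbol_at E p (A j) z x)) v)
          = ?g j * (?g i * hinner E (symbol_at E p (A j) z (symbol_at E p (A i) z x)) v)"
        using arg_cong[OF eq, of "\<lambda>y. hinner E y v"] c v by (simp del: E_inner)
      then show "hinner E (symbol_at E p (A i) z (symbol_at E p (A j) z x)) v
          = hinner E (symbol_at E p (A j) z (symbol_at E p (A i) z x)) v"
        using g by (simp del: E_inner add: mult.left_commute)
    qed
    show "\<exists>c>0. \<forall>x\<in>carrier E. c * hnorm E x \<le>
      hnorm E (t ^ (n - 1) \<odot>\<^bsub>E\<^esub> x \<oplus>\<^bsub>E\<^esub> finsum E (\<lambda>i. ((-1) ^ i * ?g i * t ^ (n - 1 - i))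
        \<odot>\<^bsub>E\<^esub> symbol_at E p (A i) z x) {1..n-1})" if z: "cmod z = 1" and t: "cmod t > 1" for z t
    proof -
      \<comment> \<open>The weight moves from the scalar into the operator, because
        \<open>Gamma_contraction_bounded_below\<close> with r = n - 1 speaks of the weighted
        tuple.\<close>
      have "finsum E (\<lambda>i. ((-1) ^ i * ?g i * t ^ (n - 1 - i)) \<odot>\<^bsub>E\<^esub> symbol_at E p (A i) z x) {1..n-1}
          = finsum E (\<lambda>i. ((-1) ^ i * t ^ (n - 1 - i)) \<odot>\<^bsub>E\<^esub> (?g i \<odot>\<^bsub>E\<^esub> symbol_at E p (A i) z x)) {1..n-1}"
        if x: "x \<in> carrier E" for x
      proof (rule E.finsum_cong')
        fix i assume i: "i \<in> {1..n-1}"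
        have eq: "((-1) ^ i * ?g i * t ^ (n - 1 - i)) = ((-1) ^ i * t ^ (n - 1 - i)) * ?g i" by simp
        show "((-1) ^ i * ?g i * t ^ (n - 1 - i)) \<odot>\<^bsub>E\<^esub> symbol_at E p (A i) z x
            = ((-1) ^ i * t ^ (n - 1 - i)) \<odot>\<^bsub>E\<^esub> (?g i \<odot>\<^bsub>E\<^esub> symbol_at E p (A i) z x)"
          unfolding eq by (rule E.smult_assoc[OF sc[OF i x]])
      qed (use sc x in auto)
      then show ?thesis using E.Gamma_contraction_bounded_below[OF Gc'[OF z] t] by simp
    qed
  qed (fact A_bounded V_bounded V_e Vn_e)+
  moreover have "pure_isometry K (V n)"
    by (rule M.shift_pure_isometry[OF Vn_bounded Vn_coord Vn_e])
  moreover have "minimal_dilation n H K V W"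
    unfolding minimal_dilation_def WM by (rule M.minimal[OF Vn_bounded Vn_coord Vn_e])
  ultimately show ?thesis
    using W_sums W_iso intertwine dilation Tcon
    by (simp add: Theta_isometric_dilation_def pure_Theta_isometry_def)
qed

end
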